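(* Let $X$ be a separable Banach space endowed with a non-degenerate centered Gaussian measure $\mu$, with Cameron--Martin space $H$. Let $s>1$, $s'=\frac{s}{s-1}$, $t>s'$, and let $w$ be a function on $X$ with $w>0$ $\mu$-a.e., $w\in W^{1,s}(X,\mu)$ ($w$ being a $(1,s)$-precise version) and $\log w\in W^{1,t}(X,\mu)$. Set $\nu:=w\mu$. Then for every $f\in\mathscr{FC}_b^\infty(X)$ and every $h\in H$, $$\int_X\partial_hf(x)\,d\nu(x)=\int_Xf(x)\left(\hat h(x)-\partial_h\log w(x)\right)d\nu(x).$$
   Context: $H$ has inner product $\langle\cdot,\cdot\rangle_H$ and norm $|\cdot|_H$. $X^*_\mu$ is the closure of $X^*$ in $L^2(X,\mu)$; $R_\mu:X^*_\mu\to X$ is defined by $y^*(R_\mu g)=\int_X g\,y^*\,d\mu$ for $y^*\in X^*$; for $h\in H$, $\hat h$ is the unique element of $X^*_\mu$ with $R_\mu\hat h=h$. $\mathscr{FC}_b^\infty(X)$ is the space of functions $f(x)=\varphi(l_1(x),\dots,l_n(x))$ with $n\in\mathbb{N}$, $\varphi\in C_b^\infty(\mathbb{R}^n)$, $l_i\in X^*$. $\nabla_H$ is the gradient along $H$ and $\partial_h f=\langle\nabla_H f,h\rangle_H$. $W^{1,p}(X,\mu)$ ($p\ge1$) is the completion of $\mathscr{FC}_b^\infty(X)$ in the norm $\|f\|_{L^p(\mu)}+\|\nabla_H f\|_{L^p(\mu;H)}$; $\nabla_H$ extends to it. Precise versions: $L_p$ is the generator in $L^p(X,\mu)$ of the Ornstein--Uhlenbeck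 semigroup $T(t)f(x)=\int_X f(e^{-t}x+(1-e^{-2t})^{1/2}y)\,d\mu(y)$. For $A$ open, $C_{k,p}(A)=\inf\{\|f\|_{L^p(X,\mu)} : (I-L_p)^{-k/2}f\ge1\ \mu\text{-a.e. in }A\}$; for $B$ Borel, $C_{k,p}(B)=\inf\{C_{k,p}(A): B\subseteq A\text{ open}\}$. A $(k,p)$-precise version of $f\in W^{k,p}(X,\mu)$ is a Borel version $\bar f$ that is $C_{k,p}$-quasicontinuous (for each $\varepsilon>0$ there is an open $A$ with $C_{k,p}(A)\le\varepsilon$ and $\bar f|_{X\setminus A}$ continuous) and satisfies $C_{k,p}(\{|\bar f|>r\})\le\frac1r\|(I-L_p)^{k/2}\bar f\|_{L^p(X,\mu)}$ for all $r>0$. *)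

theory Defs
  imports "HOL-Probability.Probability" "HOL-Analysis.Abstract_Euclidean_Space"
begin

section \<open>Gaussian measures\<close>

definition centered_gaussian :: "'a::real_normed_vector measure \<Rightarrow> bool" where
  "centered_gaussian \<mu> \<longleftrightarrow> sets \<mu> = sets borel \<and> prob_space \<mu> \<and>
    (\<forall>l :: 'a \<Rightarrow>\<^sub>L real.
       distr \<mu> borel (blinfun_apply l) = return borel 0 \<or>
       (\<exists>\<sigma>>0. distr \<mu> borel (blinfun_apply l)
              = density lborel (\<lambda>x. ennreal (normal_density 0 \<sigma> x))))"

definition nondegenerate :: "'a::real_normed_vector measure \<Rightarrow> bool" where
  "nondegenerate \<mu> \<longleftrightarrow>
    (\<forall>l :: 'a \<Rightarrow>\<^sub>L real. l \<noteq> 0 \<longrightarrow> distr \<mu> borel (blinfun_apply l) \<noteq> return borel 0)"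

section \<open>\<open>L\<^sup>p\<close> spaces\<close>

text \<open>Elements of \<open>L\<^sup>p\<close> are represented by Borel functions; identification modulo null sets is
  never made explicit.\<close>

definition Lp :: "'a measure \<Rightarrow> real \<Rightarrow> ('a \<Rightarrow> real) set" where
  "Lp \<mu> p = {f \<in> borel_measurable \<mu>. integrable \<mu> (\<lambda>x. \<bar>f x\<bar> powr p)}"

definition Lp_norm :: "'a measure \<Rightarrow> real \<Rightarrow> ('a \<Rightarrow> real) \<Rightarrow> real" where
  "Lp_norm \<mu> p f = (\<integral>x. \<bar>f x\<bar> powr p \<partial>\<mu>) powr (1 / p)"

section \<open>The Cameron--Martin space\<close>

definition dual_closure :: "'a::real_normed_vector measure \<Rightarrow> ('a \<Rightarrow> real) set" where
  "dual_closure \<mu> = {g \<in> Lp \<mu> 2.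
     \<exists>l :: nat \<Rightarrow> 'a \<Rightarrow>\<^sub>L real. (\<lambda>n. Lp_norm \<mu> 2 (\<lambda>x. g x - l n x)) \<longlonglongrightarrow> 0}"

text \<open>The point is unique, because the dual separates points.\<close>
definition R_op :: "'a::real_normed_vector measure \<Rightarrow> ('a \<Rightarrow> real) \<Rightarrow> 'a" where
  "R_op \<mu> g = (SOME z. \<forall>l :: 'a \<Rightarrow>\<^sub>L real. l z = (\<integral>x. g x * l x \<partial>\<mu>))"

definition cameron_martin :: "'a::real_normed_vector measure \<Rightarrow> 'a set" where
  "cameron_martin \<mu> = R_op \<mu> ` dual_closure \<mu>"

text \<open>Determined up to a \<open>\<mu>\<close>-null set.\<close>
definition hat :: "'a::real_normed_vector measure \<Rightarrow> 'a \<Rightarrow> ('a \<Rightarrow> real)" where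
  "hat \<mu> h = (SOME g. g \<in> dual_closure \<mu> \<and> R_op \<mu> g = h)"

definition inner_H :: "'a::real_normed_vector measure \<Rightarrow> 'a \<Rightarrow> 'a \<Rightarrow> real" where
  "inner_H \<mu> h k = (\<integral>x. hat \<mu> h x * hat \<mu> k x \<partial>\<mu>)"

definition norm_H :: "'a::real_normed_vector measure \<Rightarrow> 'a \<Rightarrow> real" where
  "norm_H \<mu> h = sqrt (inner_H \<mu> h h)"

section \<open>Smooth cylindrical functions\<close>

text \<open>\<open>\<real>\<^sup>n\<close> is the library's \<open>Euclidean_space n\<close>: real sequences vanishing from index \<open>n\<close> on, with
  the product topology. For a list \<open>is\<close> of indices below \<open>n\<close>, \<open>D is\<close> is the iterated
  partial derivative of \<open>\<phi>\<close> in those directions.\<close>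

definition Cb_infinity :: "nat \<Rightarrow> ((nat \<Rightarrow> real) \<Rightarrow> real) \<Rightarrow> bool" where
  "Cb_infinity n \<phi> \<longleftrightarrow> (\<exists>D :: nat list \<Rightarrow> (nat \<Rightarrow> real) \<Rightarrow> real.
     (\<forall>v \<in> topspace (Euclidean_space n). D [] v = \<phi> v) \<and>
     (\<forall>is \<in> lists {..<n}.
        continuous_map (Euclidean_space n) euclideanreal (D is) \<and>
        bounded (D is ` topspace (Euclidean_space n)) \<and>
        (\<forall>i<n. \<forall>v \<in> topspace (Euclidean_space n).
           ((\<lambda>t. D is (v(i := t))) has_real_derivative D (i # is) v) (at (v i)))))"

definition FCb :: "('a::real_normed_vector \<Rightarrow> real) set" where
  "FCb = {f. \<exists>n \<phi> (l :: nat \<Rightarrow> 'a \<Rightarrow>\<^sub>L real). Cb_infinity n \<phi> \<and>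
             f = (\<lambda>x. \<phi> (\<lambda>i. if i < n then l i x else 0))}"

section \<open>The gradient along \<open>H\<close> and Sobolev spaces\<close>

definition has_grad_H ::
    "'a::real_normed_vector measure \<Rightarrow> ('a \<Rightarrow> real) \<Rightarrow> 'a \<Rightarrow> 'a \<Rightarrow> bool" where
  "has_grad_H \<mu> f v x \<longleftrightarrow> v \<in> cameron_martin \<mu> \<and>
    (\<forall>e>0. \<exists>d>0. \<forall>h \<in> cameron_martin \<mu>. norm_H \<mu> h < d \<longrightarrow>
       \<bar>f (x + h) - f x - inner_H \<mu> v h\<bar> \<le> e * norm_H \<mu> h)"

definition grad_H :: "'a::real_normed_vector measure \<Rightarrow> ('a \<Rightarrow> real) \<Rightarrow> 'a \<Rightarrow> 'a" where
  "grad_H \<mu> f x = (SOME v. has_grad_H \<mu> f v x)"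

definition partial_H :: "'a::real_normed_vector measure \<Rightarrow> 'a \<Rightarrow> ('a \<Rightarrow> real) \<Rightarrow> 'a \<Rightarrow> real" where
  "partial_H \<mu> h f x = inner_H \<mu> (grad_H \<mu> f x) h"

text \<open>Since \<open>H\<close> is separable, measurability of an \<open>H\<close>-valued map may be tested weakly.\<close>
definition Lp_H :: "'a::real_normed_vector measure \<Rightarrow> real \<Rightarrow> ('a \<Rightarrow> 'a) set" where
  "Lp_H \<mu> p = {G. (\<forall>x. G x \<in> cameron_martin \<mu>) \<and>
     (\<forall>h \<in> cameron_martin \<mu>. (\<lambda>x. inner_H \<mu> (G x) h) \<in> borel_measurable \<mu>) \<and>
     integrable \<mu> (\<lambda>x. norm_H \<mu> (G x) powr p)}"

definition Lp_H_norm :: "'a::real_normed_vector measure \<Rightarrow> real \<Rightarrow> ('a \<Rightarrow> 'a) \<Rightarrow> real" where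
  "Lp_H_norm \<mu> p G = (\<integral>x. norm_H \<mu> (G x) powr p \<partial>\<mu>) powr (1 / p)"

text \<open>\<open>f\<close> is an element of the completion of the cylindrical functions in the Sobolev norm, and
  \<open>G\<close> is a version of its extended gradient. The completion is a subspace of \<open>L\<^sup>p\<close>, and \<open>G\<close>
  depends on \<open>f\<close> only (up to null sets), because the gradient is closable.\<close>
definition has_sobolev_grad ::
    "'a::real_normed_vector measure \<Rightarrow> real \<Rightarrow> ('a \<Rightarrow> real) \<Rightarrow> ('a \<Rightarrow> 'a) \<Rightarrow> bool" where
  "has_sobolev_grad \<mu> p f G \<longleftrightarrow> f \<in> Lp \<mu> p \<and> G \<in> Lp_H \<mu> p \<and>
     (\<exists>F. (\<forall>n. F n \<in> FCb) \<and>
        (\<lambda>n. Lp_norm \<mu> p (\<lambda>x. F n x - f x) + Lp_H_norm \<mu> p (\<lambda>x. grad_H \<mu> (F n) x - G x))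
          \<longlonglongrightarrow> 0)"

definition sobolev :: "'a::real_normed_vector measure \<Rightarrow> real \<Rightarrow> ('a \<Rightarrow> real) set" where
  "sobolev \<mu> p = {f. \<exists>G. has_sobolev_grad \<mu> p f G}"

section \<open>Capacities and precise versions\<close>

definition OU :: "'a::real_normed_vector measure \<Rightarrow> real \<Rightarrow> ('a \<Rightarrow> real) \<Rightarrow> 'a \<Rightarrow> real" where
  "OU \<mu> t f x = (\<integral>y. f (exp (- t) *\<^sub>R x + sqrt (1 - exp (- 2 * t)) *\<^sub>R y) \<partial>\<mu>)"

text \<open>\<open>(I - L\<^sub>p)\<^bsup>-k/2\<^esup>\<close>, where \<open>L\<^sub>p\<close> generates \<open>T(t) = OU \<mu> t\<close> in \<open>L\<^sup>p\<close>, so that \<open>-(I - L\<^sub>p)\<close>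
  generates \<open>e\<^bsup>-t\<^esup> T(t)\<close>: as usual for the generator of a bounded semigroup \<open>S\<close>, its fractional power
  of exponent \<open>-\<alpha> < 0\<close> is \<open>\<Gamma>(\<alpha>)\<^bsup>-1\<^esup>\<close> times the integral of \<open>t\<^bsup>\<alpha> - 1\<^esup> S(t)\<close> over \<open>t > 0\<close>.
  The integral converges for \<open>\<mu>\<close>-almost every point and does not depend on \<open>p\<close>.\<close>
definition neg_pow :: "'a::real_normed_vector measure \<Rightarrow> nat \<Rightarrow> ('a \<Rightarrow> real) \<Rightarrow> 'a \<Rightarrow> real" where
  "neg_pow \<mu> k f x =
     (LBINT t:{0<..}. t powr (real k / 2 - 1) * exp (- t) * OU \<mu> t f x) / Gamma (real k / 2)"

text \<open>\<open>(I - L\<^sub>p)\<^bsup>k/2\<^esup>\<close>, with domain \<open>W\<^bsup>k,p\<^esup>\<close>, is the inverse: \<open>g = (I - L\<^sub>p)\<^bsup>k/2\<^esup> f\<close>.\<close>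
definition is_pos_pow ::
    "'a::real_normed_vector measure \<Rightarrow> nat \<Rightarrow> real \<Rightarrow> ('a \<Rightarrow> real) \<Rightarrow> ('a \<Rightarrow> real) \<Rightarrow> bool" where
  "is_pos_pow \<mu> k p f g \<longleftrightarrow> g \<in> Lp \<mu> p \<and> (AE x in \<mu>. neg_pow \<mu> k g x = f x)"

text \<open>Both infima are over nonempty sets, as the constant function 1 and the whole space
  are admissible.\<close>
definition cap_open :: "'a::real_normed_vector measure \<Rightarrow> nat \<Rightarrow> real \<Rightarrow> 'a set \<Rightarrow> real" where
  "cap_open \<mu> k p A =
     Inf (Lp_norm \<mu> p ` {f \<in> Lp \<mu> p. AE x in \<mu>. x \<in> A \<longrightarrow> neg_pow \<mu> k f x \<ge> 1})"

definition cap :: "'a::real_normed_vector measure \<Rightarrow> nat \<Rightarrow> real \<Rightarrow> 'a set \<Rightarrow> real" where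
  "cap \<mu> k p B = Inf (cap_open \<mu> k p ` {A. open A \<and> B \<subseteq> A})"

definition quasicontinuous ::
    "'a::real_normed_vector measure \<Rightarrow> nat \<Rightarrow> real \<Rightarrow> ('a \<Rightarrow> real) \<Rightarrow> bool" where
  "quasicontinuous \<mu> k p f \<longleftrightarrow>
     (\<forall>e>0. \<exists>A. open A \<and> cap_open \<mu> k p A \<le> e \<and> continuous_on (- A) f)"

definition precise :: "'a::real_normed_vector measure \<Rightarrow> nat \<Rightarrow> real \<Rightarrow> ('a \<Rightarrow> real) \<Rightarrow> bool" where
  "precise \<mu> k p f \<longleftrightarrow> f \<in> borel_measurable borel \<and> quasicontinuous \<mu> k p f \<and>
     (\<exists>g. is_pos_pow \<mu> k p f g \<and>
        (\<forall>r>0. cap \<mu> k p {x. \<bar>f x\<bar> > r} \<le> Lp_norm \<mu> p g / r))"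

end

theory Submission
  imports Defs "HOL-Real_Asymp.Real_Asymp"
begin

text \<open>For \<open>h = R\<^sub>\<mu> e\<close> with \<open>\<sigma> = \<parallel>e\<parallel> > 0\<close> the functionals \<open>l - (l h / \<sigma>\<^sup>2) e\<close> are independent of \<open>e\<close>, so that
  \<open>\<integral> \<partial>\<^sub>h g d\<mu> = \<integral> g e d\<mu>\<close> for cylindrical \<open>g\<close> reduces to one-dimensional Gaussian integration by parts in the
  direction of \<open>e\<close>. Put \<open>u = log w\<close>. The formula is applied to \<open>g = f \<theta>(F)\<close> with \<open>\<theta>(r) = e\<^sup>r / (1 + c e\<^sup>r)\<close>
  bounded and \<open>F\<close> cylindrical, and passed to the limit \<open>F \<rightarrow> u\<close> in \<open>W\<^bsup>1,t\<^esup>\<close> and then \<open>c \<rightarrow> 0\<close>, where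
  \<open>\<theta>(u)\<close> and \<open>\<theta>'(u)\<close> increase to \<open>e\<^sup>u = w\<close>. The dominating functions \<open>w\<close>, \<open>w e\<close> and \<open>w \<bar>G\<bar>\<^sub>H\<close> are integrable
  because \<open>w \<in> L\<^sup>s\<close>, while \<open>e\<close> and \<open>\<bar>G\<bar>\<^sub>H\<close> lie in \<open>L\<^bsup>s'\<^esup>\<close>. This avoids any chain rule for \<open>w\<close> itself.\<close>

section \<open>The Hahn--Banach theorem\<close>

text \<open>Three obstacles shape the argument. Putting \<open>f * \<theta>(F)\<close> back into
  \<open>FCb\<close> would require closure of that class under products and compositions; instead,
  integration by parts is proved for every bounded measurable function of a sequence of functionals
  that has a bounded measurable derivative along \<open>h\<close> alone. Next, \<open>R_op\<close>,
  \<open>hat\<close> and \<open>grad_H\<close> are choices. Their uniqueness rests on the fact that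
  functionals separate points, hence on Hahn-Banach, and the existence of
  \<open>R_op \<mu> g\<close> on a weak vector integral that is built from bounded variances of
  functionals, without any moment of the norm of \<open>x\<close>. Finally, convergence of
  \<open>F\<close> to \<open>u\<close> in the Sobolev norm gives no control of \<open>exp F\<close>.
  The function \<theta> meets two demands at once: \<theta> and its derivative are bounded by
  \<open>1/c\<close>, so that convergence in mean of the gradients suffices for the first limit, and
  also by the exponential, so that at \<open>u\<close> both stay below \<open>w\<close> for every
  \<open>c\<close>, as the second limit requires.\<close>

lemma hahn_banach_extend:
  fixes M :: "('a::real_normed_vector \<times> real) set"
  assumes M: "subspace M" and le: "\<And>x a. (x, a) \<in> M \<Longrightarrow> a \<le> norm x"
  obtains S b where "subspace S" "M \<subseteq> S" "(y, b) \<in> S" "\<And>x a. (x, a) \<in> S \<Longrightarrow> a \<le> norm x"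
proof -
  define A where "A = (\<lambda>(x, a). a - norm (x - y)) ` M"
  define b where "b = Sup A"
  have z: "(0, 0) \<in> M" using subspace_0[OF M] by (simp add: zero_prod_def)
  have add: "(x + x', a + a') \<in> M" if "(x, a) \<in> M" "(x', a') \<in> M" for x x' a a'
    using subspace_add[OF M that] by simp
  have scale: "(c *\<^sub>R x, c * a) \<in> M" if "(x, a) \<in> M" for x a c
    using subspace_scale[OF M that, of c] by simp
  \<comment> \<open>The value \<open>b\<close> at \<open>y\<close> has to be at least every
    \<open>a - norm (x - y)\<close> and at most every \<open>norm (x' + y) - a'\<close>. The two
    families are compatible because \<open>a + a'\<close> is at most \<open>norm (x + x')\<close>,
    in which \<open>y\<close> cancels.\<close>
  have *: "a - norm (x - y) \<le> norm (x' + y) - a'" if "(x, a) \<in> M" "(x', a') \<in> M" for x x' a a'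
    using le[OF add[OF that]] norm_triangle_ineq[of "x - y" "x' + y"] by simp
  have "bdd_above A"
    unfolding A_def using *[OF _ z] by (intro bdd_aboveI[of _ "norm y"]) auto
  then have lower: "a - norm (x - y) \<le> b" if "(x, a) \<in> M" for x a
    unfolding b_def A_def using that by (intro cSup_upper) force+
  have upper: "b \<le> norm (x' + y) - a'" if "(x', a') \<in> M" for x' a'
    unfolding b_def A_def using *[OF _ that] z by (intro cSup_least) auto
  define S where "S = (\<lambda>((x, a), c). (x + c *\<^sub>R y, a + c * b)) ` (M \<times> UNIV)"
  show thesis
  proof
    show "subspace S"
    proof (rule subspaceI)
      show "0 \<in> S"
        unfolding S_def zero_prod_def by (rule image_eqI[of _ _ "((0, 0), 0)"]) (use z in auto)
    next
      fix u v assume "u \<in> S" "v \<in> S"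
      from \<open>u \<in> S\<close> obtain x a c where "(x, a) \<in> M" "u = (x + c *\<^sub>R y, a + c * b)"
        unfolding S_def by auto
      moreover from \<open>v \<in> S\<close> obtain x' a' c' where "(x', a') \<in> M" "v = (x' + c' *\<^sub>R y, a' + c' * b)"
        unfolding S_def by auto
      ultimately show "u + v \<in> S"
        unfolding S_def using add
        by (intro image_eqI[of _ _ "((x + x', a + a'), c + c')"]) (auto simp: algebra_simps)
    next
      fix r :: real and u assume "u \<in> S"
      then obtain x a c where "(x, a) \<in> M" "u = (x + c *\<^sub>R y, a + c * b)"
        unfolding S_def by auto
      then show "r *\<^sub>R u \<in> S"
        unfolding S_def using scale
        by (intro image_eqI[of _ _ "((r *\<^sub>R x, r * a), r * c)"]) (auto simp: algebra_simps)
    qed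
    show "M \<subseteq> S"
      unfolding S_def by (auto intro!: image_eqI[of "(x, a)" _ "((x, a), 0)" for x a])
    show "(y, b) \<in> S"
      unfolding S_def by (rule image_eqI[of _ _ "((0, 0), 1)"]) (use z in auto)
  next
    fix u r assume "(u, r) \<in> S"
    then obtain x a c where x: "(x, a) \<in> M" "u = x + c *\<^sub>R y" "r = a + c * b"
      unfolding S_def by auto
    \<comment> \<open>Homogeneity reduces the coefficient of \<open>y\<close> to 1 or -1, where the
      claim is the upper or the lower estimate of \<open>b\<close> at the rescaled point.\<close>
    consider "c = 0" | "c > 0" | "c < 0" by linarith
    then show "r \<le> norm u"
    proof cases
      case 1 then show ?thesis using x le by simp
    next
      case 2
      have "c * b \<le> c * (norm ((1/c) *\<^sub>R x + y) - (1/c) * a)"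
        using upper[OF scale[OF x(1), of "1/c"]] 2 by (intro mult_left_mono) auto
      also have "\<dots> = norm (c *\<^sub>R ((1/c) *\<^sub>R x + y)) - a"
        using 2 by (subst norm_scaleR) (simp add: right_diff_distrib)
      also have "c *\<^sub>R ((1/c) *\<^sub>R x + y) = u" using 2 x by (simp add: algebra_simps)
      finally show ?thesis using x by simp
    next
      case 3
      have e0: "(-c) * ((-1/c) * a - norm ((-1/c) *\<^sub>R x - y)) \<le> (-c) * b"
        using lower[OF scale[OF x(1), of "-1/c"]] 3 by (intro mult_left_mono) auto
      have e1: "(-c) * ((-1/c) * a - norm ((-1/c) *\<^sub>R x - y)) = a - norm ((-c) *\<^sub>R ((-1/c) *\<^sub>R x - y))"
        using 3 by (subst norm_scaleR) (simp add: right_diff_distrib)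
      have e2: "(-c) *\<^sub>R ((-1/c) *\<^sub>R x - y) = u" using 3 x by (simp add: algebra_simps)
      show ?thesis using e0 unfolding e1 e2 using x(3) by simp
    qed
  qed
qed

text \<open>Partial functionals are represented by their graphs, subspaces of the product with the
  reals, so that extension is inclusion and Zorn's lemma applies. That a graph is single-valued
  follows from \<open>a \<le> norm x\<close> at \<open>x = 0\<close>, used for \<open>a\<close> and
  \<open>- a\<close>. A maximal graph through \<open>(x0, norm x0)\<close> has full domain by the
  one-step extension.\<close>

theorem norming_functional:
  fixes x0 :: "'a::real_normed_vector"
  obtains l :: "'a \<Rightarrow>\<^sub>L real" where "norm l \<le> 1" "l x0 = norm x0"
proof -
  define \<A> where "\<A> = {S :: ('a \<times> real) set. subspace S \<and> (x0, norm x0) \<in> S \<and> (\<forall>(x, a)\<in>S. a \<le> norm x)}"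
  have "\<exists>M\<in>\<A>. \<forall>X\<in>\<A>. M \<subseteq> X \<longrightarrow> X = M"
  proof (rule subset_Zorn_nonempty)
    \<comment> \<open>The starting graph sends \<open>c *\<^sub>R x0\<close> to
      \<open>c * norm x0\<close>, which the norm dominates since
      \<open>c \<le> \<bar>c\<bar>\<close>.\<close>
    have "span {(x0, norm x0)} \<in> \<A>"
      unfolding \<A>_def
      by (intro CollectI conjI span_base subspace_span)
         (auto simp: span_singleton intro!: mult_right_mono)
    then show "\<A> \<noteq> {}" by blast
  next
    fix \<C> assume ne: "\<C> \<noteq> {}" and ch: "subset.chain \<A> \<C>"
    then have sub: "\<C> \<subseteq> \<A>" by (simp add: subset.chain_def)
    have tot: "X \<subseteq> Y \<or> Y \<subseteq> X" if "X \<in> \<C>" "Y \<in> \<C>" for X Y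
      using ch that by (auto simp: subset_chain_def)
    have "subspace (\<Union>\<C>)"
    proof (rule subspaceI)
      show "0 \<in> \<Union>\<C>"
        using ne sub by (auto simp: \<A>_def dest!: subspace_0)
    next
      fix x y assume "x \<in> \<Union>\<C>" "y \<in> \<Union>\<C>"
      then obtain X Y where XY: "X \<in> \<C>" "Y \<in> \<C>" "x \<in> X" "y \<in> Y" by auto
      then have "\<exists>Z\<in>\<C>. x \<in> Z \<and> y \<in> Z" using tot by blast
      then obtain Z where "Z \<in> \<C>" "x \<in> Z" "y \<in> Z" by blast
      moreover from this have "subspace Z" using sub by (auto simp: \<A>_def)
      ultimately show "x + y \<in> \<Union>\<C>" using subspace_add by blast
    next
      fix c x assume "x \<in> \<Union>\<C>"
      then obtain Z where "Z \<in> \<C>" "x \<in> Z" by blast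
      moreover from this have "subspace Z" using sub by (auto simp: \<A>_def)
      ultimately show "c *\<^sub>R x \<in> \<Union>\<C>" using subspace_scale by blast
    qed
    then show "\<Union>\<C> \<in> \<A>"
      using ne sub unfolding \<A>_def by fast
  qed
  then obtain M where MA: "M \<in> \<A>" and max: "\<And>X. X \<in> \<A> \<Longrightarrow> M \<subseteq> X \<Longrightarrow> X = M" by blast
  have M: "subspace M" and x0: "(x0, norm x0) \<in> M" and le: "\<And>x a. (x, a) \<in> M \<Longrightarrow> a \<le> norm x"
    using MA unfolding \<A>_def by auto
  have ex: "\<exists>b. (y, b) \<in> M" for y
  proof -
    obtain S b where S: "subspace S" "M \<subseteq> S" "(y, b) \<in> S" "\<And>x a. (x, a) \<in> S \<Longrightarrow> a \<le> norm x"
      using hahn_banach_extend[OF M le, of y] by blast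
    then have "S \<in> \<A>" unfolding \<A>_def using x0 by auto
    then show ?thesis using max S by blast
  qed
  have eq: "a = b" if "(y, a) \<in> M" "(y, b) \<in> M" for y a b
  proof -
    have "(0, a - b) \<in> M" "(0, b - a) \<in> M"
      using subspace_diff[OF M that] subspace_diff[OF M that(2,1)] by auto
    then show ?thesis using le[of 0 "a - b"] le[of 0 "b - a"] by simp
  qed
  define L where "L y = (THE b. (y, b) \<in> M)" for y
  have L: "(y, L y) \<in> M" for y
    unfolding L_def using ex[of y] eq by (metis theI)
  have Leq: "L y = b" if "(y, b) \<in> M" for y b
    using eq[OF L that] .
  have "linear L"
  proof (rule linearI)
    show "L (x + y) = L x + L y" for x y
      using subspace_add[OF M L L, of x y] by (intro Leq) simp
    show "L (c *\<^sub>R x) = c *\<^sub>R L x" for c x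
      using subspace_scale[OF M L, of c x] by (intro Leq) simp
  qed
  have bd: "norm (L x) \<le> norm x * 1" for x
    using le[OF L, of x] le[OF L, of "- x"] linear_neg[OF \<open>linear L\<close>, of x] by auto
  have bl: "bounded_linear L"
    using \<open>linear L\<close> bd by (intro bounded_linear_intro[where K=1]) (auto simp: linear_add linear_scale)
  show thesis
  proof (rule that[of "Blinfun L"])
    show "norm (Blinfun L) \<le> 1"
      using bd by (intro norm_blinfun_bound) (auto simp: bounded_linear_Blinfun_apply[OF bl])
    show "Blinfun L x0 = norm x0"
      using Leq[OF x0] by (simp add: bounded_linear_Blinfun_apply[OF bl])
  qed
qed

lemma dual_separates_points:
  fixes x y :: "'a::real_normed_vector"
  assumes "\<And>l :: 'a \<Rightarrow>\<^sub>L real. l x = l y"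
  shows "x = y"
proof -
  obtain l :: "'a \<Rightarrow>\<^sub>L real" where "l (x - y) = norm (x - y)"
    using norming_functional by blast
  with assms[of l] show ?thesis by (simp add: blinfun.diff_right)
qed

section \<open>Joint distributions and characteristic functions\<close>

text \<open>Divided by its common total mass, \<open>Z\<close> is a probability density, and
  \<open>Levy_uniqueness\<close> applies to the laws of \<open>Y\<close> under the two weighted
  measures. The phase \<open>c\<close> lets real cosines carry the whole characteristic function:
  \<open>c = 0\<close> gives its real part and \<open>c = - pi/2\<close> its imaginary part. A
  weight of mass 0 vanishes almost everywhere for both measures.\<close>

lemma weighted_distribution_unique:
  fixes M N :: "'b measure" and Y Z :: "'b \<Rightarrow> real"
  assumes fin: "finite_measure M" "finite_measure N" and sets: "sets N = sets M"
    and Z: "Z \<in> borel_measurable M" "\<And>x. 0 \<le> Z x" "\<And>x. Z x \<le> C"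
    and Y: "Y \<in> borel_measurable M"
    and eq: "\<And>r c. (\<integral>x. Z x * cos (r * Y x + c) \<partial>M) = (\<integral>x. Z x * cos (r * Y x + c) \<partial>N)"
    and B: "B \<in> sets borel"
  shows "(\<integral>x. Z x * indicator B (Y x) \<partial>M) = (\<integral>x. Z x * indicator B (Y x) \<partial>N)"
proof -
  define m where "m = (\<integral>x. Z x \<partial>M)"
  have mN: "m = (\<integral>x. Z x \<partial>N)" using eq[of 0 0] by (simp add: m_def)
  have meas: "Z \<in> borel_measurable K" "Y \<in> borel_measurable K" if "sets K = sets M" for K
    using Z(1) Y measurable_cong_sets[OF that refl] by auto
  have intZ: "integrable K (\<lambda>x. Z x * g x)"
    if K: "finite_measure K" "sets K = sets M" and g: "g \<in> borel_measurable K" "\<And>x. \<bar>g x\<bar> \<le> 1" for K g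
  proof (rule finite_measure.integrable_const_bound[OF K(1)])
    show "(\<lambda>x. Z x * g x) \<in> borel_measurable K" using g meas[OF K(2)] by simp
    have "\<bar>Z x\<bar> * \<bar>g x\<bar> \<le> C * 1" for x
      using Z(2,3)[of x] g(2)[of x] by (intro mult_mono) auto
    then show "AE x in K. norm (Z x * g x) \<le> C" by (simp add: abs_mult)
  qed
  show ?thesis
  proof (cases "m = 0")
    case True
    have zero: "(\<integral>x. Z x * indicator B (Y x) \<partial>K) = 0"
      if K: "finite_measure K" "sets K = sets M" and 0: "(\<integral>x. Z x \<partial>K) = 0" for K
    proof -
      note [measurable] = meas[OF K(2)] B
      have "AE x in K. Z x = 0"
        using integral_nonneg_eq_0_iff_AE[of K Z] intZ[OF K, of "\<lambda>_. 1"] 0 Z(2) by simp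
      then have "(\<integral>x. Z x * indicator B (Y x) \<partial>K) = (\<integral>x. 0 \<partial>K)"
        by (intro integral_cong_AE) auto
      then show ?thesis by simp
    qed
    show ?thesis
      using zero[OF fin(1) refl] zero[OF fin(2) sets] True mN m_def by simp
  next
    case False
    have "m \<ge> 0" unfolding m_def using Z(2) by (simp add: integral_nonneg_AE)
    with False have m: "m > 0" by simp
    define D where "D K = distr (density K (\<lambda>x. ennreal (Z x / m))) borel Y" for K
    have rd: "real_distribution (D K)"
      and chr: "char (D K) r = Complex ((\<integral>x. Z x * cos (r * Y x + 0) \<partial>K) / m)
                  ((\<integral>x. Z x * cos (r * Y x + - pi/2) \<partial>K) / m)"
      and msr: "measure (D K) B = (\<integral>x. Z x * indicator B (Y x) \<partial>K) / m"
      if K: "finite_measure K" "sets K = sets M" and K1: "(\<integral>x. Z x \<partial>K) = m" for K r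
    proof -
      note [measurable] = meas[OF K(2)] B
      have "emeasure (density K (\<lambda>x. ennreal (Z x / m))) (space (density K (\<lambda>x. ennreal (Z x / m))))
        = (\<integral>\<^sup>+x. ennreal (Z x / m) \<partial>K)"
        by (simp add: emeasure_density)
      also have "\<dots> = ennreal (\<integral>x. Z x / m \<partial>K)"
        using Z(2) m intZ[OF K, of "\<lambda>_. 1"] by (intro nn_integral_eq_integral) auto
      also have "\<dots> = 1" using K1 m by simp
      finally have "prob_space (density K (\<lambda>x. ennreal (Z x / m)))" by (rule prob_spaceI)
      then interpret P: prob_space "density K (\<lambda>x. ennreal (Z x / m))" .
      show rd': "real_distribution (D K)"
        unfolding D_def real_distribution_def real_distribution_axioms_def
        by (auto intro!: P.prob_space_distr)
      interpret D: real_distribution "D K" by (rule rd')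
      have c1: "char (D K) r = (\<integral>x. (Z x / m) *\<^sub>R iexp (r * Y x) \<partial>K)"
        unfolding char_def D_def using Z(2) m
        by (subst integral_distr; (subst integral_density)?) auto
      have ii: "integrable K (\<lambda>x. (Z x / m) *\<^sub>R iexp (r * Y x))"
      proof (rule finite_measure.integrable_const_bound[OF K(1)])
        show "AE x in K. norm ((Z x / m) *\<^sub>R iexp (r * Y x)) \<le> C / m"
          using Z(2,3) m by (simp add: divide_right_mono del: of_real_mult)
      qed measurable
      have cs: "cos (y + - pi/2) = sin y" for y
        using cos_diff[of y "pi/2"] by simp
      have c2: "(\<integral>x. Re ((Z x / m) *\<^sub>R iexp (r * Y x)) \<partial>K) = (\<integral>x. Z x * cos (r * Y x + 0) \<partial>K) / m"
        by (simp add: Re_exp)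
      have c3: "(\<integral>x. Im ((Z x / m) *\<^sub>R iexp (r * Y x)) \<partial>K) = (\<integral>x. Z x * cos (r * Y x + - pi/2) \<partial>K) / m"
        unfolding cs by (simp add: Im_exp)
      show "char (D K) r = Complex ((\<integral>x. Z x * cos (r * Y x + 0) \<partial>K) / m)
                  ((\<integral>x. Z x * cos (r * Y x + - pi/2) \<partial>K) / m)"
        by (rule complex_eqI)
          (simp_all only: complex.sel c1 integral_Re[OF ii, symmetric] integral_Im[OF ii, symmetric] c2 c3)
      have "measure (D K) B = (\<integral>x. indicator B x \<partial>D K)"
        by simp
      also have "\<dots> = (\<integral>x. (Z x / m) *\<^sub>R indicator B (Y x) \<partial>K)"
        unfolding D_def using Z(2) m
        by (subst integral_distr; (subst integral_density)?) auto
      finally show "measure (D K) B = (\<integral>x. Z x * indicator B (Y x) \<partial>K) / m" by simp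
    qed
    note MN = fin(1) refl m_def[symmetric] fin(2) sets mN[symmetric]
    have "char (D M) r = char (D N) r" for r
      unfolding chr[OF MN(1-3)] chr[OF MN(4-6)] eq ..
    then have "D M = D N"
      by (intro Levy_uniqueness rd ext MN)
    then show ?thesis
      using msr[OF fin(1) refl] msr[OF fin(2) sets] m mN m_def by simp
  qed
qed

text \<open>Cosines are traded for indicators one coordinate at a time: by the induction in
  \<open>key\<close>, the product of the indicators of the first \<open>k\<close> coordinates and
  \<open>cos (a x)\<close>, for any \<open>a\<close> in \<A>, has the same mean under both measures.
  Boxes over finitely many coordinates then determine the law. The class \<A> plays the part of the
  affine combinations of the coordinates; kept abstract, it can record further information such as
  orthogonality.\<close>

lemma joint_distribution_unique:
  fixes M N :: "'b measure" and X :: "nat \<Rightarrow> 'b \<Rightarrow> real" and \<A> :: "('b \<Rightarrow> real) set"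
  assumes fin: "finite_measure M" "finite_measure N" and sets: "sets N = sets M"
    and X: "\<And>k. X k \<in> borel_measurable M"
    and A: "\<And>a. a \<in> \<A> \<Longrightarrow> a \<in> borel_measurable M"
    and zero: "(\<lambda>_. 0) \<in> \<A>"
    and shift: "\<And>a r. a \<in> \<A> \<Longrightarrow> (\<lambda>x. a x + r) \<in> \<A>"
    and add: "\<And>a r k. a \<in> \<A> \<Longrightarrow> (\<lambda>x. a x + r * X k x) \<in> \<A>"
    and eq: "\<And>a. a \<in> \<A> \<Longrightarrow> (\<integral>x. cos (a x) \<partial>M) = (\<integral>x. cos (a x) \<partial>N)"
  shows "distr M (Pi\<^sub>M UNIV (\<lambda>_. borel)) (\<lambda>x k. X k x) = distr N (Pi\<^sub>M UNIV (\<lambda>_. borel)) (\<lambda>x k. X k x)"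
proof -
  have meas: "f \<in> borel_measurable N" if "f \<in> borel_measurable M" for f :: "'b \<Rightarrow> real"
    using that measurable_cong_sets[OF sets refl] by auto
  have bd: "integrable K (\<lambda>x. f x * g x)"
    if "K = M \<or> K = N" "f \<in> borel_measurable M" "g \<in> borel_measurable M"
      "\<And>x. \<bar>f x\<bar> \<le> 1" "\<And>x. \<bar>g x\<bar> \<le> 2" for K and f g :: "'b \<Rightarrow> real"
  proof (rule finite_measure.integrable_const_bound[of _ _ 2])
    show "finite_measure K" using that(1) fin by auto
    have "f \<in> borel_measurable K" "g \<in> borel_measurable K" using that(1-3) meas by blast+
    then show "(\<lambda>x. f x * g x) \<in> borel_measurable K" by simp
    have "\<bar>f x\<bar> * \<bar>g x\<bar> \<le> 1 * 2" for x using that(4,5) by (intro mult_mono) auto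
    then show "AE x in K. norm (f x * g x) \<le> 2" by (simp add: abs_mult)
  qed
  have key: "(\<integral>x. (\<Prod>i<k. indicator (B i) (X i x)) * cos (a x) \<partial>M) =
      (\<integral>x. (\<Prod>i<k. indicator (B i) (X i x)) * cos (a x) \<partial>N)"
    if "\<And>i. B i \<in> sets borel" "a \<in> \<A>" for a k and B :: "nat \<Rightarrow> real set"
    using that(2)
  proof (induction k arbitrary: a)
    case 0
    then show ?case using eq by simp
  next
    case (Suc k)
    note [measurable] = X A that(1)
    define I :: "'b \<Rightarrow> real" where "I x = (\<Prod>i<k. indicator (B i) (X i x))" for x
    have I: "0 \<le> I x" "I x \<le> 1" "\<bar>I x\<bar> \<le> 1" for x
      unfolding I_def by (auto intro!: prod_nonneg prod_le_1 simp: abs_prod)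
    have [measurable]: "I \<in> borel_measurable M" unfolding I_def by measurable
    have IH: "(\<integral>x. I x * cos (b x) \<partial>M) = (\<integral>x. I x * cos (b x) \<partial>N)" if "b \<in> \<A>" for b
      using Suc.IH[OF that] by (simp add: I_def)
    have lin: "(\<lambda>x. r * X k x + c) \<in> \<A>" for r c
      using shift[OF add[OF zero]] by simp
    have 1: "(\<integral>x. I x * cos (r * X k x + c) \<partial>M) = (\<integral>x. I x * cos (r * X k x + c) \<partial>N)" for r c
      by (rule IH[OF lin])
    have ap: "(\<lambda>x. a x + r * X k x + c) \<in> \<A>" for r c
      by (rule shift[OF add[OF Suc.prems]])
    \<comment> \<open>The weight \<open>I x * cos (a x)\<close> may be negative, so
      \<open>1 + cos (a x)\<close> takes the place of the cosine. The product formula turns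
      \<open>cos (a x) * cos (r * X k x + c)\<close> into cosines of the sum and the difference of
      the arguments, which are again in \<A>.\<close>
    have split: "(\<integral>x. I x * (1 + cos (a x)) * cos (r * X k x + c) \<partial>K) =
      (\<integral>x. I x * cos (r * X k x + c) \<partial>K) + ((\<integral>x. I x * cos (a x + r * X k x + c) \<partial>K)
        + (\<integral>x. I x * cos (a x + (- r) * X k x + (- c)) \<partial>K)) / 2" if K: "K = M \<or> K = N" for K r c
    proof -
      have "I x * (1 + cos (a x)) * cos (r * X k x + c) = I x * cos (r * X k x + c) +
        (I x * cos (a x + r * X k x + c) + I x * cos (a x + (- r) * X k x + (- c))) / 2" for x
      proof -
        have "cos (a x) * cos (r * X k x + c) = (cos (a x + r * X k x + c) + cos (a x + (- r) * X k x + (- c))) / 2"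
          using cos_times_cos[of "a x" "r * X k x + c"] by (simp add: algebra_simps)
        then show ?thesis by (simp add: algebra_simps)
      qed
      moreover have "integrable K (\<lambda>x. I x * cos (b x))" if [measurable]: "b \<in> borel_measurable M" for b
        using I by (intro bd[OF K]) (auto intro: order_trans[OF abs_cos_le_one])
      ultimately show ?thesis using Suc.prems by simp
    qed
    have 2: "(\<integral>x. I x * (1 + cos (a x)) * cos (r * X k x + c) \<partial>M) =
      (\<integral>x. I x * (1 + cos (a x)) * cos (r * X k x + c) \<partial>N)" for r c
      unfolding split[of M, OF disjI1[OF refl]] split[of N, OF disjI2[OF refl]] 1 IH[OF ap] ..
    have u1: "(\<integral>x. I x * indicator (B k) (X k x) \<partial>M) = (\<integral>x. I x * indicator (B k) (X k x) \<partial>N)"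
      by (rule weighted_distribution_unique[OF fin sets _ I(1,2) _ 1]) measurable
    have le2: "0 \<le> 1 + cos (a x)" "1 + cos (a x) \<le> 2" for x
      using cos_ge_minus_one[of "a x"] cos_le_one[of "a x"] by linarith+
    have Z: "0 \<le> I x * (1 + cos (a x))" "I x * (1 + cos (a x)) \<le> 2" for x
      using mult_mono[OF I(2)[of x] le2(2)[of x]] I(1)[of x] le2(1)[of x] by auto
    have u2: "(\<integral>x. I x * (1 + cos (a x)) * indicator (B k) (X k x) \<partial>M) =
      (\<integral>x. I x * (1 + cos (a x)) * indicator (B k) (X k x) \<partial>N)"
      using Suc.prems by (intro weighted_distribution_unique[OF fin sets _ Z _ 2]) measurable
    \<comment> \<open>Subtracting the mean with weight \<open>I\<close> from the one with weight
      \<open>I * (1 + cos a)\<close> leaves the signed weight \<open>I * cos a\<close>.\<close>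
    have diff: "(\<integral>x. (\<Prod>i<Suc k. indicator (B i) (X i x)) * cos (a x) \<partial>K) =
      (\<integral>x. I x * (1 + cos (a x)) * indicator (B k) (X k x) \<partial>K) -
      (\<integral>x. I x * indicator (B k) (X k x) \<partial>K)" if K: "K = M \<or> K = N" for K
    proof -
      have "integrable K (\<lambda>x. I x * ((1 + cos (a x)) * indicator (B k) (X k x)))"
        using I le2 Suc.prems by (intro bd[OF K]) (auto split: split_indicator)
      moreover have "integrable K (\<lambda>x. I x * indicator (B k) (X k x))"
        using I by (intro bd[OF K]) (auto split: split_indicator)
      ultimately show ?thesis
        by (subst Bochner_Integration.integral_diff[symmetric]) (auto simp: I_def algebra_simps)
    qed
    show ?case using diff[of M] diff[of N] u1 u2 by simp
  qed
  show ?thesis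
  proof (rule measure_eqI_PiM_infinite)
    have XM: "(\<lambda>x k. X k x) \<in> measurable M (Pi\<^sub>M UNIV (\<lambda>_. borel))"
      using X by (intro measurable_PiM_single') auto
    then have XN: "(\<lambda>x k. X k x) \<in> measurable N (Pi\<^sub>M UNIV (\<lambda>_. borel))"
      using measurable_cong_sets[OF sets refl] by auto
    show "finite_measure (distr M (Pi\<^sub>M UNIV (\<lambda>_. borel)) (\<lambda>x k. X k x))"
      by (rule finite_measure.finite_measure_distr[OF fin(1) XM])
    fix J :: "nat set" and E :: "nat \<Rightarrow> real set"
    assume J: "finite J" and E: "\<And>i. i \<in> J \<Longrightarrow> E i \<in> sets borel"
    \<comment> \<open>A box over the finite set \<open>J\<close> becomes one over the first
      \<open>n\<close> coordinates, with full factors outside \<open>J\<close>; inserting 0 makes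
      \<open>Max\<close> meaningful for empty \<open>J\<close>. The factor \<open>cos 0\<close>
      below is 1 and brings the integral to the shape of \<open>key\<close> for the zero function of
      \<A>.\<close>
    define n where "n = Suc (Max (insert 0 J))"
    define B where "B i = (if i \<in> J then E i else UNIV)" for i
    have B: "B i \<in> sets borel" for i using E by (auto simp: B_def)
    have Jn: "J \<subseteq> {..<n}"
      unfolding n_def using J by (auto simp: less_Suc_eq_le)
    let ?S = "prod_emb UNIV (\<lambda>_. borel) J (Pi\<^sub>E J E) :: (nat \<Rightarrow> real) set"
    have "?S \<in> sets (Pi\<^sub>M UNIV (\<lambda>_. borel))"
      using J E by (intro sets_PiM_I) auto
    have ind: "indicator ?S (\<lambda>k. X k x) = ((\<Prod>i<n. indicator (B i) (X i x)) * cos 0 :: real)" for x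
    proof -
      have "(\<Prod>i<n. indicator (B i) (X i x)) = (if \<forall>i<n. X i x \<in> B i then 1 else (0 :: real))"
        by (auto simp: indicator_def)
      also have "(\<forall>i<n. X i x \<in> B i) \<longleftrightarrow> (\<lambda>k. X k x) \<in> ?S"
        using Jn by (auto simp: B_def prod_emb_def PiE_iff split: if_splits)
      finally show ?thesis by (simp add: indicator_def)
    qed
    have ms: "measure (distr K (Pi\<^sub>M UNIV (\<lambda>_. borel)) (\<lambda>x k. X k x)) ?S =
      (\<integral>x. (\<Prod>i<n. indicator (B i) (X i x)) * cos 0 \<partial>K)"
      if K: "(\<lambda>x k. X k x) \<in> measurable K (Pi\<^sub>M UNIV (\<lambda>_. borel))" for K
    proof -
      have "measure (distr K (Pi\<^sub>M UNIV (\<lambda>_. borel)) (\<lambda>x k. X k x)) ?S =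
        (\<integral>z. indicator ?S z \<partial>distr K (Pi\<^sub>M UNIV (\<lambda>_. borel)) (\<lambda>x k. X k x))"
        by (simp add: space_PiM PiE_UNIV_domain)
      also have "\<dots> = (\<integral>x. indicator ?S (\<lambda>k. X k x) \<partial>K)"
        by (rule integral_distr[OF K]) (use \<open>?S \<in> _\<close> in measurable)
      finally show ?thesis unfolding ind .
    qed
    have "measure (distr M (Pi\<^sub>M UNIV (\<lambda>_. borel)) (\<lambda>x k. X k x)) ?S =
      measure (distr N (Pi\<^sub>M UNIV (\<lambda>_. borel)) (\<lambda>x k. X k x)) ?S"
      unfolding ms[OF XM] ms[OF XN] using key[OF B zero] .
    then show "emeasure (distr M (Pi\<^sub>M UNIV (\<lambda>_. borel)) (\<lambda>x k. X k x)) ?S =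
      emeasure (distr N (Pi\<^sub>M UNIV (\<lambda>_. borel)) (\<lambda>x k. X k x)) ?S"
      by (simp add: finite_measure.emeasure_eq_measure finite_measure.finite_measure_distr fin XM XN)
  qed simp_all
qed

section \<open>Gaussian measures and the Cameron--Martin space\<close>

lemma tendsto_zero_le:
  fixes a b :: "nat \<Rightarrow> real"
  assumes "\<And>n. \<bar>a n\<bar> \<le> b n" "b \<longlonglongrightarrow> 0"
  shows "a \<longlonglongrightarrow> 0"
  by (rule Lim_null_comparison[OF _ assms(2)]) (simp add: assms(1))

section \<open>Square-integrable functions and the Cauchy-Schwarz inequality\<close>

definition L2 :: "'b measure \<Rightarrow> ('b \<Rightarrow> real) set" where
  "L2 M = {f \<in> borel_measurable M. integrable M (\<lambda>x. (f x)\<^sup>2)}"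

lemma L2_mult_integrable:
  assumes "f \<in> L2 M" "g \<in> L2 M"
  shows "integrable M (\<lambda>x. f x * g x)"
proof (rule Bochner_Integration.integrable_bound)
  show "integrable M (\<lambda>x. (f x)\<^sup>2 + (g x)\<^sup>2)" using assms by (simp add: L2_def)
  show "(\<lambda>x. f x * g x) \<in> borel_measurable M" using assms by (auto simp: L2_def)
  have "\<bar>f x * g x\<bar> \<le> (f x)\<^sup>2 + (g x)\<^sup>2" for x
  proof -
    have "2 * (\<bar>f x\<bar> * \<bar>g x\<bar>) \<le> (f x)\<^sup>2 + (g x)\<^sup>2"
      using sum_squares_bound[of "\<bar>f x\<bar>" "\<bar>g x\<bar>"] by simp
    moreover have "0 \<le> \<bar>f x\<bar> * \<bar>g x\<bar>" by simp
    ultimately show ?thesis unfolding abs_mult by linarith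
  qed
  then show "AE x in M. norm (f x * g x) \<le> norm ((f x)\<^sup>2 + (g x)\<^sup>2)"
    by (auto intro: order_trans[OF _ abs_ge_self])
qed

lemma L2_lincomb:
  assumes "f \<in> L2 M" "g \<in> L2 M"
  shows "(\<lambda>x. a * f x + b * g x) \<in> L2 M"
proof -
  have "integrable M (\<lambda>x. a\<^sup>2 * (f x)\<^sup>2 + 2 * a * b * (f x * g x) + b\<^sup>2 * (g x)\<^sup>2)"
    using assms L2_mult_integrable[OF assms] by (simp add: L2_def)
  then have "integrable M (\<lambda>x. (a * f x + b * g x)\<^sup>2)"
    by (simp add: power2_sum power_mult_distrib algebra_simps)
  then show ?thesis using assms by (auto simp: L2_def)
qed

lemma L2_diff:
  assumes "f \<in> L2 M" "g \<in> L2 M"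
  shows "(\<lambda>x. f x - g x) \<in> L2 M"
  using L2_lincomb[OF assms, of 1 "-1"] by simp

lemma L2_integral_lincomb_sq:
  assumes "f \<in> L2 M" "g \<in> L2 M"
  shows "(\<integral>x. (a * f x + b * g x)\<^sup>2 \<partial>M) =
    a\<^sup>2 * (\<integral>x. (f x)\<^sup>2 \<partial>M) + 2 * a * b * (\<integral>x. f x * g x \<partial>M) + b\<^sup>2 * (\<integral>x. (g x)\<^sup>2 \<partial>M)"
proof -
  have "(\<integral>x. (a * f x + b * g x)\<^sup>2 \<partial>M) =
    (\<integral>x. a\<^sup>2 * (f x)\<^sup>2 + 2 * a * b * (f x * g x) + b\<^sup>2 * (g x)\<^sup>2 \<partial>M)"
    by (simp add: power2_sum power_mult_distrib algebra_simps)
  then show ?thesis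
    using assms L2_mult_integrable[OF assms] by (simp add: L2_def)
qed

lemma L2_Cauchy_Schwarz_sq:
  assumes "f \<in> L2 M" "g \<in> L2 M"
  shows "(\<integral>x. f x * g x \<partial>M)\<^sup>2 \<le> (\<integral>x. (f x)\<^sup>2 \<partial>M) * (\<integral>x. (g x)\<^sup>2 \<partial>M)"
proof -
  define A B C where "A = (\<integral>x. (f x)\<^sup>2 \<partial>M)" and "B = (\<integral>x. f x * g x \<partial>M)" and "C = (\<integral>x. (g x)\<^sup>2 \<partial>M)"
  have q: "0 \<le> a\<^sup>2 * A + 2 * a * b * B + b\<^sup>2 * C" for a b
    unfolding A_def B_def C_def L2_integral_lincomb_sq[OF assms, symmetric] by simp
  have A: "A \<ge> 0" "C \<ge> 0" unfolding A_def C_def by simp_all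
  have "B\<^sup>2 \<le> A * C"
  proof (cases "A = 0")
    case True
    have "B = 0"
    proof (rule ccontr)
      assume B: "B \<noteq> 0"
      \<comment> \<open>With \<open>A = 0\<close> the form at \<open>(a, 1)\<close> is
        \<open>2 * a * B + C\<close>, and this \<open>a\<close> makes it -1.\<close>
      define a where "a = - (C + 1) / (2 * B)"
      have "2 * a * B = - (C + 1)" using B by (simp add: a_def)
      with q[of a 1] True show False by simp
    qed
    then show ?thesis using True by simp
  next
    case False
    \<comment> \<open>The form is evaluated at \<open>(- B, A)\<close>, which up to scaling
      minimises it in \<open>a\<close>.\<close>
    have "0 \<le> A * (A * C - B\<^sup>2)"
      using q[of "-B" A] by (simp add: power2_eq_square algebra_simps)
    then show ?thesis using False A by (simp add: zero_le_mult_iff)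
  qed
  then show ?thesis by (simp add: A_def B_def C_def)
qed

lemma L2_Cauchy_Schwarz:
  assumes "f \<in> L2 M" "g \<in> L2 M"
  shows "\<bar>\<integral>x. f x * g x \<partial>M\<bar> \<le> sqrt (\<integral>x. (f x)\<^sup>2 \<partial>M) * sqrt (\<integral>x. (g x)\<^sup>2 \<partial>M)"
  using L2_Cauchy_Schwarz_sq[OF assms]
  by (simp add: real_sqrt_mult[symmetric] real_le_rsqrt)

lemma L2_tendsto_mult:
  assumes "\<And>n. g n \<in> L2 M" "g0 \<in> L2 M" "f \<in> L2 M"
    and lim: "(\<lambda>n. \<integral>x. (g n x - g0 x)\<^sup>2 \<partial>M) \<longlonglongrightarrow> 0"
  shows "(\<lambda>n. \<integral>x. f x * g n x \<partial>M) \<longlonglongrightarrow> (\<integral>x. f x * g0 x \<partial>M)"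
proof -
  have b: "(\<lambda>n. sqrt (\<integral>x. (f x)\<^sup>2 \<partial>M) * sqrt (\<integral>x. (g n x - g0 x)\<^sup>2 \<partial>M)) \<longlonglongrightarrow> 0"
    using tendsto_mult[OF tendsto_const tendsto_real_sqrt[OF lim], of "sqrt (\<integral>x. (f x)\<^sup>2 \<partial>M)"]
    by simp
  have "\<bar>(\<integral>x. f x * g n x \<partial>M) - (\<integral>x. f x * g0 x \<partial>M)\<bar>
      \<le> sqrt (\<integral>x. (f x)\<^sup>2 \<partial>M) * sqrt (\<integral>x. (g n x - g0 x)\<^sup>2 \<partial>M)" for n
  proof -
    have "(\<integral>x. f x * g n x \<partial>M) - (\<integral>x. f x * g0 x \<partial>M) = (\<integral>x. f x * (g n x - g0 x) \<partial>M)"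
      unfolding right_diff_distrib
      by (rule Bochner_Integration.integral_diff[symmetric]; intro L2_mult_integrable assms)
    then show ?thesis
      using L2_Cauchy_Schwarz[OF assms(3) L2_diff[OF assms(1)[of n] assms(2)]] by simp
  qed
  from tendsto_zero_le[OF this b]
  have "(\<lambda>n. (\<integral>x. f x * g n x \<partial>M) - (\<integral>x. f x * g0 x \<partial>M)) \<longlonglongrightarrow> 0" .
  then show ?thesis by (simp add: LIM_zero_iff)
qed

lemma L2_tendsto_square:
  assumes "\<And>n. g n \<in> L2 M" "g0 \<in> L2 M"
    and lim: "(\<lambda>n. \<integral>x. (g n x - g0 x)\<^sup>2 \<partial>M) \<longlonglongrightarrow> 0"
  shows "(\<lambda>n. \<integral>x. (g n x)\<^sup>2 \<partial>M) \<longlonglongrightarrow> (\<integral>x. (g0 x)\<^sup>2 \<partial>M)"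
proof -
  have "(\<integral>x. (g n x - g0 x)\<^sup>2 \<partial>M) = (\<integral>x. (g n x)\<^sup>2 \<partial>M) - 2 * (\<integral>x. g0 x * g n x \<partial>M) + (\<integral>x. (g0 x)\<^sup>2 \<partial>M)" for n
    using L2_integral_lincomb_sq[OF assms(1)[of n] assms(2), of 1 "-1"] by (simp add: mult.commute)
  then have "(\<integral>x. (g n x)\<^sup>2 \<partial>M) = (\<integral>x. (g n x - g0 x)\<^sup>2 \<partial>M) + 2 * (\<integral>x. g0 x * g n x \<partial>M) - (\<integral>x. (g0 x)\<^sup>2 \<partial>M)" for n
    by (simp add: algebra_simps)
  moreover have "(\<lambda>n. (\<integral>x. (g n x - g0 x)\<^sup>2 \<partial>M) + 2 * (\<integral>x. g0 x * g n x \<partial>M) - (\<integral>x. (g0 x)\<^sup>2 \<partial>M))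
    \<longlonglongrightarrow> 0 + 2 * (\<integral>x. g0 x * g0 x \<partial>M) - (\<integral>x. (g0 x)\<^sup>2 \<partial>M)"
    by (intro tendsto_intros lim L2_tendsto_mult assms)
  ultimately show ?thesis by (simp add: power2_eq_square)
qed

text \<open>The characteristic function of a centered normal law, with a phase. Rescaling by
  \<sigma> reduces to the standard normal law, whose characteristic function is real; the sine part
  therefore vanishes and the phase leaves only \<open>cos c\<close>.\<close>

lemma integral_normal_density_cos:
  assumes "\<sigma> > 0"
  shows "(\<integral>y. cos (s * y + c) \<partial>density lborel (\<lambda>x. ennreal (normal_density 0 \<sigma> x))) = exp (- (s * \<sigma>)\<^sup>2 / 2) * cos c"
proof -
  let ?N = "density lborel (\<lambda>x. ennreal (std_normal_density x))"
  define t where "t = s * \<sigma>"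
  interpret prob_space ?N by (rule prob_space_normal_density) simp
  have i: "integrable ?N (\<lambda>y. iexp (t * y))"
    by (intro integrable_const_bound[of _ 1]) auto
  have ch: "(\<integral>y. iexp (t * y) \<partial>?N) = complex_of_real (exp (- t\<^sup>2 / 2))"
    using char_std_normal_distribution unfolding char_def by (metis (no_types))
  have C: "(\<integral>y. cos (t * y) \<partial>?N) = exp (- t\<^sup>2 / 2)"
    using integral_Re[OF i] ch by (simp add: Re_exp)
  have S: "(\<integral>y. sin (t * y) \<partial>?N) = 0"
    using integral_Im[OF i] ch by (simp add: Im_exp)
  have i2: "integrable ?N (\<lambda>y. cos (t * y))" "integrable ?N (\<lambda>y. sin (t * y))"
    by (intro integrable_const_bound[of _ 1]; auto)+
  have dens: "normal_density 0 \<sigma> (\<sigma> * y) * \<sigma> = std_normal_density y" for y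
    using assms by (simp add: normal_density_def real_sqrt_mult power_mult_distrib)
  have "(\<integral>y. cos (s * y + c) \<partial>density lborel (\<lambda>x. ennreal (normal_density 0 \<sigma> x))) =
    (\<integral>y. normal_density 0 \<sigma> y * cos (s * y + c) \<partial>lborel)"
    by (subst integral_density) auto
  also have "\<dots> = (\<integral>y. (normal_density 0 \<sigma> (\<sigma> * y) * \<sigma>) * cos (t * y + c) \<partial>lborel)"
    using assms
    by (subst lborel_integral_real_affine[of \<sigma> _ 0])
       (auto simp: t_def mult_ac simp flip: integral_mult_right_zero)
  also have "\<dots> = (\<integral>y. cos (t * y + c) \<partial>?N)"
    unfolding dens by (subst integral_density) auto
  also have "\<dots> = (\<integral>y. cos c * cos (t * y) - sin c * sin (t * y) \<partial>?N)"
    by (simp add: cos_add mult.commute)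
  also have "\<dots> = exp (- t\<^sup>2 / 2) * cos c"
    using i2 C S by simp
  finally show ?thesis by (simp add: t_def)
qed

section \<open>Functionals and their closure in mean square as Gaussian variables\<close>

locale gaussian_measure =
  fixes \<mu> :: "'a::{banach, second_countable_topology} measure"
  assumes gaussian: "centered_gaussian \<mu>"
begin

lemma sets_mu [measurable_cong, simp]: "sets \<mu> = sets borel"
  using gaussian by (simp add: centered_gaussian_def)

lemma space_mu [simp]: "space \<mu> = UNIV"
  using sets_eq_imp_space_eq[OF sets_mu] by simp

sublocale prob_space \<mu>
  using gaussian by (simp add: centered_gaussian_def)

lemma dual_measurable [measurable]: "blinfun_apply (l :: 'a \<Rightarrow>\<^sub>L real) \<in> borel_measurable borel"
  by (intro borel_measurable_continuous_onI linear_continuous_on blinfun.bounded_linear_right)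

text \<open>Written through the second moment, one formula covers both laws allowed by
  \<open>centered_gaussian\<close>: for the point mass at 0 the variance is 0 and the exponential is
  1. This form also passes to limits in mean square.\<close>

lemma
  fixes l :: "'a \<Rightarrow>\<^sub>L real"
  shows dual_L2: "blinfun_apply l \<in> L2 \<mu>"
    and dual_cos: "(\<integral>x. cos (l x + c) \<partial>\<mu>) = exp (- (\<integral>x. (l x)\<^sup>2 \<partial>\<mu>) / 2) * cos c"
proof -
  have m: "blinfun_apply l \<in> borel_measurable \<mu>" by measurable
  have sq: "(\<integral>x. (l x)\<^sup>2 \<partial>\<mu>) = (\<integral>y. y\<^sup>2 \<partial>distr \<mu> borel l)"
    "integrable \<mu> (\<lambda>x. (l x)\<^sup>2) \<longleftrightarrow> integrable (distr \<mu> borel l) (\<lambda>y. y\<^sup>2)"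
    using m by (simp_all add: integral_distr integrable_distr_eq)
  have cs: "(\<integral>x. cos (l x + c) \<partial>\<mu>) = (\<integral>y. cos (1 * y + c) \<partial>distr \<mu> borel l)"
    using m by (simp add: integral_distr)
  consider "distr \<mu> borel l = return borel 0"
    | \<sigma> where "\<sigma> > 0" "distr \<mu> borel l = density lborel (\<lambda>x. ennreal (normal_density 0 \<sigma> x))"
    using gaussian unfolding centered_gaussian_def by blast
  then have "integrable \<mu> (\<lambda>x. (l x)\<^sup>2) \<and> (\<integral>x. cos (l x + c) \<partial>\<mu>) = exp (- (\<integral>x. (l x)\<^sup>2 \<partial>\<mu>) / 2) * cos c"
  proof cases
    case 1
    have "integrable (return borel (0::real)) (\<lambda>y. y\<^sup>2)"
      by (rule integrableI_bounded) (auto simp: nn_integral_return)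
    then show ?thesis unfolding sq cs 1 by (simp add: integral_return)
  next
    case 2
    have i: "integrable lborel (\<lambda>x. normal_density 0 \<sigma> x * x\<^sup>2)"
      using integrable_normal_moment[OF 2(1), of 0 2] by simp
    have "(\<integral>y. normal_density 0 \<sigma> y * y\<^sup>2 \<partial>lborel) = \<sigma>\<^sup>2"
      using integral_normal_moment_even[OF 2(1), of 0 1] by simp
    then show ?thesis
      unfolding sq cs 2(2) using i integral_normal_density_cos[OF 2(1), of 1 c]
      by (auto simp: integral_density integrable_density)
  qed
  then show "blinfun_apply l \<in> L2 \<mu>" "(\<integral>x. cos (l x + c) \<partial>\<mu>) = exp (- (\<integral>x. (l x)\<^sup>2 \<partial>\<mu>) / 2) * cos c"
    using m by (auto simp: L2_def)
qed

lemma const_L2: "(\<lambda>_. c) \<in> L2 \<mu>"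
  by (simp add: L2_def)

lemma dual_closure_iff:
  "g \<in> dual_closure \<mu> \<longleftrightarrow> g \<in> L2 \<mu> \<and> (\<exists>l :: nat \<Rightarrow> 'a \<Rightarrow>\<^sub>L real. (\<lambda>n. \<integral>x. (g x - l n x)\<^sup>2 \<partial>\<mu>) \<longlonglongrightarrow> 0)"
proof -
  have "Lp_norm \<mu> 2 f = sqrt (\<integral>x. (f x)\<^sup>2 \<partial>\<mu>)" for f
    unfolding Lp_norm_def by (simp add: powr_half_sqrt)
  moreover have "(\<lambda>n. sqrt (X n)) \<longlonglongrightarrow> 0 \<longleftrightarrow> X \<longlonglongrightarrow> 0" if "\<And>n. X n \<ge> 0" for X :: "nat \<Rightarrow> real"
    using tendsto_real_sqrt[of X 0 sequentially] tendsto_power[of "\<lambda>n. sqrt (X n)" 0 sequentially 2] that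
    by auto
  ultimately show ?thesis
    unfolding dual_closure_def Lp_def L2_def by simp
qed

lemma dual_closure_L2: "g \<in> dual_closure \<mu> \<Longrightarrow> g \<in> L2 \<mu>"
  by (simp add: dual_closure_iff)

lemma dual_in_dual_closure: "blinfun_apply (l :: 'a \<Rightarrow>\<^sub>L real) \<in> dual_closure \<mu>"
  unfolding dual_closure_iff by (auto intro!: dual_L2 exI[of _ "\<lambda>_. l"])

lemma dual_closure_lincomb:
  assumes "g \<in> dual_closure \<mu>" "g' \<in> dual_closure \<mu>"
  shows "(\<lambda>x. a * g x + b * g' x) \<in> dual_closure \<mu>"
proof -
  note L = assms[THEN dual_closure_L2]
  obtain l l' :: "nat \<Rightarrow> 'a \<Rightarrow>\<^sub>L real" where l: "(\<lambda>n. \<integral>x. (g x - l n x)\<^sup>2 \<partial>\<mu>) \<longlonglongrightarrow> 0"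
    and l': "(\<lambda>n. \<integral>x. (g' x - l' n x)\<^sup>2 \<partial>\<mu>) \<longlonglongrightarrow> 0"
    using assms unfolding dual_closure_iff by blast
  define k where "k n = a *\<^sub>R l n + b *\<^sub>R l' n" for n
  have b: "(\<lambda>n. 2 * a\<^sup>2 * (\<integral>x. (g x - l n x)\<^sup>2 \<partial>\<mu>) + 2 * b\<^sup>2 * (\<integral>x. (g' x - l' n x)\<^sup>2 \<partial>\<mu>)) \<longlonglongrightarrow> 0"
    using tendsto_add[OF tendsto_mult[OF tendsto_const l, of "2 * a\<^sup>2"] tendsto_mult[OF tendsto_const l', of "2 * b\<^sup>2"]]
    by simp
  have le: "(\<integral>x. ((a * g x + b * g' x) - k n x)\<^sup>2 \<partial>\<mu>)
      \<le> 2 * a\<^sup>2 * (\<integral>x. (g x - l n x)\<^sup>2 \<partial>\<mu>) + 2 * b\<^sup>2 * (\<integral>x. (g' x - l' n x)\<^sup>2 \<partial>\<mu>)" for n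
  proof -
    note D = L2_diff[OF L(1) dual_L2[of "l n"]] L2_diff[OF L(2) dual_L2[of "l' n"]]
    have sq: "((a * g x + b * g' x) - k n x)\<^sup>2 = (a * (g x - l n x) + b * (g' x - l' n x))\<^sup>2" for x
      by (simp add: k_def blinfun.add_left blinfun.scaleR_left algebra_simps)
    have "(\<integral>x. ((a * g x + b * g' x) - k n x)\<^sup>2 \<partial>\<mu>)
      \<le> (\<integral>x. 2 * a\<^sup>2 * (g x - l n x)\<^sup>2 + 2 * b\<^sup>2 * (g' x - l' n x)\<^sup>2 \<partial>\<mu>)"
    proof (rule integral_mono)
      show "integrable \<mu> (\<lambda>x. ((a * g x + b * g' x) - k n x)\<^sup>2)"
        unfolding sq using L2_lincomb[OF D, of a b] by (simp add: L2_def)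
      show "integrable \<mu> (\<lambda>x. 2 * a\<^sup>2 * (g x - l n x)\<^sup>2 + 2 * b\<^sup>2 * (g' x - l' n x)\<^sup>2)"
        using D by (simp add: L2_def)
      show "((a * g x + b * g' x) - k n x)\<^sup>2 \<le> 2 * a\<^sup>2 * (g x - l n x)\<^sup>2 + 2 * b\<^sup>2 * (g' x - l' n x)\<^sup>2" for x
        unfolding sq using sum_squares_bound[of "a * (g x - l n x)" "b * (g' x - l' n x)"]
        by (simp add: power2_sum power_mult_distrib)
    qed
    then show ?thesis using D by (simp add: L2_def)
  qed
  have "\<bar>\<integral>x. ((a * g x + b * g' x) - k n x)\<^sup>2 \<partial>\<mu>\<bar>
      \<le> 2 * a\<^sup>2 * (\<integral>x. (g x - l n x)\<^sup>2 \<partial>\<mu>) + 2 * b\<^sup>2 * (\<integral>x. (g' x - l' n x)\<^sup>2 \<partial>\<mu>)" for n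
    using le[of n] by simp
  from tendsto_zero_le[OF this b]
  have "(\<lambda>n. \<integral>x. ((a * g x + b * g' x) - k n x)\<^sup>2 \<partial>\<mu>) \<longlonglongrightarrow> 0" .
  then show ?thesis
    unfolding dual_closure_iff using L2_lincomb[OF L, of a b] by blast
qed

text \<open>Limits in mean square of centered Gaussian variables are centered Gaussian. The right
  side is continuous under such limits, and so is the left, because the cosine is 1-Lipschitz and on
  a probability space the mean of an absolute value is at most the root mean square.\<close>

lemma dual_closure_cos:
  assumes "g \<in> dual_closure \<mu>"
  shows "(\<integral>x. cos (g x + c) \<partial>\<mu>) = exp (- (\<integral>x. (g x)\<^sup>2 \<partial>\<mu>) / 2) * cos c"
proof -
  note L = assms[THEN dual_closure_L2]
  obtain l :: "nat \<Rightarrow> 'a \<Rightarrow>\<^sub>L real" where l: "(\<lambda>n. \<integral>x. (g x - l n x)\<^sup>2 \<partial>\<mu>) \<longlonglongrightarrow> 0"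
    using assms unfolding dual_closure_iff by blast
  have l': "(\<lambda>n. \<integral>x. (l n x - g x)\<^sup>2 \<partial>\<mu>) \<longlonglongrightarrow> 0"
    using l by (simp add: power2_commute)
  have [measurable]: "g \<in> borel_measurable \<mu>" using L by (simp add: L2_def)
  have "(\<lambda>n. exp (- (\<integral>x. (l n x)\<^sup>2 \<partial>\<mu>) / 2) * cos c) \<longlonglongrightarrow> exp (- (\<integral>x. (g x)\<^sup>2 \<partial>\<mu>) / 2) * cos c"
    by (intro tendsto_intros L2_tendsto_square dual_L2 L l') auto
  then have 1: "(\<lambda>n. \<integral>x. cos (l n x + c) \<partial>\<mu>) \<longlonglongrightarrow> exp (- (\<integral>x. (g x)\<^sup>2 \<partial>\<mu>) / 2) * cos c"
    by (simp add: dual_cos)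
  have "(\<lambda>n. (\<integral>x. cos (l n x + c) \<partial>\<mu>) - (\<integral>x. cos (g x + c) \<partial>\<mu>)) \<longlonglongrightarrow> 0"
  proof (rule Lim_null_comparison)
    show "(\<lambda>n. sqrt (\<integral>x. (l n x - g x)\<^sup>2 \<partial>\<mu>)) \<longlonglongrightarrow> 0"
      using tendsto_real_sqrt[OF l'] by simp
    have "\<bar>(\<integral>x. cos (l n x + c) \<partial>\<mu>) - (\<integral>x. cos (g x + c) \<partial>\<mu>)\<bar> \<le> sqrt (\<integral>x. (l n x - g x)\<^sup>2 \<partial>\<mu>)" for n
    proof -
      note D = L2_diff[OF dual_L2[of "l n"] L]
      have D': "(\<lambda>x. \<bar>l n x - g x\<bar>) \<in> L2 \<mu>" using D by (simp add: L2_def)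
      have i: "integrable \<mu> (\<lambda>x. cos (h x + c))" if [measurable]: "h \<in> borel_measurable \<mu>" for h
        by (intro integrable_const_bound[of _ 1]) auto
      have "\<bar>(\<integral>x. cos (l n x + c) \<partial>\<mu>) - (\<integral>x. cos (g x + c) \<partial>\<mu>)\<bar> = \<bar>\<integral>x. cos (l n x + c) - cos (g x + c) \<partial>\<mu>\<bar>"
        by (simp add: i)
      also have "\<dots> \<le> (\<integral>x. \<bar>cos (l n x + c) - cos (g x + c)\<bar> \<partial>\<mu>)"
        by (rule integral_abs_bound)
      also have "\<dots> \<le> (\<integral>x. 1 * \<bar>l n x - g x\<bar> \<partial>\<mu>)"
      proof (rule integral_mono)
        show "integrable \<mu> (\<lambda>x. \<bar>cos (l n x + c) - cos (g x + c)\<bar>)" by (simp add: i)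
        show "integrable \<mu> (\<lambda>x. 1 * \<bar>l n x - g x\<bar>)"
          by (rule L2_mult_integrable[OF const_L2 D'])
        show "\<bar>cos (l n x + c) - cos (g x + c)\<bar> \<le> 1 * \<bar>l n x - g x\<bar>" for x
        proof -
          have "\<bar>cos (l n x + c) - cos (g x + c)\<bar> = 2 * (\<bar>sin ((l n x + c + (g x + c)) / 2)\<bar> * \<bar>sin ((g x - l n x) / 2)\<bar>)"
            by (simp add: cos_diff_cos abs_mult)
          also have "\<dots> \<le> 2 * (1 * \<bar>(g x - l n x) / 2\<bar>)"
            by (intro mult_left_mono mult_mono abs_sin_le_one abs_sin_x_le_abs_x) auto
          finally show ?thesis by simp
        qed
      qed
      also have "\<dots> \<le> \<bar>\<integral>x. 1 * \<bar>l n x - g x\<bar> \<partial>\<mu>\<bar>" by simp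
      also have "\<dots> \<le> sqrt (\<integral>x. (l n x - g x)\<^sup>2 \<partial>\<mu>)"
        using L2_Cauchy_Schwarz[OF const_L2[of 1] D'] prob_space by simp
      finally show ?thesis .
    qed
    then show "\<forall>\<^sub>F n in sequentially. norm ((\<integral>x. cos (l n x + c) \<partial>\<mu>) - (\<integral>x. cos (g x + c) \<partial>\<mu>))
      \<le> sqrt (\<integral>x. (l n x - g x)\<^sup>2 \<partial>\<mu>)" by simp
  qed
  then have "(\<lambda>n. \<integral>x. cos (l n x + c) \<partial>\<mu>) \<longlonglongrightarrow> (\<integral>x. cos (g x + c) \<partial>\<mu>)"
    by (simp add: LIM_zero_iff)
  then show ?thesis using 1 LIMSEQ_unique by blast
qed

lemma L2_measurable [measurable_dest]: "g \<in> L2 \<mu> \<Longrightarrow> g \<in> borel_measurable \<mu>"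
  by (simp add: L2_def)

lemma L2_integrable: "g \<in> L2 \<mu> \<Longrightarrow> integrable \<mu> g"
  using L2_mult_integrable[OF const_L2[of 1]] by simp

text \<open>If a functional \<open>l\<close> of norm at most 1 had large variance, then \<open>cos (\<tau> l)\<close> would have small mean,
  whereas \<open>1 - cos (\<tau> l x) \<le> min 2 (\<tau> \<parallel>x\<parallel>)\<close> has small mean for small \<open>\<tau>\<close>, uniformly in \<open>l\<close>.\<close>
lemma dual_variance_bounded:
  obtains C where "C \<ge> 0" "\<And>l :: 'a \<Rightarrow>\<^sub>L real. norm l \<le> 1 \<Longrightarrow> (\<integral>x. (blinfun_apply l x)\<^sup>2 \<partial>\<mu>) \<le> C"
proof -
  have mb: "(\<lambda>x :: 'a. min 2 (c * norm x)) \<in> borel_measurable \<mu>" for c :: real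
    by measurable
  have "(\<lambda>n. \<integral>x. min 2 (inverse (real (Suc n)) * norm x) \<partial>\<mu>) \<longlonglongrightarrow> (\<integral>x. min 2 (0 * norm x) \<partial>\<mu>)"
  proof (rule integral_dominated_convergence[where w = "\<lambda>_. 2"])
    show "AE x in \<mu>. (\<lambda>n. min 2 (inverse (real (Suc n)) * norm x)) \<longlonglongrightarrow> min 2 (0 * norm x)"
      by (intro AE_I2 tendsto_intros LIMSEQ_inverse_real_of_nat)
  qed (auto intro: mb)
  then have "(\<lambda>n. \<integral>x. min 2 (inverse (real (Suc n)) * norm x) \<partial>\<mu>) \<longlonglongrightarrow> 0" by simp
  then have "\<forall>\<^sub>F n in sequentially. (\<integral>x. min 2 (inverse (real (Suc n)) * norm x) \<partial>\<mu>) < 1/2"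
    by (rule order_tendstoD) simp
  then obtain n where n: "(\<integral>x. min 2 (inverse (real (Suc n)) * norm x) \<partial>\<mu>) < 1/2"
    using eventually_happens'[OF sequentially_bot] by blast
  \<comment> \<open>At this scale \<open>1 - cos (\<tau> * l x)\<close> has mean below 1/2 for every
    \<open>l\<close> in the unit ball.\<close>
  define \<tau> where "\<tau> = inverse (real (Suc n))"
  have \<tau>: "\<tau> > 0" by (simp add: \<tau>_def)
  have "(\<integral>x. (l x)\<^sup>2 \<partial>\<mu>) \<le> 2 / \<tau>\<^sup>2" if l: "norm l \<le> 1" for l :: "'a \<Rightarrow>\<^sub>L real"
  proof -
    define V where "V = \<tau>\<^sup>2 * (\<integral>x. (l x)\<^sup>2 \<partial>\<mu>) / 2"
    have le: "1 - cos (\<tau> * l x) \<le> min 2 (\<tau> * norm x)" for x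
    proof -
      have "\<bar>l x\<bar> \<le> 1 * norm x"
        using norm_blinfun[of l x] mult_right_mono[OF l, of "norm x"] by simp
      then have "\<bar>\<tau> * l x\<bar> \<le> \<tau> * norm x" using \<tau> by (simp add: abs_mult)
      moreover have "1 - cos y \<le> \<bar>y\<bar>" for y :: real
      proof -
        have "1 - cos y = 2 * (\<bar>sin (y / 2)\<bar> * \<bar>sin (y / 2)\<bar>)"
          using cos_double_sin[of "y / 2"] by (simp add: power2_eq_square)
        also have "\<dots> \<le> 2 * (1 * \<bar>y / 2\<bar>)"
          by (intro mult_left_mono mult_mono abs_sin_le_one abs_sin_x_le_abs_x) auto
        finally show ?thesis by simp
      qed
      moreover have "1 - cos (\<tau> * l x) \<le> 2" using cos_ge_minus_one[of "\<tau> * l x"] by linarith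
      ultimately show ?thesis by (smt (verit) min_def)
    qed
    have ic: "integrable \<mu> (\<lambda>x. cos (\<tau> * l x))"
      by (intro integrable_const_bound[of _ 1]) auto
    have "1 - (\<integral>x. cos (\<tau> * l x) \<partial>\<mu>) = (\<integral>x. 1 - cos (\<tau> * l x) \<partial>\<mu>)"
      using ic prob_space by simp
    also have "\<dots> \<le> (\<integral>x. min 2 (\<tau> * norm x) \<partial>\<mu>)"
    proof (rule integral_mono)
      show "integrable \<mu> (\<lambda>x. min 2 (\<tau> * norm x))"
        using \<tau> by (intro integrable_const_bound[of _ 2] mb) auto
    qed (use ic le in auto)
    also have "\<dots> < 1/2" using n by (simp add: \<tau>_def)
    finally have "1/2 < (\<integral>x. cos (\<tau> * l x) \<partial>\<mu>)" by simp
    also have "\<dots> = exp (- V)"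
      using dual_cos[of "\<tau> *\<^sub>R l" 0] by (simp add: blinfun.scaleR_left power_mult_distrib V_def)
    \<comment> \<open>Together with \<open>1 + V \<le> exp V\<close> this gives
      \<open>V < 1\<close>, which is the bound \<open>2 / \<tau>\<^sup>2\<close> on the
      variance.\<close>
    finally have "exp V < 2" by (simp add: exp_minus field_simps)
    with exp_ge_add_one_self[of V] have "V < 1" by linarith
    then show ?thesis using \<tau> by (simp add: V_def field_simps)
  qed
  with that[of "2 / \<tau>\<^sup>2"] show thesis by simp
qed

text \<open>The weak integral \<open>\<integral> g x d\<mu>\<close> is the limit of the Bochner integrals over balls, which form a Cauchy
  sequence because all functionals in the unit ball have uniformly bounded variance.\<close>
lemma weak_integral_exists:
  assumes g: "g \<in> L2 \<mu>"
  obtains z where "\<And>l :: 'a \<Rightarrow>\<^sub>L real. blinfun_apply l z = (\<integral>x. g x * blinfun_apply l x \<partial>\<mu>)"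
proof -
  obtain C where C: "C \<ge> 0" "\<And>l :: 'a \<Rightarrow>\<^sub>L real. norm l \<le> 1 \<Longrightarrow> (\<integral>x. (blinfun_apply l x)\<^sup>2 \<partial>\<mu>) \<le> C"
    using dual_variance_bounded by blast
  have [measurable]: "g \<in> borel_measurable borel" using L2_measurable[OF g] by simp
  define I :: "nat \<Rightarrow> 'a \<Rightarrow> real" where "I n = indicator (cball 0 (real n))" for n
  have I_meas [measurable]: "I n \<in> borel_measurable borel" for n
    unfolding I_def by (intro borel_measurable_indicator) simp
  have I: "0 \<le> I n x" "I n x \<le> 1" for n x by (auto simp: I_def indicator_def)
  have I_lim: "(\<lambda>n. I n x) \<longlonglongrightarrow> 1" for x
  proof -
    obtain N where N: "norm x \<le> real N" using real_arch_simple by blast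
    have "\<forall>\<^sub>F n in sequentially. I n x = 1"
      using eventually_ge_at_top[of N] by eventually_elim (use N in \<open>auto simp: I_def indicator_def\<close>)
    then show ?thesis by (rule tendsto_eventually)
  qed
  have Ig: "(\<lambda>x. I n x * g x) \<in> L2 \<mu>" for n
  proof -
    have "integrable \<mu> (\<lambda>x. (I n x * g x)\<^sup>2)"
    proof (rule Bochner_Integration.integrable_bound)
      show "integrable \<mu> (\<lambda>x. (g x)\<^sup>2)" using g by (simp add: L2_def)
      have "(I n x)\<^sup>2 * (g x)\<^sup>2 \<le> 1 * (g x)\<^sup>2" for x
        using I[of n x] by (intro mult_right_mono) (auto simp: power_le_one)
      then show "AE x in \<mu>. norm ((I n x * g x)\<^sup>2) \<le> norm ((g x)\<^sup>2)"
        by (simp add: power_mult_distrib abs_mult)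
    qed measurable
    then show ?thesis by (simp add: L2_def)
  qed
  \<comment> \<open>On the ball of radius \<open>n\<close> the vector integrand is bounded by
    \<open>n * \<bar>g x\<bar>\<close>, so truncation makes the Bochner integral available.\<close>
  have int: "integrable \<mu> (\<lambda>x. (I n x * g x) *\<^sub>R x)" for n
  proof (rule Bochner_Integration.integrable_bound)
    show "integrable \<mu> (\<lambda>x. real n * g x)" using L2_integrable[OF g] by simp
    have "\<bar>I n x * g x\<bar> * norm x \<le> real n * \<bar>g x\<bar>" for x
      by (cases "norm x \<le> real n") (auto simp: I_def indicator_def mult.commute[of "real n"] intro!: mult_left_mono)
    then show "AE x in \<mu>. norm ((I n x * g x) *\<^sub>R x) \<le> norm (real n * g x)"
      by (simp add: abs_mult)
  qed measurable
  define z where "z n = (\<integral>x. (I n x * g x) *\<^sub>R x \<partial>\<mu>)" for n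
  have lz: "l (z n) = (\<integral>x. (I n x * g x) * l x \<partial>\<mu>)" for n and l :: "'a \<Rightarrow>\<^sub>L real"
    unfolding z_def using integral_bounded_linear[OF blinfun.bounded_linear_right int[of n], of l]
    by (simp add: blinfun.scaleR_right)
  \<comment> \<open>The mean square size of \<open>g\<close> outside the ball of radius
    \<open>n\<close>, times the uniform bound on standard deviations.\<close>
  define b where "b n = sqrt (\<integral>x. (1 - I n x) * (g x)\<^sup>2 \<partial>\<mu>) * sqrt C" for n
  have gi: "integrable \<mu> (\<lambda>x. (1 - I n x) * (g x)\<^sup>2)" for n
  proof (rule Bochner_Integration.integrable_bound)
    show "integrable \<mu> (\<lambda>x. (g x)\<^sup>2)" using g by (simp add: L2_def)
    show "AE x in \<mu>. norm ((1 - I n x) * (g x)\<^sup>2) \<le> norm ((g x)\<^sup>2)"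
      using I[of n] by (simp add: abs_mult mult_left_le_one_le)
  qed measurable
  have le: "dist (z m) (z n) \<le> b m" if "m < n" for m n
  proof -
    \<comment> \<open>A functional that attains the norm of the difference turns the distance of two
      vector integrals into one scalar integral, to which Cauchy-Schwarz applies.\<close>
    obtain l :: "'a \<Rightarrow>\<^sub>L real" where l: "norm l \<le> 1" "l (z n - z m) = norm (z n - z m)"
      using norming_functional .
    note D = L2_diff[OF Ig[of n] Ig[of m]]
    have "dist (z m) (z n) = l (z n) - l (z m)"
      using l by (simp add: dist_norm norm_minus_commute blinfun.diff_right)
    also have "\<dots> = (\<integral>x. (I n x * g x - I m x * g x) * l x \<partial>\<mu>)"
      unfolding lz left_diff_distrib
      by (rule Bochner_Integration.integral_diff[symmetric]; intro L2_mult_integrable Ig dual_L2)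
    also have "\<dots> \<le> sqrt (\<integral>x. (I n x * g x - I m x * g x)\<^sup>2 \<partial>\<mu>) * sqrt (\<integral>x. (l x)\<^sup>2 \<partial>\<mu>)"
      using L2_Cauchy_Schwarz[OF D dual_L2[of l]] by simp
    also have "\<dots> \<le> b m"
      unfolding b_def
    proof (intro mult_mono real_sqrt_le_mono C(2) l integral_mono gi)
      show "integrable \<mu> (\<lambda>x. (I n x * g x - I m x * g x)\<^sup>2)" using D by (simp add: L2_def)
      show "(I n x * g x - I m x * g x)\<^sup>2 \<le> (1 - I m x) * (g x)\<^sup>2" for x
        using that by (auto simp: I_def indicator_def)
      show "0 \<le> sqrt (\<integral>x. (1 - I m x) * (g x)\<^sup>2 \<partial>\<mu>)" using I by (simp add: integral_nonneg_AE)
      show "0 \<le> sqrt (\<integral>x. (l x)\<^sup>2 \<partial>\<mu>)" by simp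
    qed
    finally show ?thesis .
  qed
  have "(\<lambda>n. \<integral>x. (1 - I n x) * (g x)\<^sup>2 \<partial>\<mu>) \<longlonglongrightarrow> (\<integral>x. (1 - 1) * (g x)\<^sup>2 \<partial>\<mu>)"
  proof (rule integral_dominated_convergence[where w = "\<lambda>x. (g x)\<^sup>2"])
    show "integrable \<mu> (\<lambda>x. (g x)\<^sup>2)" using g by (simp add: L2_def)
    show "AE x in \<mu>. (\<lambda>n. (1 - I n x) * (g x)\<^sup>2) \<longlonglongrightarrow> (1 - 1) * (g x)\<^sup>2"
      by (intro AE_I2 tendsto_intros I_lim)
    show "AE x in \<mu>. norm ((1 - I n x) * (g x)\<^sup>2) \<le> (g x)\<^sup>2" for n
      using I[of n] by (simp add: abs_mult mult_left_le_one_le)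
  qed measurable
  then have "(\<lambda>n. \<integral>x. (1 - I n x) * (g x)\<^sup>2 \<partial>\<mu>) \<longlonglongrightarrow> 0" by simp
  from tendsto_mult[OF tendsto_real_sqrt[OF this] tendsto_const, of "sqrt C"]
  have b: "b \<longlonglongrightarrow> 0" unfolding b_def by simp
  have "Cauchy z"
    unfolding Cauchy_altdef
  proof (intro allI impI)
    fix e :: real assume "e > 0"
    then obtain N where "\<And>m. m \<ge> N \<Longrightarrow> b m < e"
      using order_tendstoD(2)[OF b] by (auto simp: eventually_sequentially)
    then show "\<exists>M. \<forall>m\<ge>M. \<forall>n>m. dist (z m) (z n) < e" using le by (meson le_less_trans)
  qed
  then obtain z0 where z0: "z \<longlonglongrightarrow> z0" using Cauchy_convergent convergent_def by blast
  show thesis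
  proof
    fix l :: "'a \<Rightarrow>\<^sub>L real"
    have gl: "integrable \<mu> (\<lambda>x. g x * l x)" by (rule L2_mult_integrable[OF g dual_L2])
    have "(\<lambda>n. \<integral>x. I n x * (g x * l x) \<partial>\<mu>) \<longlonglongrightarrow> (\<integral>x. 1 * (g x * l x) \<partial>\<mu>)"
    proof (rule integral_dominated_convergence[where w = "\<lambda>x. \<bar>g x * l x\<bar>"])
      show "integrable \<mu> (\<lambda>x. \<bar>g x * l x\<bar>)" using gl by simp
      show "AE x in \<mu>. (\<lambda>n. I n x * (g x * l x)) \<longlonglongrightarrow> 1 * (g x * l x)"
        by (intro AE_I2 tendsto_intros I_lim)
      show "AE x in \<mu>. norm (I n x * (g x * l x)) \<le> \<bar>g x * l x\<bar>" for n
        using I[of n] by (simp add: abs_mult mult_left_le_one_le)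
    qed measurable
    then have "(\<lambda>n. l (z n)) \<longlonglongrightarrow> (\<integral>x. g x * l x \<partial>\<mu>)"
      unfolding lz by (simp add: mult.assoc)
    moreover have "(\<lambda>n. l (z n)) \<longlonglongrightarrow> l z0"
      by (intro blinfun.tendsto tendsto_const z0)
    ultimately show "l z0 = (\<integral>x. g x * l x \<partial>\<mu>)" using LIMSEQ_unique by blast
  qed
qed

section \<open>The operator R_mu, the Cameron-Martin space and its inner product\<close>

lemma R_op_apply:
  assumes "g \<in> L2 \<mu>"
  shows "blinfun_apply l (R_op \<mu> g) = (\<integral>x. g x * l x \<partial>\<mu>)"
proof -
  have "\<exists>z. \<forall>l :: 'a \<Rightarrow>\<^sub>L real. l z = (\<integral>x. g x * l x \<partial>\<mu>)"
    using weak_integral_exists[OF assms] by blast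
  from someI_ex[OF this] show ?thesis unfolding R_op_def by blast
qed

lemma R_op_eqI:
  assumes "g \<in> L2 \<mu>" "\<And>l :: 'a \<Rightarrow>\<^sub>L real. l z = (\<integral>x. g x * l x \<partial>\<mu>)"
  shows "R_op \<mu> g = z"
  by (rule dual_separates_points) (simp add: R_op_apply assms)

lemma R_op_lincomb:
  assumes "g \<in> L2 \<mu>" "g' \<in> L2 \<mu>"
  shows "R_op \<mu> (\<lambda>x. a * g x + b * g' x) = a *\<^sub>R R_op \<mu> g + b *\<^sub>R R_op \<mu> g'"
proof (rule R_op_eqI[OF L2_lincomb[OF assms]])
  fix l :: "'a \<Rightarrow>\<^sub>L real"
  have "(\<integral>x. (a * g x + b * g' x) * l x \<partial>\<mu>) = (\<integral>x. a * (g x * l x) + b * (g' x * l x) \<partial>\<mu>)"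
    by (simp add: algebra_simps)
  also have "\<dots> = a * (\<integral>x. g x * l x \<partial>\<mu>) + b * (\<integral>x. g' x * l x \<partial>\<mu>)"
    using assms[THEN L2_mult_integrable, OF dual_L2[of l]] by simp
  finally show "l (a *\<^sub>R R_op \<mu> g + b *\<^sub>R R_op \<mu> g') = (\<integral>x. (a * g x + b * g' x) * l x \<partial>\<mu>)"
    by (simp add: blinfun.add_right blinfun.scaleR_right R_op_apply assms)
qed

lemma hat:
  assumes "h \<in> cameron_martin \<mu>"
  shows "hat \<mu> h \<in> dual_closure \<mu>" "R_op \<mu> (hat \<mu> h) = h"
proof -
  have "\<exists>g. g \<in> dual_closure \<mu> \<and> R_op \<mu> g = h"
    using assms unfolding cameron_martin_def by blast
  from someI_ex[OF this] show "hat \<mu> h \<in> dual_closure \<mu>" "R_op \<mu> (hat \<mu> h) = h"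
    unfolding hat_def by blast+
qed

lemma hat_L2: "h \<in> cameron_martin \<mu> \<Longrightarrow> hat \<mu> h \<in> L2 \<mu>"
  by (rule dual_closure_L2[OF hat(1)])

lemma dual_apply_hat:
  "h \<in> cameron_martin \<mu> \<Longrightarrow> blinfun_apply l h = (\<integral>x. hat \<mu> h x * l x \<partial>\<mu>)"
  using R_op_apply[OF hat_L2, of h l] by (simp add: hat(2))

text \<open>Approximation of \<open>g\<close> by functionals \<open>l n\<close> in mean square makes
  the mean of \<open>(g x)\<^sup>2\<close> a limit of the means of \<open>g x * l n x\<close>, all
  of which are 0. This is the injectivity of R_mu up to null sets.\<close>

lemma dual_closure_orthogonal:
  assumes g: "g \<in> dual_closure \<mu>" and orth: "\<And>l :: 'a \<Rightarrow>\<^sub>L real. (\<integral>x. g x * l x \<partial>\<mu>) = 0"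
  shows "AE x in \<mu>. g x = 0"
proof -
  note L = dual_closure_L2[OF g]
  obtain l :: "nat \<Rightarrow> 'a \<Rightarrow>\<^sub>L real" where "(\<lambda>n. \<integral>x. (g x - l n x)\<^sup>2 \<partial>\<mu>) \<longlonglongrightarrow> 0"
    using g unfolding dual_closure_iff by blast
  then have "(\<lambda>n. \<integral>x. (l n x - g x)\<^sup>2 \<partial>\<mu>) \<longlonglongrightarrow> 0" by (simp add: power2_commute)
  from L2_tendsto_mult[OF dual_L2 L L this]
  have "(\<integral>x. (g x)\<^sup>2 \<partial>\<mu>) = 0"
    by (simp add: orth power2_eq_square LIMSEQ_const_iff)
  then have "AE x in \<mu>. (g x)\<^sup>2 = 0"
    using L integral_nonneg_eq_0_iff_AE[of \<mu> "\<lambda>x. (g x)\<^sup>2"] by (simp add: L2_def)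
  then show ?thesis by simp
qed

text \<open>\<open>hat\<close> chooses one of many representatives, so agreement with
  \<open>g\<close> can hold only almost everywhere. The difference of the two lies in
  \<open>dual_closure \<mu>\<close> and is sent to 0 by \<open>R_op\<close>, hence is orthogonal to
  all functionals.\<close>

lemma hat_R_op:
  assumes g: "g \<in> dual_closure \<mu>"
  shows "AE x in \<mu>. hat \<mu> (R_op \<mu> g) x = g x"
proof -
  have CM: "R_op \<mu> g \<in> cameron_martin \<mu>" using g by (simp add: cameron_martin_def)
  note L = dual_closure_L2[OF g] hat_L2[OF CM]
  have "AE x in \<mu>. 1 * hat \<mu> (R_op \<mu> g) x + (-1) * g x = 0"
  proof (rule dual_closure_orthogonal)
    show "(\<lambda>x. 1 * hat \<mu> (R_op \<mu> g) x + (-1) * g x) \<in> dual_closure \<mu>"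
      by (rule dual_closure_lincomb[OF hat(1)[OF CM] g])
    have "R_op \<mu> (\<lambda>x. 1 * hat \<mu> (R_op \<mu> g) x + (-1) * g x) = 0"
      unfolding R_op_lincomb[OF L(2,1)] using hat(2)[OF CM] by simp
    then show "(\<integral>x. (1 * hat \<mu> (R_op \<mu> g) x + (-1) * g x) * l x \<partial>\<mu>) = 0" for l :: "'a \<Rightarrow>\<^sub>L real"
      using R_op_apply[OF L2_lincomb[OF L(2,1), of 1 "-1"], of l] by (simp add: blinfun.zero_right)
  qed
  then show ?thesis by simp
qed

lemma inner_H_R_op:
  assumes "g \<in> dual_closure \<mu>" "h \<in> cameron_martin \<mu>"
  shows "inner_H \<mu> (R_op \<mu> g) h = (\<integral>x. g x * hat \<mu> h x \<partial>\<mu>)"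
proof -
  have CM: "R_op \<mu> g \<in> cameron_martin \<mu>" using assms by (simp add: cameron_martin_def)
  note [measurable] = L2_measurable[OF dual_closure_L2[OF assms(1)]] L2_measurable[OF hat_L2[OF CM]]
    L2_measurable[OF hat_L2[OF assms(2)]]
  show ?thesis
    unfolding inner_H_def using hat_R_op[OF assms(1)] by (intro integral_cong_AE) auto
qed

lemma inner_H_commute: "inner_H \<mu> h k = inner_H \<mu> k h"
  by (simp add: inner_H_def mult.commute)

text \<open>The \<open>hat\<close> of a linear combination is the combination of the
  \<open>hat\<close>s only up to null sets. The explicit representative
  \<open>a * hat \<mu> h x + b * hat \<mu> k x\<close>, inserted by \<open>inner_H_R_op\<close>,
  nevertheless gives exact linearity of the inner product.\<close>

lemma cameron_martin_lincomb:
  assumes "h \<in> cameron_martin \<mu>" "k \<in> cameron_martin \<mu>"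
  shows "a *\<^sub>R h + b *\<^sub>R k \<in> cameron_martin \<mu>"
    and "v \<in> cameron_martin \<mu> \<Longrightarrow> inner_H \<mu> (a *\<^sub>R h + b *\<^sub>R k) v = a * inner_H \<mu> h v + b * inner_H \<mu> k v"
proof -
  note d = dual_closure_lincomb[OF hat(1)[OF assms(1)] hat(1)[OF assms(2)], of a b]
  have eq: "a *\<^sub>R h + b *\<^sub>R k = R_op \<mu> (\<lambda>x. a * hat \<mu> h x + b * hat \<mu> k x)"
    using R_op_lincomb[OF assms[THEN hat_L2]] assms[THEN hat(2)] by simp
  show "a *\<^sub>R h + b *\<^sub>R k \<in> cameron_martin \<mu>"
    unfolding eq cameron_martin_def using d by blast
  assume v: "v \<in> cameron_martin \<mu>"
  have "(\<integral>x. (a * hat \<mu> h x + b * hat \<mu> k x) * hat \<mu> v x \<partial>\<mu>)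
    = (\<integral>x. a * (hat \<mu> h x * hat \<mu> v x) + b * (hat \<mu> k x * hat \<mu> v x) \<partial>\<mu>)"
    by (simp add: algebra_simps)
  also have "\<dots> = a * inner_H \<mu> h v + b * inner_H \<mu> k v"
    using assms[THEN hat_L2, THEN L2_mult_integrable, OF hat_L2[OF v]] by (simp add: inner_H_def)
  finally show "inner_H \<mu> (a *\<^sub>R h + b *\<^sub>R k) v = a * inner_H \<mu> h v + b * inner_H \<mu> k v"
    unfolding eq inner_H_R_op[OF d v] .
qed

lemma norm_H_nonneg [simp]: "0 \<le> norm_H \<mu> h"
  by (simp add: norm_H_def inner_H_def)

lemma norm_H_eq_sqrt: "norm_H \<mu> h = sqrt (\<integral>x. (hat \<mu> h x)\<^sup>2 \<partial>\<mu>)"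
  unfolding norm_H_def inner_H_def power2_eq_square ..

lemma norm_H_sq: "(norm_H \<mu> h)\<^sup>2 = inner_H \<mu> h h"
  unfolding norm_H_def inner_H_def by (rule real_sqrt_pow2) simp

lemma inner_H_Cauchy_Schwarz:
  assumes "h \<in> cameron_martin \<mu>" "k \<in> cameron_martin \<mu>"
  shows "\<bar>inner_H \<mu> h k\<bar> \<le> norm_H \<mu> h * norm_H \<mu> k"
  unfolding inner_H_def norm_H_eq_sqrt by (rule L2_Cauchy_Schwarz[OF assms[THEN hat_L2]])

lemma norm_H_scale:
  assumes "h \<in> cameron_martin \<mu>"
  shows "norm_H \<mu> (c *\<^sub>R h) = \<bar>c\<bar> * norm_H \<mu> h" "c *\<^sub>R h \<in> cameron_martin \<mu>"
proof -
  have eq: "c *\<^sub>R h + 0 *\<^sub>R h = c *\<^sub>R h" by simp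
  note lin = cameron_martin_lincomb[OF assms assms, where a = c and b = 0, unfolded eq]
  show CM: "c *\<^sub>R h \<in> cameron_martin \<mu>" by (rule lin(1))
  have "inner_H \<mu> (c *\<^sub>R h) (c *\<^sub>R h) = c * inner_H \<mu> h (c *\<^sub>R h)"
    using lin(2)[OF CM] by simp
  also have "inner_H \<mu> h (c *\<^sub>R h) = inner_H \<mu> (c *\<^sub>R h) h"
    by (rule inner_H_commute)
  also have "c * \<dots> = c\<^sup>2 * inner_H \<mu> h h"
    using lin(2)[OF assms] by (simp add: power2_eq_square)
  finally show "norm_H \<mu> (c *\<^sub>R h) = \<bar>c\<bar> * norm_H \<mu> h"
    by (simp add: norm_H_def real_sqrt_mult)
qed

end

section \<open>Gaussian integration by parts\<close>

lemma normal_density_tendsto_0: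
  assumes "\<sigma> > 0"
  shows "(\<lambda>n. normal_density 0 \<sigma> (real n)) \<longlonglongrightarrow> 0" "(\<lambda>n. normal_density 0 \<sigma> (- real n)) \<longlonglongrightarrow> 0"
proof -
  show "(\<lambda>n. normal_density 0 \<sigma> (real n)) \<longlonglongrightarrow> 0"
    unfolding normal_density_def using assms by real_asymp
  then show "(\<lambda>n. normal_density 0 \<sigma> (- real n)) \<longlonglongrightarrow> 0"
    by (simp add: normal_density_def)
qed

text \<open>The derivative of the density is \<open>- (y / \<sigma>\<^sup>2)\<close> times the
  density, so the difference of the two weighted integrands is the derivative of \<open>u\<close>
  times the density. It is integrated over \<open>{- n..n}\<close>, and the boundary terms vanish in
  the limit because \<open>u\<close> is bounded.\<close>

lemma normal_density_integration_by_parts: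
  fixes u u' :: "real \<Rightarrow> real"
  assumes s: "\<sigma> > 0"
    and der: "\<And>y. (u has_real_derivative u' y) (at y)"
    and [measurable]: "u' \<in> borel_measurable borel"
    and bd: "\<And>y. \<bar>u y\<bar> \<le> C" "\<And>y. \<bar>u' y\<bar> \<le> C"
  shows "(\<integral>y. u' y \<partial>density lborel (\<lambda>x. ennreal (normal_density 0 \<sigma> x)))
    = (\<integral>y. u y * y \<partial>density lborel (\<lambda>x. ennreal (normal_density 0 \<sigma> x))) / \<sigma>\<^sup>2"
proof -
  let ?r = "normal_density 0 \<sigma>"
  have "continuous_on UNIV u"
    using der by (auto intro!: continuous_at_imp_continuous_on DERIV_isCont)
  then have [measurable]: "u \<in> borel_measurable borel" by (rule borel_measurable_continuous_onI)
  have C: "0 \<le> C" using bd(1)[of 0] by linarith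
  have i1: "integrable lborel (\<lambda>y. ?r y * u' y)"
  proof (rule Bochner_Integration.integrable_bound)
    show "integrable lborel (\<lambda>y. ?r y * C)" using integrable_normal_density[OF s] by simp
    show "AE y in lborel. norm (?r y * u' y) \<le> norm (?r y * C)"
      using bd(2) C by (auto simp: abs_mult intro!: mult_left_mono)
  qed measurable
  have i2: "integrable lborel (\<lambda>y. ?r y * (u y * y))"
  proof (rule Bochner_Integration.integrable_bound)
    show "integrable lborel (\<lambda>y. C * (?r y * y))"
      using integrable_normal_moment_nz_1[OF s, of 0] by simp
    have "\<bar>?r y * (u y * y)\<bar> \<le> \<bar>C * (?r y * y)\<bar>" for y
      using mult_right_mono[OF bd(1)[of y], of "?r y * \<bar>y\<bar>"] C by (simp add: abs_mult ac_simps)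
    then show "AE y in lborel. norm (?r y * (u y * y)) \<le> norm (C * (?r y * y))" by simp
  qed measurable
  define F where "F y = u y * ?r y" for y
  define f where "f y = ?r y * u' y - (?r y * (u y * y)) / \<sigma>\<^sup>2" for y
  have fi: "integrable lborel f" unfolding f_def using i1 i2 by simp
  have dr: "(?r has_real_derivative - (y / \<sigma>\<^sup>2) * ?r y) (at y)" for y
    unfolding normal_density_def using s
    by (auto intro!: derivative_eq_intros simp: field_simps power2_eq_square)
  have dF: "(F has_real_derivative f y) (at y)" for y
    unfolding F_def f_def by (rule derivative_eq_intros der dr refl)+ (simp add: algebra_simps)
  have ftc: "(\<integral>y. indicator {- real n..real n} y *\<^sub>R f y \<partial>lborel) = F (real n) - F (- real n)" for n
  proof -
    have "(f has_integral (F (real n) - F (- real n))) {- real n..real n}"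
      using dF by (intro fundamental_theorem_of_calculus)
        (auto simp: has_real_derivative_iff_has_vector_derivative intro: has_vector_derivative_at_within)
    moreover have "set_integrable lborel {- real n..real n} f"
      unfolding set_integrable_def using fi by (intro integrable_mult_indicator) auto
    ultimately show ?thesis
      using set_borel_integral_eq_integral(2)[of "{- real n..real n}" f]
      by (auto simp: set_lebesgue_integral_def dest: integral_unique)
  qed
  have "(\<lambda>n. \<integral>y. indicator {- real n..real n} y *\<^sub>R f y \<partial>lborel) \<longlonglongrightarrow> (\<integral>y. f y \<partial>lborel)"
  proof (rule integral_dominated_convergence[where w = "\<lambda>y. norm (f y)"])
    show "AE y in lborel. (\<lambda>n. indicator {- real n..real n} y *\<^sub>R f y) \<longlonglongrightarrow> f y"
    proof (rule AE_I2)
      fix y :: real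
      obtain N where N: "\<bar>y\<bar> \<le> real N" using real_arch_simple by blast
      have "\<forall>\<^sub>F n in sequentially. indicator {- real n..real n} y *\<^sub>R f y = f y"
        using eventually_ge_at_top[of N] by eventually_elim (use N in \<open>auto simp: indicator_def\<close>)
      then show "(\<lambda>n. indicator {- real n..real n} y *\<^sub>R f y) \<longlonglongrightarrow> f y" by (rule tendsto_eventually)
    qed
    show "AE y in lborel. norm (indicator {- real n..real n} y *\<^sub>R f y) \<le> norm (f y)" for n
      by (auto simp: indicator_def)
    show "integrable lborel (\<lambda>y. norm (f y))" using fi by simp
    show "f \<in> borel_measurable lborel" using fi by simp
    then show "(\<lambda>y. indicator {- real n..real n} y *\<^sub>R f y) \<in> borel_measurable lborel" for n by simp
  qed
  moreover have "(\<lambda>n. F (real n) - F (- real n)) \<longlonglongrightarrow> 0"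
  proof (rule tendsto_zero_le)
    show "\<bar>F (real n) - F (- real n)\<bar> \<le> C * ?r (real n) + C * ?r (- real n)" for n
      using mult_right_mono[OF bd(1)[of "real n"], of "?r (real n)"]
        mult_right_mono[OF bd(1)[of "- real n"], of "?r (- real n)"]
        abs_triangle_ineq4[of "F (real n)" "F (- real n)"]
      by (simp add: F_def abs_mult)
    show "(\<lambda>n. C * ?r (real n) + C * ?r (- real n)) \<longlonglongrightarrow> 0"
      using tendsto_add[OF tendsto_mult[OF tendsto_const normal_density_tendsto_0(1)[OF s], of C]
        tendsto_mult[OF tendsto_const normal_density_tendsto_0(2)[OF s], of C]] by simp
  qed
  ultimately have "(\<integral>y. f y \<partial>lborel) = 0"
    unfolding ftc using LIMSEQ_unique by blast
  then have "(\<integral>y. ?r y * u' y \<partial>lborel) = (\<integral>y. ?r y * (u y * y) \<partial>lborel) / \<sigma>\<^sup>2"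
    unfolding f_def using i1 i2 by simp
  then show ?thesis
    by (subst (1 2) integral_density) auto
qed

section \<open>The geometry of \<open>H\<close> and the decoupling of one Gaussian direction\<close>

context gaussian_measure
begin

lemma cameron_martin_diff:
  assumes "h \<in> cameron_martin \<mu>" "k \<in> cameron_martin \<mu>"
  shows "h - k \<in> cameron_martin \<mu>"
    and "v \<in> cameron_martin \<mu> \<Longrightarrow> inner_H \<mu> (h - k) v = inner_H \<mu> h v - inner_H \<mu> k v"
proof -
  have eq: "1 *\<^sub>R h + (-1) *\<^sub>R k = h - k" by simp
  note lin = cameron_martin_lincomb[OF assms, where a = 1 and b = "-1", unfolded eq]
  show "h - k \<in> cameron_martin \<mu>" by (rule lin(1))
  show "inner_H \<mu> (h - k) v = inner_H \<mu> h v - inner_H \<mu> k v" if "v \<in> cameron_martin \<mu>"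
    using lin(2)[OF that] by simp
qed

lemma norm_H_eq_0:
  assumes "h \<in> cameron_martin \<mu>" "norm_H \<mu> h = 0"
  shows "h = 0"
proof (rule dual_separates_points)
  fix l :: "'a \<Rightarrow>\<^sub>L real"
  have "(\<integral>x. (hat \<mu> h x)\<^sup>2 \<partial>\<mu>) = 0"
    using assms(2) by (simp add: norm_H_def inner_H_def power2_eq_square)
  then have "\<bar>\<integral>x. hat \<mu> h x * l x \<partial>\<mu>\<bar> \<le> 0"
    using L2_Cauchy_Schwarz[OF hat_L2[OF assms(1)] dual_L2[of l]] by simp
  then show "l h = l 0"
    using dual_apply_hat[OF assms(1)] by (simp add: blinfun.zero_right)
qed

text \<open>Riesz representation of \<open>l\<close> on \<open>H\<close>: both sides are the mean of
  the product of \<open>l\<close> and \<open>hat \<mu> h\<close>. It converts ordinary directional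
  derivatives into inner products with a gradient.\<close>

lemma dual_eq_inner_H:
  assumes "h \<in> cameron_martin \<mu>"
  shows "inner_H \<mu> (R_op \<mu> (blinfun_apply l)) h = l h"
  by (simp add: inner_H_R_op[OF dual_in_dual_closure assms] dual_apply_hat[OF assms] mult.commute)

lemma R_op_dual_cameron_martin: "R_op \<mu> (blinfun_apply l) \<in> cameron_martin \<mu>"
  using dual_in_dual_closure by (simp add: cameron_martin_def)

lemma norm_H_triangle:
  assumes "h \<in> cameron_martin \<mu>" "k \<in> cameron_martin \<mu>"
  shows "norm_H \<mu> (h - k) \<le> norm_H \<mu> h + norm_H \<mu> k"
proof (rule power2_le_imp_le)
  note CM = cameron_martin_diff(1)[OF assms]
  have "(norm_H \<mu> (h - k))\<^sup>2 = inner_H \<mu> h (h - k) - inner_H \<mu> k (h - k)"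
    unfolding norm_H_sq by (rule cameron_martin_diff(2)[OF assms CM])
  also have "inner_H \<mu> h (h - k) = inner_H \<mu> h h - inner_H \<mu> k h"
    unfolding inner_H_commute[of h "h - k"] by (rule cameron_martin_diff(2)[OF assms assms(1)])
  also have "inner_H \<mu> k (h - k) = inner_H \<mu> h k - inner_H \<mu> k k"
    unfolding inner_H_commute[of k "h - k"] by (rule cameron_martin_diff(2)[OF assms assms(2)])
  finally have "(norm_H \<mu> (h - k))\<^sup>2 = (norm_H \<mu> h)\<^sup>2 - 2 * inner_H \<mu> h k + (norm_H \<mu> k)\<^sup>2"
    by (simp add: norm_H_sq inner_H_commute[of k h])
  then show "(norm_H \<mu> (h - k))\<^sup>2 \<le> (norm_H \<mu> h + norm_H \<mu> k)\<^sup>2"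
    using inner_H_Cauchy_Schwarz[OF assms] by (simp add: power2_sum)
qed simp

text \<open>The functionals \<open>l - (l h / \<sigma>\<^sup>2) e\<close> are uncorrelated with \<open>e\<close>, and joint characteristic functions
  turn this into independence: \<open>e\<close> may be replaced by a normal variable on a second factor.\<close>
lemma decorrelated_distribution:
  fixes l :: "nat \<Rightarrow> 'a \<Rightarrow>\<^sub>L real"
  assumes e: "e \<in> dual_closure \<mu>" and s: "\<sigma> > 0" "(\<integral>x. (e x)\<^sup>2 \<partial>\<mu>) = \<sigma>\<^sup>2"
    and a: "\<And>i. a i = (\<integral>x. e x * l i x \<partial>\<mu>) / \<sigma>\<^sup>2"
  defines "\<gamma> \<equiv> density lborel (\<lambda>x. ennreal (normal_density 0 \<sigma> x))"
  defines "X \<equiv> (\<lambda>k p. case k of 0 \<Rightarrow> snd p | Suc i \<Rightarrow> l i (fst p) - a i * e (fst p))"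
  shows "distr \<mu> (Pi\<^sub>M UNIV (\<lambda>_. borel)) (\<lambda>x k. X k (x, e x)) = distr (\<mu> \<Otimes>\<^sub>M \<gamma>) (Pi\<^sub>M UNIV (\<lambda>_. borel)) (\<lambda>p k. X k p)"
proof -
  interpret G: prob_space \<gamma> unfolding \<gamma>_def using s(1) by (rule prob_space_normal_density)
  interpret P: pair_prob_space \<mu> \<gamma> ..
  note eL = dual_closure_L2[OF e]
  have [measurable]: "e \<in> borel_measurable borel" using L2_measurable[OF eL] by simp
  have [measurable_cong]: "sets \<gamma> = sets borel" by (simp add: \<gamma>_def)
  \<comment> \<open>The law of \<open>(x, e x)\<close> puts both sides on the space of pairs, where
    \<open>X\<close> is one and the same family of variables.\<close>
  define M where "M = distr \<mu> (borel \<Otimes>\<^sub>M borel) (\<lambda>x. (x, e x))"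
  \<comment> \<open>Coordinate 0 of \<open>X\<close> is the second component, coordinate
    \<open>Suc i\<close> the residual of \<open>l i\<close>. Each combination of them splits into a
    part \<open>g\<close> orthogonal to \<open>e\<close>, a multiple of the second component and a
    constant; from this splitting the means of the cosines can be computed.\<close>
  define \<A> where "\<A> = {b. \<exists>g s c. g \<in> dual_closure \<mu> \<and> (\<integral>x. g x * e x \<partial>\<mu>) = 0 \<and> b = (\<lambda>p. g (fst p) + s * snd p + c)}"
  have \<A>I: "(\<lambda>p. g (fst p) + s * snd p + c) \<in> \<A>" if "g \<in> dual_closure \<mu>" "(\<integral>x. g x * e x \<partial>\<mu>) = 0" for g s c
    using that unfolding \<A>_def by blast
  have \<A>E: "\<exists>g s c. g \<in> dual_closure \<mu> \<and> (\<integral>x. g x * e x \<partial>\<mu>) = 0 \<and> b = (\<lambda>p. g (fst p) + s * snd p + c)"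
    if "b \<in> \<A>" for b
    using that unfolding \<A>_def by (rule CollectD)
  have dm: "g \<in> borel_measurable borel" if "g \<in> dual_closure \<mu>" for g
    using L2_measurable[OF dual_closure_L2[OF that]] by simp
  have setsN: "sets (\<mu> \<Otimes>\<^sub>M \<gamma>) = sets M"
    unfolding M_def by (simp cong: sets_pair_measure_cong add: \<gamma>_def)
  have Xm: "X k \<in> borel_measurable (borel \<Otimes>\<^sub>M borel)" for k
    unfolding X_def by (cases k) auto
  have MX: "f \<in> borel_measurable M \<longleftrightarrow> f \<in> borel_measurable (borel \<Otimes>\<^sub>M borel)" for f :: "'a \<times> real \<Rightarrow> real"
    by (simp add: M_def)
  have "distr M (Pi\<^sub>M UNIV (\<lambda>_. borel)) (\<lambda>p k. X k p) = distr (\<mu> \<Otimes>\<^sub>M \<gamma>) (Pi\<^sub>M UNIV (\<lambda>_. borel)) (\<lambda>p k. X k p)"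
  proof (rule joint_distribution_unique[where \<A> = \<A>])
    show "finite_measure M"
      unfolding M_def by (intro finite_measure_distr) measurable
    show "finite_measure (\<mu> \<Otimes>\<^sub>M \<gamma>)" by unfold_locales
    show "sets (\<mu> \<Otimes>\<^sub>M \<gamma>) = sets M" by (rule setsN)
    show "X k \<in> borel_measurable M" for k using Xm MX by blast
    show "b \<in> borel_measurable M" if bA: "b \<in> \<A>" for b
    proof -
      obtain g s c where g: "g \<in> dual_closure \<mu>" and b: "b = (\<lambda>p. g (fst p) + s * snd p + c)"
        using \<A>E[OF bA] by blast
      note [measurable] = dm[OF g]
      show ?thesis unfolding MX b by measurable
    qed
    show "(\<lambda>_. 0) \<in> \<A>"
      using \<A>I[of "\<lambda>x. 0 * e x + 0 * e x" 0 0] dual_closure_lincomb[OF e e, of 0 0] by simp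
    show "(\<lambda>x. b x + r) \<in> \<A>" if bA: "b \<in> \<A>" for b r
    proof -
      obtain g s c where g: "g \<in> dual_closure \<mu>" "(\<integral>x. g x * e x \<partial>\<mu>) = 0" and b: "b = (\<lambda>p. g (fst p) + s * snd p + c)"
        using \<A>E[OF bA] by blast
      show ?thesis using \<A>I[OF g, of s "c + r"] by (simp add: b add.assoc)
    qed
    show "(\<lambda>x. b x + r * X k x) \<in> \<A>" if bA: "b \<in> \<A>" for b r k
    proof -
      obtain g s c where g: "g \<in> dual_closure \<mu>" "(\<integral>x. g x * e x \<partial>\<mu>) = 0" and b: "b = (\<lambda>p. g (fst p) + s * snd p + c)"
        using \<A>E[OF bA] by blast
      show ?thesis
      proof (cases k)
        case 0
        have "(\<lambda>x. b x + r * X k x) = (\<lambda>p. g (fst p) + (s + r) * snd p + c)"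
          by (simp add: b X_def 0 algebra_simps)
        then show ?thesis using \<A>I[OF g, of "s + r" c] by simp
      next
        case (Suc i)
        \<comment> \<open>Adding \<open>r\<close> times the residual \<open>l i - a i * e\<close>
          keeps \<open>g\<close> orthogonal to \<open>e\<close>; this is what fixes
          \<open>a i\<close> as the regression coefficient of \<open>l i\<close> on
          \<open>e\<close>.\<close>
        define g' where "g' x = 1 * g x + 1 * (r * l i x + (- r * a i) * e x)" for x
        have d: "(\<lambda>x. r * l i x + (- r * a i) * e x) \<in> dual_closure \<mu>"
          by (rule dual_closure_lincomb[OF dual_in_dual_closure e])
        have "g' \<in> dual_closure \<mu>"
          unfolding g'_def by (rule dual_closure_lincomb[OF g(1) d])
        moreover have "(\<integral>x. g' x * e x \<partial>\<mu>) = 0"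
        proof -
          have "(\<integral>x. g' x * e x \<partial>\<mu>) = (\<integral>x. g x * e x + (r * (e x * l i x) - (r * a i) * (e x)\<^sup>2) \<partial>\<mu>)"
            by (simp add: g'_def power2_eq_square algebra_simps)
          also have "\<dots> = (\<integral>x. g x * e x \<partial>\<mu>) + (r * (\<integral>x. e x * l i x \<partial>\<mu>) - (r * a i) * (\<integral>x. (e x)\<^sup>2 \<partial>\<mu>))"
            using L2_mult_integrable[OF dual_closure_L2[OF g(1)] eL] L2_mult_integrable[OF eL dual_L2[of "l i"]] eL
            by (simp add: L2_def)
          also have "\<dots> = 0" using s g(2) a[of i] by simp
          finally show ?thesis .
        qed
        ultimately have "(\<lambda>p. g' (fst p) + s * snd p + c) \<in> \<A>" by (rule \<A>I)
        also have "(\<lambda>p. g' (fst p) + s * snd p + c) = (\<lambda>x. b x + r * X k x)"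
          by (simp add: g'_def b X_def Suc algebra_simps)
        finally show ?thesis .
      qed
    qed
    show "(\<integral>x. cos (b x) \<partial>M) = (\<integral>x. cos (b x) \<partial>(\<mu> \<Otimes>\<^sub>M \<gamma>))" if bA: "b \<in> \<A>" for b
    proof -
      obtain g r c where g: "g \<in> dual_closure \<mu>" "(\<integral>x. g x * e x \<partial>\<mu>) = 0" and b: "b = (\<lambda>p. g (fst p) + r * snd p + c)"
        using \<A>E[OF bA] by blast
      note [measurable] = dm[OF g(1)]
      have bm [measurable]: "b \<in> borel_measurable (borel \<Otimes>\<^sub>M borel)" unfolding b by measurable
      have "(\<integral>x. cos (b x) \<partial>M) = (\<integral>x. cos ((1 * g x + r * e x) + c) \<partial>\<mu>)"
        unfolding M_def by (subst integral_distr) (auto simp: b)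
      also have "\<dots> = exp (- (\<integral>x. (1 * g x + r * e x)\<^sup>2 \<partial>\<mu>) / 2) * cos c"
        by (rule dual_closure_cos[OF dual_closure_lincomb[OF g(1) e]])
      \<comment> \<open>By orthogonality the variances add up. On the product space Fubini yields
        the same value as a product of two exponentials.\<close>
      also have "(\<integral>x. (1 * g x + r * e x)\<^sup>2 \<partial>\<mu>) = (\<integral>x. (g x)\<^sup>2 \<partial>\<mu>) + (r * \<sigma>)\<^sup>2"
        unfolding L2_integral_lincomb_sq[OF dual_closure_L2[OF g(1)] eL] using g(2) s(2)
        by (simp add: power_mult_distrib)
      finally have 1: "(\<integral>x. cos (b x) \<partial>M) = exp (- ((\<integral>x. (g x)\<^sup>2 \<partial>\<mu>) + (r * \<sigma>)\<^sup>2) / 2) * cos c" .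
      have "(\<lambda>p. cos (b p)) \<in> borel_measurable (\<mu> \<Otimes>\<^sub>M \<gamma>)" by measurable
      then have "integrable (\<mu> \<Otimes>\<^sub>M \<gamma>) (\<lambda>p. cos (b p))"
        by (intro P.integrable_const_bound[of _ 1]) auto
      then have "(\<integral>x. cos (b x) \<partial>(\<mu> \<Otimes>\<^sub>M \<gamma>)) = (\<integral>x. \<integral>y. cos (b (x, y)) \<partial>\<gamma> \<partial>\<mu>)"
        by (rule P.integral_fst'[symmetric])
      also have "\<dots> = (\<integral>x. \<integral>y. cos (r * y + (g x + c)) \<partial>\<gamma> \<partial>\<mu>)"
        by (simp add: b ac_simps)
      also have "\<dots> = (\<integral>x. exp (- (r * \<sigma>)\<^sup>2 / 2) * cos (g x + c) \<partial>\<mu>)"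
        unfolding \<gamma>_def integral_normal_density_cos[OF s(1)] ..
      also have "\<dots> = exp (- (r * \<sigma>)\<^sup>2 / 2) * (exp (- (\<integral>x. (g x)\<^sup>2 \<partial>\<mu>) / 2) * cos c)"
        using dual_closure_cos[OF g(1), of c] by simp
      also have "\<dots> = exp (- ((\<integral>x. (g x)\<^sup>2 \<partial>\<mu>) + (r * \<sigma>)\<^sup>2) / 2) * cos c"
        unfolding mult.assoc[symmetric] exp_add[symmetric] by (simp add: field_simps)
      finally show ?thesis using 1 by simp
    qed
  qed
  also have "distr M (Pi\<^sub>M UNIV (\<lambda>_. borel)) (\<lambda>p k. X k p) = distr \<mu> (Pi\<^sub>M UNIV (\<lambda>_. borel)) (\<lambda>x k. X k (x, e x))"
  proof -
    have "(\<lambda>p k. X k p) \<in> measurable (borel \<Otimes>\<^sub>M borel) (Pi\<^sub>M UNIV (\<lambda>_. borel))"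
      by (intro measurable_PiM_single') (auto simp: Xm)
    then show ?thesis
      unfolding M_def by (subst distr_distr) (auto simp: comp_def)
  qed
  finally show ?thesis .
qed

text \<open>\<open>\<Psi>\<close> may depend on the whole sequence of functionals and is
  differentiated only in the direction of the values \<open>l i h\<close>. With the residuals
  \<open>m x\<close> held fixed, the value \<open>y\<close> of \<open>e\<close> moves the argument
  by \<open>y / \<sigma>\<^sup>2\<close> in that direction, and the one-dimensional formula applies
  on the resulting line.\<close>

theorem cylindrical_integration_by_parts:
  fixes l :: "nat \<Rightarrow> 'a \<Rightarrow>\<^sub>L real" and \<Psi> \<Psi>' :: "(nat \<Rightarrow> real) \<Rightarrow> real"
  assumes h: "h \<in> cameron_martin \<mu>"
    and meas [measurable]: "\<Psi> \<in> borel_measurable (Pi\<^sub>M UNIV (\<lambda>_. borel))" "\<Psi>' \<in> borel_measurable (Pi\<^sub>M UNIV (\<lambda>_. borel))"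
    and bd: "\<And>z. \<bar>\<Psi> z\<bar> \<le> C" "\<And>z. \<bar>\<Psi>' z\<bar> \<le> C"
    and der: "\<And>z y. ((\<lambda>t. \<Psi> (\<lambda>i. z i + t * l i h)) has_real_derivative \<Psi>' (\<lambda>i. z i + y * l i h)) (at y)"
  shows "(\<integral>x. \<Psi>' (\<lambda>i. l i x) \<partial>\<mu>) = (\<integral>x. \<Psi> (\<lambda>i. l i x) * hat \<mu> h x \<partial>\<mu>)"
proof -
  define e where "e = hat \<mu> h"
  have e: "e \<in> dual_closure \<mu>" and eL: "e \<in> L2 \<mu>" unfolding e_def using hat(1)[OF h] hat_L2[OF h] by auto
  have [measurable]: "e \<in> borel_measurable borel" using L2_measurable[OF eL] by simp
  have lh: "l i h = (\<integral>x. e x * l i x \<partial>\<mu>)" for i unfolding e_def by (rule dual_apply_hat[OF h])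
  have V: "0 \<le> (\<integral>x. (e x)\<^sup>2 \<partial>\<mu>)" by simp
  have lm: "(\<lambda>x i. l i x) \<in> measurable \<mu> (Pi\<^sub>M UNIV (\<lambda>_. borel))"
    by (intro measurable_PiM_single') auto
  show ?thesis
  proof (cases "(\<integral>x. (e x)\<^sup>2 \<partial>\<mu>) = 0")
    \<comment> \<open>With vanishing variance every \<open>l i h\<close> is 0 by Cauchy-Schwarz.
      Then \<open>\<Psi>\<close> is constant in the direction considered, \<open>e\<close> is 0
      almost everywhere, and both sides vanish.\<close>
    case True
    then have "AE x in \<mu>. (e x)\<^sup>2 = 0"
      using eL integral_nonneg_eq_0_iff_AE[of \<mu> "\<lambda>x. (e x)\<^sup>2"] by (simp add: L2_def)
    then have e0: "AE x in \<mu>. e x = 0" by simp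
    have "l i h = 0" for i
      using L2_Cauchy_Schwarz[OF eL dual_L2[of "l i"]] True by (simp add: lh)
    then have "\<Psi>' z = 0" for z
      using DERIV_unique[OF der[of z 0] ] by simp
    moreover have "(\<integral>x. \<Psi> (\<lambda>i. l i x) * e x \<partial>\<mu>) = (\<integral>x. 0 \<partial>\<mu>)"
      using e0 measurable_compose[OF lm meas(1)] by (intro integral_cong_AE) auto
    ultimately show ?thesis by (simp add: e_def)
  next
    case False
    define \<sigma> where "\<sigma> = sqrt (\<integral>x. (e x)\<^sup>2 \<partial>\<mu>)"
    have s: "\<sigma> > 0" "(\<integral>x. (e x)\<^sup>2 \<partial>\<mu>) = \<sigma>\<^sup>2" using False V by (simp_all add: \<sigma>_def less_le)
    define a where "a i = l i h / \<sigma>\<^sup>2" for i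
    have a: "a i = (\<integral>x. e x * l i x \<partial>\<mu>) / \<sigma>\<^sup>2" for i by (simp add: a_def lh)
    define \<gamma> where "\<gamma> = density lborel (\<lambda>x. ennreal (normal_density 0 \<sigma> x))"
    interpret G: prob_space \<gamma> unfolding \<gamma>_def using s(1) by (rule prob_space_normal_density)
    interpret P: pair_prob_space \<mu> \<gamma> ..
    have [measurable_cong]: "sets \<gamma> = sets borel" by (simp add: \<gamma>_def)
    define X where "X = (\<lambda>k p. case k of 0 \<Rightarrow> snd p | Suc i \<Rightarrow> l i (fst p) - a i * e (fst p))"
    define D where "D = distr (\<mu> \<Otimes>\<^sub>M \<gamma>) (Pi\<^sub>M UNIV (\<lambda>_. borel)) (\<lambda>p k. X k p)"
    have DM: "D = distr \<mu> (Pi\<^sub>M UNIV (\<lambda>_. borel)) (\<lambda>x k. X k (x, e x))"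
      using decorrelated_distribution[of e \<sigma> a l, OF e s a] unfolding D_def X_def \<gamma>_def by simp
    have Xk: "X k \<in> borel_measurable (borel \<Otimes>\<^sub>M borel)" for k
      unfolding X_def by (cases k) auto
    have Xm1: "(\<lambda>p k. X k p) \<in> measurable (\<mu> \<Otimes>\<^sub>M \<gamma>) (Pi\<^sub>M UNIV (\<lambda>_. borel))"
      using Xk by (intro measurable_PiM_single') (auto cong: measurable_cong_sets sets_pair_measure_cong simp: \<gamma>_def)
    have Xm2: "(\<lambda>x k. X k (x, e x)) \<in> measurable \<mu> (Pi\<^sub>M UNIV (\<lambda>_. borel))"
      using Xk by (intro measurable_PiM_single' measurable_compose[OF _ Xk]) auto
    \<comment> \<open>Undoes the decoupling: \<open>l i\<close> is its residual, stored at
      \<open>Suc i\<close>, plus \<open>a i\<close> times the value of \<open>e\<close>, stored at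
      0.\<close>
    define T where "T \<omega> = (\<lambda>i. \<omega> (Suc i) + a i * \<omega> 0)" for \<omega> :: "nat \<Rightarrow> real"
    have Tm [measurable]: "T \<in> measurable (Pi\<^sub>M UNIV (\<lambda>_. borel)) (Pi\<^sub>M UNIV (\<lambda>_. borel))"
      unfolding T_def by (intro measurable_PiM_single') auto
    have TX1: "T (\<lambda>k. X k (x, e x)) = (\<lambda>i. l i x)" for x
      by (simp add: T_def X_def)
    define m where "m x i = l i x - a i * e x" for x i
    have TX2: "T (\<lambda>k. X k (x, y)) = (\<lambda>i. m x i + a i * y)" for x y
      by (simp add: T_def X_def m_def)
    have ai: "a i * y = (y / \<sigma>\<^sup>2) * l i h" for i y by (simp add: a_def)
    \<comment> \<open>An expectation in the \<open>l i\<close> and \<open>e\<close> becomes an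
      iterated one, in which the residuals and the normal variable \<open>y\<close> vary
      independently.\<close>
    have transfer: "(\<integral>x. F (\<lambda>i. l i x) (e x) \<partial>\<mu>) = (\<integral>x. \<integral>y. F (\<lambda>i. m x i + a i * y) y \<partial>\<gamma> \<partial>\<mu>)"
      if F: "(\<lambda>\<omega>. F (T \<omega>) (\<omega> 0)) \<in> borel_measurable (Pi\<^sub>M UNIV (\<lambda>_. borel))"
        and int: "integrable \<mu> (\<lambda>x. F (\<lambda>i. l i x) (e x))" for F :: "(nat \<Rightarrow> real) \<Rightarrow> real \<Rightarrow> real"
    proof -
      have X0: "X 0 p = snd p" for p by (simp add: X_def)
      have "(\<integral>x. F (\<lambda>i. l i x) (e x) \<partial>\<mu>) = (\<integral>\<omega>. F (T \<omega>) (\<omega> 0) \<partial>D)"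
        unfolding DM integral_distr[OF Xm2 F] by (simp add: TX1 X0)
      also have "\<dots> = (\<integral>p. F (T (\<lambda>k. X k p)) (X 0 p) \<partial>(\<mu> \<Otimes>\<^sub>M \<gamma>))"
        unfolding D_def by (rule integral_distr[OF Xm1 F])
      also have "\<dots> = (\<integral>x. \<integral>y. F (T (\<lambda>k. X k (x, y))) (X 0 (x, y)) \<partial>\<gamma> \<partial>\<mu>)"
      proof (rule P.integral_fst'[symmetric])
        have "integrable D (\<lambda>\<omega>. F (T \<omega>) (\<omega> 0))"
          unfolding DM integrable_distr_eq[OF Xm2 F] using int by (simp add: TX1 X0)
        then show "integrable (\<mu> \<Otimes>\<^sub>M \<gamma>) (\<lambda>p. F (T (\<lambda>k. X k p)) (X 0 p))"
          unfolding D_def integrable_distr_eq[OF Xm1 F] .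
      qed
      finally show ?thesis by (simp add: TX2 X0)
    qed
    have i1: "integrable \<mu> (\<lambda>x. \<Psi>' (\<lambda>i. l i x))"
      using bd(2) measurable_compose[OF lm meas(2)] by (intro integrable_const_bound[of _ C]) auto
    have i2: "integrable \<mu> (\<lambda>x. \<Psi> (\<lambda>i. l i x) * e x)"
    proof (rule Bochner_Integration.integrable_bound)
      show "integrable \<mu> (\<lambda>x. C * e x)" using L2_integrable[OF eL] by simp
      show "AE x in \<mu>. norm (\<Psi> (\<lambda>i. l i x) * e x) \<le> norm (C * e x)"
        using bd(1) by (auto simp: abs_mult intro!: mult_right_mono order_trans[OF bd(1) abs_ge_self])
      show "(\<lambda>x. \<Psi> (\<lambda>i. l i x) * e x) \<in> borel_measurable \<mu>"
        using measurable_compose[OF lm meas(1)] by measurable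
    qed
    have inner: "(\<integral>y. \<Psi>' (\<lambda>i. m x i + a i * y) \<partial>\<gamma>) = (\<integral>y. \<Psi> (\<lambda>i. m x i + a i * y) * y \<partial>\<gamma>)" for x
    proof -
      have "(\<lambda>y i. m x i + a i * y) \<in> measurable borel (Pi\<^sub>M UNIV (\<lambda>_. borel))"
        by (intro measurable_PiM_single') auto
      from measurable_compose[OF this meas(2)]
      have [measurable]: "(\<lambda>y. \<Psi>' (\<lambda>i. m x i + a i * y)) \<in> borel_measurable borel" .
      have s2: "inverse (\<sigma>\<^sup>2) > 0" using s by simp
      \<comment> \<open>The chain rule for the rescaling \<open>y / \<sigma>\<^sup>2\<close>
        produces the same factor as the normal formula, and the two cancel.\<close>
      have "(\<integral>y. \<Psi>' (\<lambda>i. m x i + a i * y) / \<sigma>\<^sup>2 \<partial>\<gamma>) = (\<integral>y. \<Psi> (\<lambda>i. m x i + a i * y) * y \<partial>\<gamma>) / \<sigma>\<^sup>2"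
        unfolding \<gamma>_def
      proof (rule normal_density_integration_by_parts[OF s(1)])
        show "((\<lambda>y. \<Psi> (\<lambda>i. m x i + a i * y)) has_real_derivative \<Psi>' (\<lambda>i. m x i + a i * y) / \<sigma>\<^sup>2) (at y)" for y
        proof -
          have "((\<lambda>y. y / \<sigma>\<^sup>2) has_real_derivative 1 / \<sigma>\<^sup>2) (at y)"
            by (rule DERIV_cdivide[OF DERIV_ident])
          from DERIV_chain2[OF der[of "m x" "y / \<sigma>\<^sup>2"] this] show ?thesis by (simp add: ai)
        qed
        show "\<bar>\<Psi> (\<lambda>i. m x i + a i * y)\<bar> \<le> C + C / \<sigma>\<^sup>2" for y
          using bd(1)[of "\<lambda>i. m x i + a i * y"] bd(2)[of "\<lambda>i. m x i + a i * y"] s2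
          by (intro order_trans[OF bd(1)]) simp
        show "\<bar>\<Psi>' (\<lambda>i. m x i + a i * y) / \<sigma>\<^sup>2\<bar> \<le> C + C / \<sigma>\<^sup>2" for y
          using divide_right_mono[OF bd(2)[of "\<lambda>i. m x i + a i * y"], of "\<sigma>\<^sup>2"] bd(1)[of undefined] s
          by (simp add: abs_ge_zero[THEN order_trans] add_increasing)
      qed measurable
      then show ?thesis using s by simp
    qed
    have "(\<integral>x. \<Psi>' (\<lambda>i. l i x) \<partial>\<mu>) = (\<integral>x. \<integral>y. \<Psi>' (\<lambda>i. m x i + a i * y) \<partial>\<gamma> \<partial>\<mu>)"
      by (rule transfer[of "\<lambda>z _. \<Psi>' z"]) (use i1 in auto)
    also have "\<dots> = (\<integral>x. \<Psi> (\<lambda>i. l i x) * e x \<partial>\<mu>)"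
      unfolding inner by (rule transfer[of "\<lambda>z y. \<Psi> z * y", symmetric]) (use i2 in auto)
    finally show ?thesis by (simp add: e_def)
  qed
qed

end

section \<open>Derivatives of cylindrical functions\<close>

text \<open>Parametrising the segment by \<open>a + t * k\<close> treats positive, negative and zero
  increments alike.\<close>

lemma mvt_unit_interval:
  fixes g g' :: "real \<Rightarrow> real"
  assumes der: "\<And>t. (g has_real_derivative g' t) (at t)"
  obtains \<theta> where "0 \<le> \<theta>" "\<theta> \<le> 1" "g (a + k) - g a = k * g' (a + \<theta> * k)"
proof -
  have "((\<lambda>t. g (a + t * k)) has_real_derivative g' (a + t * k) * k) (at t)" for t
    by (rule DERIV_chain2[OF der]) (auto intro!: derivative_eq_intros)
  then obtain \<theta> where "0 < \<theta>" "\<theta> < 1" "g (a + 1 * k) - g (a + 0 * k) = (1 - 0) * (g' (a + \<theta> * k) * k)"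
    using MVT2[of 0 1 "\<lambda>t. g (a + t * k)" "\<lambda>t. g' (a + t * k) * k"] by auto
  then show thesis by (intro that[of \<theta>]) (auto simp: mult.commute)
qed

text \<open>For \<open>m\<close> from 0 to \<open>n\<close> the points
  \<open>shift_coords m z k\<close> form a staircase path starting at \<open>z\<close>, on which one
  coordinate is moved at a time.\<close>

definition shift_coords :: "nat \<Rightarrow> (nat \<Rightarrow> real) \<Rightarrow> (nat \<Rightarrow> real) \<Rightarrow> nat \<Rightarrow> real" where
  "shift_coords n z k = (\<lambda>i. z i + (if i < n then k i else 0))"

text \<open>The increment telescopes along the staircase path, and each stage is a mean value
  theorem in a single coordinate. Writing the intermediate points as shifts of \<open>z\<close> by
  amounts no larger than \<open>k\<close> allows the statement to be applied a second time, to the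
  partial derivatives there.\<close>

lemma coordinatewise_mvt:
  fixes \<psi> :: "(nat \<Rightarrow> real) \<Rightarrow> real" and D :: "nat \<Rightarrow> (nat \<Rightarrow> real) \<Rightarrow> real"
  assumes der: "\<And>i v. i < n \<Longrightarrow> ((\<lambda>t. \<psi> (v(i := t))) has_real_derivative D i v) (at (v i))"
  obtains \<kappa> where "\<And>m i. \<bar>\<kappa> m i\<bar> \<le> \<bar>k i\<bar>"
    "\<psi> (shift_coords n z k) - \<psi> z = (\<Sum>m<n. k m * D m (shift_coords n z (\<kappa> m)))"
proof -
  have "\<exists>\<kappa>. (\<forall>i. \<bar>\<kappa> i\<bar> \<le> \<bar>k i\<bar>) \<and>
      \<psi> (shift_coords (Suc m) z k) - \<psi> (shift_coords m z k) = k m * D m (shift_coords n z \<kappa>)" if m: "m < n" for m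
  proof -
    define w where "w = shift_coords m z k"
    have wm: "w m = z m" by (simp add: w_def shift_coords_def)
    have "((\<lambda>t. \<psi> (w(m := t))) has_real_derivative D m (w(m := t))) (at t)" for t
      using der[OF m, of "w(m := t)"] by simp
    then obtain \<theta> where t: "0 \<le> \<theta>" "\<theta> \<le> 1"
      "\<psi> (w(m := z m + k m)) - \<psi> (w(m := z m)) = k m * D m (w(m := z m + \<theta> * k m))"
      using mvt_unit_interval[of "\<lambda>t. \<psi> (w(m := t))" "\<lambda>t. D m (w(m := t))" "z m" "k m"] by blast
    \<comment> \<open>At stage \<open>m\<close> the earlier coordinates have moved completely,
      coordinate \<open>m\<close> by the fraction \<theta>, and the later ones not yet.\<close>
    define \<kappa> where "\<kappa> i = (if i < m then k i else if i = m then \<theta> * k m else 0)" for i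
    have "w(m := z m + k m) = shift_coords (Suc m) z k"
      by (auto simp: w_def shift_coords_def)
    moreover have "w(m := z m) = w" using wm by auto
    moreover have "w(m := z m + \<theta> * k m) = shift_coords n z \<kappa>"
      using m by (auto simp: w_def shift_coords_def \<kappa>_def)
    moreover have "\<bar>\<kappa> i\<bar> \<le> \<bar>k i\<bar>" for i
      using t(1,2) by (auto simp: \<kappa>_def abs_mult mult_left_le_one_le)
    ultimately show ?thesis using t(3) unfolding w_def by metis
  qed
  then obtain \<kappa> where k: "\<And>m i. m < n \<Longrightarrow> \<bar>\<kappa> m i\<bar> \<le> \<bar>k i\<bar>"
    "\<And>m. m < n \<Longrightarrow> \<psi> (shift_coords (Suc m) z k) - \<psi> (shift_coords m z k) = k m * D m (shift_coords n z (\<kappa> m))"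
    by metis
  define \<kappa>' where "\<kappa>' m = (if m < n then \<kappa> m else (\<lambda>_. 0))" for m
  have "\<psi> (shift_coords n z k) - \<psi> z = (\<Sum>m<n. \<psi> (shift_coords (Suc m) z k) - \<psi> (shift_coords m z k))"
    by (subst sum_lessThan_telescope) (simp add: shift_coords_def)
  also have "\<dots> = (\<Sum>m<n. k m * D m (shift_coords n z (\<kappa>' m)))"
    by (rule sum.cong) (auto simp: k(2) \<kappa>'_def)
  finally show thesis
    by (intro that[of \<kappa>']) (auto simp: \<kappa>'_def k(1))
qed

lemma lipschitz_of_bounded_partials:
  fixes \<psi> :: "(nat \<Rightarrow> real) \<Rightarrow> real"
  assumes der: "\<And>i v. i < n \<Longrightarrow> ((\<lambda>t. \<psi> (v(i := t))) has_real_derivative D i v) (at (v i))"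
    and bd: "\<And>i v. i < n \<Longrightarrow> \<bar>D i v\<bar> \<le> B"
  shows "\<bar>\<psi> (shift_coords n z k) - \<psi> z\<bar> \<le> B * (\<Sum>i<n. \<bar>k i\<bar>)"
proof -
  obtain \<kappa> where "\<psi> (shift_coords n z k) - \<psi> z = (\<Sum>m<n. k m * D m (shift_coords n z (\<kappa> m)))"
    using coordinatewise_mvt[of n \<psi> D k z] der by metis
  then have "\<bar>\<psi> (shift_coords n z k) - \<psi> z\<bar> \<le> (\<Sum>m<n. \<bar>k m * D m (shift_coords n z (\<kappa> m))\<bar>)"
    by (simp add: sum_abs)
  also have "\<dots> \<le> (\<Sum>m<n. \<bar>k m\<bar> * B)"
    by (intro sum_mono) (auto simp: abs_mult bd intro!: mult_left_mono)
  finally show ?thesis by (simp add: sum_distrib_left mult.commute)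
qed

text \<open>The increment is a sum of first partials at intermediate points, and the Lipschitz
  estimate for each \<open>D m\<close> compares these with the partials at \<open>z\<close>. The
  comparison costs another factor \<open>\<Sum>i<n. \<bar>k i\<bar>\<close>, hence the
  square.\<close>

lemma taylor_of_bounded_second_partials:
  fixes \<psi> :: "(nat \<Rightarrow> real) \<Rightarrow> real"
  assumes der: "\<And>i v. i < n \<Longrightarrow> ((\<lambda>t. \<psi> (v(i := t))) has_real_derivative D i v) (at (v i))"
    and der2: "\<And>i j v. i < n \<Longrightarrow> j < n \<Longrightarrow> ((\<lambda>t. D i (v(j := t))) has_real_derivative E i j v) (at (v j))"
    and bd: "\<And>i j v. i < n \<Longrightarrow> j < n \<Longrightarrow> \<bar>E i j v\<bar> \<le> B" and B: "0 \<le> B"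
  shows "\<bar>\<psi> (shift_coords n z k) - \<psi> z - (\<Sum>i<n. k i * D i z)\<bar> \<le> B * (\<Sum>i<n. \<bar>k i\<bar>)\<^sup>2"
proof -
  obtain \<kappa> where \<kappa>: "\<And>m i. \<bar>\<kappa> m i\<bar> \<le> \<bar>k i\<bar>"
    "\<psi> (shift_coords n z k) - \<psi> z = (\<Sum>m<n. k m * D m (shift_coords n z (\<kappa> m)))"
    using coordinatewise_mvt[of n \<psi> D k z] der by metis
  have "\<bar>\<psi> (shift_coords n z k) - \<psi> z - (\<Sum>i<n. k i * D i z)\<bar> = \<bar>\<Sum>m<n. k m * (D m (shift_coords n z (\<kappa> m)) - D m z)\<bar>"
    unfolding \<kappa>(2) by (simp add: sum_subtractf right_diff_distrib)
  also have "\<dots> \<le> (\<Sum>m<n. \<bar>k m\<bar> * \<bar>D m (shift_coords n z (\<kappa> m)) - D m z\<bar>)"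
    by (rule order_trans[OF sum_abs]) (simp add: abs_mult)
  also have "\<dots> \<le> (\<Sum>m<n. \<bar>k m\<bar> * (B * (\<Sum>i<n. \<bar>k i\<bar>)))"
  proof (intro sum_mono mult_left_mono)
    fix m assume m: "m \<in> {..<n}"
    have "\<bar>D m (shift_coords n z (\<kappa> m)) - D m z\<bar> \<le> B * (\<Sum>i<n. \<bar>\<kappa> m i\<bar>)"
      using m by (intro lipschitz_of_bounded_partials[of n "D m" "E m"] der2 bd) auto
    also have "\<dots> \<le> B * (\<Sum>i<n. \<bar>k i\<bar>)"
      by (intro mult_left_mono sum_mono \<kappa>(1) B)
    finally show "\<bar>D m (shift_coords n z (\<kappa> m)) - D m z\<bar> \<le> B * (\<Sum>i<n. \<bar>k i\<bar>)" .
  qed simp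
  also have "\<dots> = B * (\<Sum>i<n. \<bar>k i\<bar>)\<^sup>2"
    unfolding sum_distrib_right[symmetric] by (simp add: power2_eq_square mult_ac)
  finally show ?thesis .
qed

text \<open>Functions of finitely many variables are extended to all real sequences, so that the number of variables
  enters only through the quadratic Taylor bound; \<open>D\<close> are the first partial derivatives.\<close>
definition cyl_data :: "nat \<Rightarrow> ((nat \<Rightarrow> real) \<Rightarrow> real) \<Rightarrow> (nat \<Rightarrow> (nat \<Rightarrow> real) \<Rightarrow> real) \<Rightarrow> real \<Rightarrow> bool" where
  "cyl_data n \<phi> D C \<longleftrightarrow>
     \<phi> \<in> borel_measurable (Pi\<^sub>M UNIV (\<lambda>_. borel)) \<and> (\<forall>i. D i \<in> borel_measurable (Pi\<^sub>M UNIV (\<lambda>_. borel))) \<and>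
     (\<forall>z. \<bar>\<phi> z\<bar> \<le> C) \<and> (\<forall>i z. \<bar>D i z\<bar> \<le> C) \<and>
     (\<forall>z k. \<bar>\<phi> (\<lambda>i. z i + k i) - \<phi> z - (\<Sum>i<n. k i * D i z)\<bar> \<le> C * (\<Sum>i<n. \<bar>k i\<bar>)\<^sup>2)"

lemma cyl_dataD:
  assumes "cyl_data n \<phi> D C"
  shows "\<phi> \<in> borel_measurable (Pi\<^sub>M UNIV (\<lambda>_. borel))" "D i \<in> borel_measurable (Pi\<^sub>M UNIV (\<lambda>_. borel))"
    "\<bar>\<phi> z\<bar> \<le> C" "\<bar>D i z\<bar> \<le> C" "0 \<le> C"
    "\<bar>\<phi> (\<lambda>i. z i + k i) - \<phi> z - (\<Sum>i<n. k i * D i z)\<bar> \<le> C * (\<Sum>i<n. \<bar>k i\<bar>)\<^sup>2"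
  using assms order_trans[OF abs_ge_zero, of "\<phi> z" C] by (simp_all add: cyl_data_def)

text \<open>Composition with the truncation \<open>tr\<close> extends the function and its iterated
  partials from \<open>Euclidean_space n\<close> to all real sequences, where measurability refers
  to the infinite product. The second partials enter only through the Taylor bound.\<close>

lemma FCb_cyl_data:
  fixes f :: "'a::real_normed_vector \<Rightarrow> real"
  assumes "f \<in> FCb"
  obtains n \<phi> D C and l :: "nat \<Rightarrow> 'a \<Rightarrow>\<^sub>L real" where
    "cyl_data n \<phi> D C" "f = (\<lambda>x. \<phi> (\<lambda>i. blinfun_apply (l i) x))"
proof -
  obtain n \<phi>0 and l :: "nat \<Rightarrow> 'a \<Rightarrow>\<^sub>L real" where \<phi>0: "Cb_infinity n \<phi>0"
    and f: "f = (\<lambda>x. \<phi>0 (\<lambda>i. if i < n then l i x else 0))"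
    using assms unfolding FCb_def by blast
  have top: "topspace (Euclidean_space n) = {v. \<forall>i\<ge>n. v i = 0}" by (rule topspace_Euclidean_space)
  obtain E where E0: "\<And>v. v \<in> topspace (Euclidean_space n) \<Longrightarrow> E [] v = \<phi>0 v"
    and Ec: "\<And>is. is \<in> lists {..<n} \<Longrightarrow> continuous_map (Euclidean_space n) euclideanreal (E is)"
    and Eb: "\<And>is. is \<in> lists {..<n} \<Longrightarrow> bounded (E is ` topspace (Euclidean_space n))"
    and Ed: "\<And>is i v. is \<in> lists {..<n} \<Longrightarrow> i < n \<Longrightarrow> v \<in> topspace (Euclidean_space n) \<Longrightarrow>
      ((\<lambda>t. E is (v(i := t))) has_real_derivative E (i # is) v) (at (v i))"
    using \<phi>0 unfolding Cb_infinity_def by metis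
  define tr where "tr z = (\<lambda>i. if i < n then z i else 0)" for z :: "nat \<Rightarrow> real"
  have tr: "tr z \<in> topspace (Euclidean_space n)" for z by (simp add: tr_def top)
  have trc: "continuous_map euclidean (Euclidean_space n) tr"
  proof -
    have "continuous_map euclidean (powertop_real UNIV) tr"
      unfolding continuous_map_componentwise_UNIV
    proof
      fix i
      have "continuous_on UNIV (\<lambda>z :: nat \<Rightarrow> real. tr z i)"
        by (cases "i < n") (auto simp: tr_def intro!: continuous_intros continuous_on_product_coordinates)
      then show "continuous_map euclidean euclideanreal (\<lambda>z. tr z i)" by simp
    qed
    then show ?thesis
      unfolding Euclidean_space_def continuous_map_in_subtopology by (auto simp: tr_def)
  qed
  have meas: "(\<lambda>z. E is (tr z)) \<in> borel_measurable (Pi\<^sub>M UNIV (\<lambda>_. borel))" if "is \<in> lists {..<n}" for "is"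
  proof -
    have "continuous_map euclidean euclideanreal (E is \<circ> tr)"
      by (rule continuous_map_compose[OF trc Ec[OF that]])
    then have "continuous_on UNIV (\<lambda>z. E is (tr z))" by (simp add: comp_def)
    then have "(\<lambda>z. E is (tr z)) \<in> borel_measurable borel" by (rule borel_measurable_continuous_onI)
    then show ?thesis
      using measurable_cong_sets[OF sets_PiM_equal_borel refl] by blast
  qed
  have "\<exists>B. \<forall>z. \<bar>E is (tr z)\<bar> \<le> B" if "is \<in> lists {..<n}" for "is"
    using Eb[OF that] tr unfolding bounded_iff by (metis image_eqI real_norm_def)
  then obtain B where B: "\<And>is z. is \<in> lists {..<n} \<Longrightarrow> \<bar>E is (tr z)\<bar> \<le> B is" by metis
  \<comment> \<open>Only finitely many derivatives have order at most two, so the sum of their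
    bounds serves as a common constant.\<close>
  define S where "S = {is \<in> lists {..<n}. length is \<le> 2}"
  have finS: "finite S"
    unfolding S_def using finite_lists_length_le[of "{..<n}" 2] by (simp add: lists_eq_set)
  define C where "C = (\<Sum>is\<in>S. \<bar>B is\<bar>)"
  have C0: "0 \<le> C" unfolding C_def by (simp add: sum_nonneg)
  have C: "\<bar>E is (tr z)\<bar> \<le> C" if "is \<in> lists {..<n}" "length is \<le> 2" for "is" z
  proof -
    have "\<bar>B is\<bar> \<le> C" unfolding C_def using that by (intro member_le_sum finS) (auto simp: S_def)
    then show ?thesis using B[OF that(1), of z] by linarith
  qed
  define \<phi> where "\<phi> z = E [] (tr z)" for z
  define D where "D i z = (if i < n then E [i] (tr z) else 0)" for i z
  have tru: "tr (v(i := t)) = (tr v)(i := t)" if "i < n" for v i t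
    using that by (auto simp: tr_def)
  have d: "((\<lambda>t. E is (tr (v(i := t)))) has_real_derivative E (i # is) (tr v)) (at (v i))"
    if "is \<in> lists {..<n}" "i < n" for "is" i v
  proof -
    have "tr v i = v i" using that by (simp add: tr_def)
    then show ?thesis using Ed[OF that tr[of v]] tru[OF that(2)] by simp
  qed
  have "cyl_data n \<phi> D C"
    unfolding cyl_data_def
  proof (intro conjI allI)
    show "\<phi> \<in> borel_measurable (Pi\<^sub>M UNIV (\<lambda>_. borel))" unfolding \<phi>_def by (rule meas) simp
    show "D i \<in> borel_measurable (Pi\<^sub>M UNIV (\<lambda>_. borel))" for i
      unfolding D_def using meas[of "[i]"] by (cases "i < n") auto
    show "\<bar>\<phi> z\<bar> \<le> C" for z unfolding \<phi>_def by (rule C) auto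
    show "\<bar>D i z\<bar> \<le> C" for i z unfolding D_def using C[of "[i]" z] C0 by auto
    fix z k :: "nat \<Rightarrow> real"
    have "\<bar>\<phi> (shift_coords n z k) - \<phi> z - (\<Sum>i<n. k i * D i z)\<bar> \<le> C * (\<Sum>i<n. \<bar>k i\<bar>)\<^sup>2"
    \<comment> \<open>In the index lists the last differentiation stands first:
      \<open>[j, i]\<close> is the partial in direction \<open>j\<close> of the partial in direction
      \<open>i\<close>.\<close>
    proof (rule taylor_of_bounded_second_partials[where E = "\<lambda>i j z. E [j, i] (tr z)"])
      show "((\<lambda>t. \<phi> (v(i := t))) has_real_derivative D i v) (at (v i))" if "i < n" for i v
        using d[of "[]" i v] that by (simp add: \<phi>_def D_def)
      show "((\<lambda>t. D i (v(j := t))) has_real_derivative E [j, i] (tr v)) (at (v j))" if "i < n" "j < n" for i j v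
        using d[of "[i]" j v] that by (simp add: D_def)
      show "\<bar>E [j, i] (tr v)\<bar> \<le> C" if "i < n" "j < n" for i j v
        using that by (intro C) auto
    qed (rule C0)
    moreover have "tr (shift_coords n z k) = tr (\<lambda>i. z i + k i)" by (auto simp: tr_def shift_coords_def)
    ultimately show "\<bar>\<phi> (\<lambda>i. z i + k i) - \<phi> z - (\<Sum>i<n. k i * D i z)\<bar> \<le> C * (\<Sum>i<n. \<bar>k i\<bar>)\<^sup>2"
      by (simp add: \<phi>_def)
  qed
  moreover have "f = (\<lambda>x. \<phi> (\<lambda>i. l i x))"
    using E0[OF tr] by (simp add: f \<phi>_def tr_def)
  ultimately show thesis by (rule that)
qed

lemma has_real_derivative_quadratic_error:
  fixes g :: "real \<Rightarrow> real"
  assumes "\<And>\<tau>. \<bar>g (y + \<tau>) - g y - \<tau> * c\<bar> \<le> K * \<tau>\<^sup>2"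
  shows "(g has_real_derivative c) (at y)"
  unfolding DERIV_def
proof (rule Lim_null[THEN iffD2, OF Lim_null_comparison])
  show "((\<lambda>\<tau>. K * \<bar>\<tau>\<bar>) \<longlongrightarrow> 0) (at 0)"
    by (auto intro!: tendsto_eq_intros)
  have "\<bar>(g (y + \<tau>) - g y) / \<tau> - c\<bar> \<le> K * \<bar>\<tau>\<bar>" if "\<tau> \<noteq> 0" for \<tau>
  proof -
    have "\<bar>(g (y + \<tau>) - g y) / \<tau> - c\<bar> = \<bar>g (y + \<tau>) - g y - \<tau> * c\<bar> / \<bar>\<tau>\<bar>"
      using that by (simp add: field_simps flip: abs_divide)
    also have "\<dots> \<le> K * \<tau>\<^sup>2 / \<bar>\<tau>\<bar>" by (intro divide_right_mono assms) simp
    also have "\<dots> = K * \<bar>\<tau>\<bar>" using that by (simp add: power2_eq_square field_simps abs_if)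
    finally show ?thesis .
  qed
  then show "\<forall>\<^sub>F \<tau> in at 0. norm ((g (y + \<tau>) - g y) / \<tau> - c) \<le> K * \<bar>\<tau>\<bar>"
    by (auto simp: eventually_at_filter)
qed

text \<open>The Taylor bound in \<open>cyl_data\<close> holds at every base point. Applied at the
  moved point it gives the derivative at any \<open>y\<close>, also for directions \<open>v\<close>
  with infinitely many nonzero entries.\<close>

lemma cyl_data_line_derivative:
  assumes "cyl_data n \<phi> D C"
  shows "((\<lambda>t. \<phi> (\<lambda>i. z i + t * v i)) has_real_derivative (\<Sum>i<n. D i (\<lambda>i. z i + y * v i) * v i)) (at y)"
proof (rule has_real_derivative_quadratic_error[where K = "C * (\<Sum>i<n. \<bar>v i\<bar>)\<^sup>2"])
  fix \<tau> :: real
  let ?w = "\<lambda>i. z i + y * v i"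
  have "(\<Sum>i<n. (\<tau> * v i) * D i ?w) = \<tau> * (\<Sum>i<n. D i ?w * v i)"
    by (simp add: sum_distrib_left mult_ac)
  moreover have "(\<Sum>i<n. \<bar>\<tau> * v i\<bar>)\<^sup>2 = (\<Sum>i<n. \<bar>v i\<bar>)\<^sup>2 * \<tau>\<^sup>2"
    by (simp add: abs_mult sum_distrib_left[symmetric] power_mult_distrib)
  moreover have "(\<lambda>i. z i + (y + \<tau>) * v i) = (\<lambda>i. ?w i + \<tau> * v i)"
    by (simp add: algebra_simps)
  ultimately show "\<bar>\<phi> (\<lambda>i. z i + (y + \<tau>) * v i) - \<phi> ?w - \<tau> * (\<Sum>i<n. D i ?w * v i)\<bar>
      \<le> C * (\<Sum>i<n. \<bar>v i\<bar>)\<^sup>2 * \<tau>\<^sup>2"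
    using cyl_dataD(6)[OF assms, of ?w "\<lambda>i. \<tau> * v i"] by (simp add: mult.assoc)
qed

section \<open>Gradients along \<open>H\<close> of cylindrical functions and the product
  formula\<close>

context gaussian_measure
begin

lemma cameron_martin_sum:
  fixes n :: nat
  assumes "\<And>i. i < n \<Longrightarrow> v i \<in> cameron_martin \<mu>"
  shows "(\<Sum>i<n. c i *\<^sub>R v i) \<in> cameron_martin \<mu> \<and>
    (\<forall>h\<in>cameron_martin \<mu>. inner_H \<mu> (\<Sum>i<n. c i *\<^sub>R v i) h = (\<Sum>i<n. c i * inner_H \<mu> (v i) h))"
  using assms
proof (induction n)
  case 0
  \<comment> \<open>The empty sum is reached as \<open>k - k\<close> for some \<open>k\<close> in
    the Cameron-Martin space, which also shows that its inner products vanish.\<close>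
  define k where "k = R_op \<mu> (blinfun_apply (0 :: 'a \<Rightarrow>\<^sub>L real))"
  have k: "k \<in> cameron_martin \<mu>" unfolding k_def by (rule R_op_dual_cameron_martin)
  have "k - k \<in> cameron_martin \<mu>" by (rule cameron_martin_diff(1)[OF k k])
  moreover have "inner_H \<mu> (k - k) h = inner_H \<mu> k h - inner_H \<mu> k h" if "h \<in> cameron_martin \<mu>" for h
    by (rule cameron_martin_diff(2)[OF k k that])
  ultimately show ?case by simp
next
  case (Suc n)
  have S: "(\<Sum>i<n. c i *\<^sub>R v i) \<in> cameron_martin \<mu>"
    "\<And>h. h \<in> cameron_martin \<mu> \<Longrightarrow> inner_H \<mu> (\<Sum>i<n. c i *\<^sub>R v i) h = (\<Sum>i<n. c i * inner_H \<mu> (v i) h)"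
    using Suc.IH Suc.prems by auto
  have eq: "1 *\<^sub>R (\<Sum>i<n. c i *\<^sub>R v i) + c n *\<^sub>R v n = (\<Sum>i<Suc n. c i *\<^sub>R v i)" by simp
  note lin = cameron_martin_lincomb[OF S(1) Suc.prems[of n], where a = 1 and b = "c n", unfolded eq]
  show ?case using lin S(2) by simp
qed

text \<open>Testing both expansions on a small multiple of the difference \<open>k\<close> of the
  gradients gives \<open>N * N \<le> 2 * e * N\<close> for its norm \<open>N\<close> and every
  \<open>e > 0\<close>. Uniqueness is what makes the choice in \<open>grad_H\<close>
  computable.\<close>

lemma has_grad_H_unique:
  assumes "has_grad_H \<mu> f v x" "has_grad_H \<mu> f v' x"
  shows "v = v'"
proof -
  have v: "v \<in> cameron_martin \<mu>" "v' \<in> cameron_martin \<mu>" using assms by (auto simp: has_grad_H_def)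
  define k where "k = v - v'"
  have k: "k \<in> cameron_martin \<mu>" unfolding k_def by (rule cameron_martin_diff(1)[OF v])
  define N where "N = norm_H \<mu> k"
  have N: "N \<ge> 0" by (simp add: N_def)
  have le: "N * N \<le> 2 * e * N" if e: "e > 0" for e
  proof -
    obtain d where d: "d > 0" "\<And>h. h \<in> cameron_martin \<mu> \<Longrightarrow> norm_H \<mu> h < d \<Longrightarrow> \<bar>f (x + h) - f x - inner_H \<mu> v h\<bar> \<le> e * norm_H \<mu> h"
      using assms(1) e unfolding has_grad_H_def by blast
    obtain d' where d': "d' > 0" "\<And>h. h \<in> cameron_martin \<mu> \<Longrightarrow> norm_H \<mu> h < d' \<Longrightarrow> \<bar>f (x + h) - f x - inner_H \<mu> v' h\<bar> \<le> e * norm_H \<mu> h"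
      using assms(2) e unfolding has_grad_H_def by blast
    define q where "q = min d d'"
    have q: "q > 0" using d d' by (simp add: q_def)
    \<comment> \<open>The denominator \<open>N + 1\<close> keeps \<open>\<tau> * N\<close> below
      \<open>q\<close> and is positive also when \<open>N = 0\<close>.\<close>
    define \<tau> where "\<tau> = q / (N + 1)"
    have \<tau>: "\<tau> > 0" using q N by (simp add: \<tau>_def)
    have "\<tau> * N < q"
      using q N by (simp add: \<tau>_def field_simps)
    then have "\<tau> * N < min d d'" by (simp add: q_def)
    moreover have nk: "norm_H \<mu> (\<tau> *\<^sub>R k) = \<tau> * N" "\<tau> *\<^sub>R k \<in> cameron_martin \<mu>"
      using norm_H_scale[OF k, of \<tau>] \<tau> by (simp_all add: N_def)
    ultimately have "\<bar>inner_H \<mu> v (\<tau> *\<^sub>R k) - inner_H \<mu> v' (\<tau> *\<^sub>R k)\<bar> \<le> 2 * e * (\<tau> * N)"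
      using d(2)[OF nk(2)] d'(2)[OF nk(2)] by (simp add: abs_le_iff)
    moreover have "inner_H \<mu> v (\<tau> *\<^sub>R k) - inner_H \<mu> v' (\<tau> *\<^sub>R k) = inner_H \<mu> (\<tau> *\<^sub>R k) k"
      unfolding cameron_martin_diff(2)[OF v nk(2), symmetric] k_def[symmetric] by (rule inner_H_commute)
    moreover have "inner_H \<mu> (\<tau> *\<^sub>R k) k = \<tau> * (N * N)"
    proof -
      have eq: "\<tau> *\<^sub>R k + 0 *\<^sub>R k = \<tau> *\<^sub>R k" by simp
      show ?thesis
        using cameron_martin_lincomb(2)[OF k k k, where a = \<tau> and b = 0, unfolded eq] norm_H_sq[of k]
        by (simp add: N_def power2_eq_square)
    qed
    ultimately have "\<tau> * (N * N) \<le> \<tau> * (2 * e * N)" using \<tau> N by (simp add: abs_mult mult_ac)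
    then show ?thesis using \<tau> by simp
  qed
  have "N = 0"
  proof (rule ccontr)
    assume "N \<noteq> 0"
    then have "N > 0" using N by simp
    then show False using le[of "N / 4"] by simp
  qed
  then show ?thesis using norm_H_eq_0[OF k] by (simp add: N_def k_def)
qed

text \<open>Since \<open>R_op \<mu> (l i)\<close> represents \<open>l i\<close> on \<open>H\<close>,
  the candidate pairs with \<open>h\<close> to the linear term of the Taylor expansion. The same
  representation bounds each \<open>\<bar>l i h\<bar>\<close> by a multiple of
  \<open>norm_H \<mu> h\<close>, which makes the remainder quadratic in
  \<open>norm_H \<mu> h\<close>.\<close>

lemma grad_H_cyl:
  fixes l :: "nat \<Rightarrow> 'a \<Rightarrow>\<^sub>L real"
  assumes dat: "cyl_data n \<phi> D C"
  shows "grad_H \<mu> (\<lambda>x. \<phi> (\<lambda>i. l i x)) x = (\<Sum>i<n. D i (\<lambda>i. l i x) *\<^sub>R R_op \<mu> (l i))"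
proof -
  define v where "v = (\<Sum>i<n. D i (\<lambda>i. l i x) *\<^sub>R R_op \<mu> (l i))"
  note S = cameron_martin_sum[of n "\<lambda>i. R_op \<mu> (l i)" "\<lambda>i. D i (\<lambda>i. l i x)", OF R_op_dual_cameron_martin, folded v_def]
  have vh: "inner_H \<mu> v h = (\<Sum>i<n. l i h * D i (\<lambda>i. l i x))" if "h \<in> cameron_martin \<mu>" for h
    using S that by (simp add: dual_eq_inner_H mult.commute)
  define K where "K = (\<Sum>i<n. norm_H \<mu> (R_op \<mu> (l i)))"
  have K0: "0 \<le> K" unfolding K_def by (simp add: sum_nonneg)
  have K: "(\<Sum>i<n. \<bar>l i h\<bar>) \<le> K * norm_H \<mu> h" if "h \<in> cameron_martin \<mu>" for h
    unfolding K_def sum_distrib_right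
    using inner_H_Cauchy_Schwarz[OF R_op_dual_cameron_martin that]
    by (intro sum_mono) (simp add: dual_eq_inner_H[OF that])
  have C: "0 \<le> C" by (rule cyl_dataD(5)[OF dat])
  have "has_grad_H \<mu> (\<lambda>x. \<phi> (\<lambda>i. l i x)) v x"
    unfolding has_grad_H_def
  proof (intro conjI allI impI)
    show "v \<in> cameron_martin \<mu>" using S by simp
    fix e :: real assume e: "e > 0"
    \<comment> \<open>Chosen so that \<open>C * K\<^sup>2 * norm_H \<mu> h \<le> e\<close> below
      \<open>d\<close>; the added 1 covers the case \<open>C * K\<^sup>2 = 0\<close>.\<close>
    define d where "d = e / (C * K\<^sup>2 + 1)"
    have pos: "C * K\<^sup>2 + 1 > 0" using C by (simp add: add_nonneg_pos)
    have "\<bar>\<phi> (\<lambda>i. l i (x + h)) - \<phi> (\<lambda>i. l i x) - inner_H \<mu> v h\<bar> \<le> e * norm_H \<mu> h"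
      if h: "h \<in> cameron_martin \<mu>" and hd: "norm_H \<mu> h < d" for h
    proof -
      have "\<bar>\<phi> (\<lambda>i. l i (x + h)) - \<phi> (\<lambda>i. l i x) - inner_H \<mu> v h\<bar> \<le> C * (\<Sum>i<n. \<bar>l i h\<bar>)\<^sup>2"
        using cyl_dataD(6)[OF dat, of "\<lambda>i. l i x" "\<lambda>i. l i h"] by (simp add: vh[OF h] blinfun.add_right)
      also have "\<dots> \<le> C * (K * norm_H \<mu> h)\<^sup>2"
        by (intro mult_left_mono power_mono K h C) (simp add: sum_nonneg)
      also have "\<dots> = (C * K\<^sup>2 * norm_H \<mu> h) * norm_H \<mu> h"
        by (simp add: power2_eq_square mult_ac)
      also have "\<dots> \<le> e * norm_H \<mu> h"
      proof (intro mult_right_mono)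
        have "C * K\<^sup>2 * norm_H \<mu> h \<le> (C * K\<^sup>2 + 1) * d"
          using hd C by (intro mult_mono) auto
        then show "C * K\<^sup>2 * norm_H \<mu> h \<le> e" using pos by (simp add: d_def)
      qed simp
      finally show ?thesis .
    qed
    moreover have "d > 0" using e pos by (simp add: d_def)
    ultimately show "\<exists>d>0. \<forall>h\<in>cameron_martin \<mu>. norm_H \<mu> h < d \<longrightarrow>
      \<bar>\<phi> (\<lambda>i. l i (x + h)) - \<phi> (\<lambda>i. l i x) - inner_H \<mu> v h\<bar> \<le> e * norm_H \<mu> h" by blast
  qed
  moreover from this have "has_grad_H \<mu> (\<lambda>x. \<phi> (\<lambda>i. l i x)) (grad_H \<mu> (\<lambda>x. \<phi> (\<lambda>i. l i x)) x) x"
    unfolding grad_H_def by (rule someI)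
  ultimately show ?thesis unfolding v_def[symmetric] by (rule has_grad_H_unique[rotated])
qed

lemma grad_H_cyl_cameron_martin:
  fixes l :: "nat \<Rightarrow> 'a \<Rightarrow>\<^sub>L real"
  assumes dat: "cyl_data n \<phi> D C"
  shows "grad_H \<mu> (\<lambda>x. \<phi> (\<lambda>i. l i x)) x \<in> cameron_martin \<mu>"
    and "h \<in> cameron_martin \<mu> \<Longrightarrow> inner_H \<mu> (grad_H \<mu> (\<lambda>x. \<phi> (\<lambda>i. l i x)) x) h
      = (\<Sum>i<n. D i (\<lambda>i. l i x) * inner_H \<mu> (R_op \<mu> (l i)) h)"
  unfolding grad_H_cyl[OF dat]
  using cameron_martin_sum[of n "\<lambda>i. R_op \<mu> (l i)" "\<lambda>i. D i (\<lambda>i. l i x)", OF R_op_dual_cameron_martin]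
  by auto

lemma partial_H_cyl:
  fixes l :: "nat \<Rightarrow> 'a \<Rightarrow>\<^sub>L real"
  assumes dat: "cyl_data n \<phi> D C" and h: "h \<in> cameron_martin \<mu>"
  shows "partial_H \<mu> h (\<lambda>x. \<phi> (\<lambda>i. l i x)) x = (\<Sum>i<n. D i (\<lambda>i. l i x) * l i h)"
  unfolding partial_H_def grad_H_cyl_cameron_martin(2)[OF dat h] by (simp add: dual_eq_inner_H[OF h])

lemma dual_seq_measurable:
  fixes l :: "nat \<Rightarrow> 'a \<Rightarrow>\<^sub>L real"
  shows "(\<lambda>x i. l i x) \<in> measurable \<mu> (Pi\<^sub>M UNIV (\<lambda>_. borel))"
  by (intro measurable_PiM_single') auto

lemma FCb_bounded_measurable:
  assumes "f \<in> FCb"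
  shows "f \<in> borel_measurable \<mu>" "\<exists>C. \<forall>x. \<bar>f x\<bar> \<le> C"
proof -
  obtain n \<phi> D C and l :: "nat \<Rightarrow> 'a \<Rightarrow>\<^sub>L real" where d: "cyl_data n \<phi> D C" and f: "f = (\<lambda>x. \<phi> (\<lambda>i. blinfun_apply (l i) x))"
    using FCb_cyl_data[OF assms] .
  show "f \<in> borel_measurable \<mu>"
    unfolding f by (rule measurable_compose[OF dual_seq_measurable cyl_dataD(1)[OF d]])
  show "\<exists>C. \<forall>x. \<bar>f x\<bar> \<le> C" unfolding f using cyl_dataD(3)[OF d] by blast
qed

lemma partial_H_bounded_measurable:
  assumes "f \<in> FCb" and h: "h \<in> cameron_martin \<mu>"
  shows "partial_H \<mu> h f \<in> borel_measurable \<mu>" "\<exists>C. \<forall>x. \<bar>partial_H \<mu> h f x\<bar> \<le> C"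
proof -
  obtain n \<phi> D C and l :: "nat \<Rightarrow> 'a \<Rightarrow>\<^sub>L real" where d: "cyl_data n \<phi> D C" and f: "f = (\<lambda>x. \<phi> (\<lambda>i. blinfun_apply (l i) x))"
    using FCb_cyl_data[OF assms(1)] .
  have p: "partial_H \<mu> h f = (\<lambda>x. \<Sum>i<n. D i (\<lambda>i. l i x) * l i h)"
    unfolding f using partial_H_cyl[OF d h] by auto
  note [measurable] = measurable_compose[OF dual_seq_measurable cyl_dataD(2)[OF d]]
  show "partial_H \<mu> h f \<in> borel_measurable \<mu>" unfolding p by measurable
  have "\<bar>\<Sum>i<n. D i (\<lambda>i. l i x) * l i h\<bar> \<le> (\<Sum>i<n. C * \<bar>l i h\<bar>)" for x
    by (rule order_trans[OF sum_abs])
      (auto simp: abs_mult intro!: sum_mono mult_right_mono cyl_dataD(4)[OF d])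
  then show "\<exists>C. \<forall>x. \<bar>partial_H \<mu> h f x\<bar> \<le> C" unfolding p by blast
qed

text \<open>The two cylindrical functions are put over one sequence of functionals by interleaving theirs.\<close>
lemma product_integration_by_parts:
  fixes f F :: "'a \<Rightarrow> real" and \<theta> \<theta>' :: "real \<Rightarrow> real"
  assumes f: "f \<in> FCb" and F: "F \<in> FCb" and h: "h \<in> cameron_martin \<mu>"
    and der: "\<And>r. (\<theta> has_real_derivative \<theta>' r) (at r)"
    and [measurable]: "\<theta>' \<in> borel_measurable borel"
    and bd: "\<And>r. \<bar>\<theta> r\<bar> \<le> K" "\<And>r. \<bar>\<theta>' r\<bar> \<le> K"
  shows "(\<integral>x. partial_H \<mu> h f x * \<theta> (F x) + f x * (\<theta>' (F x) * partial_H \<mu> h F x) \<partial>\<mu>)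
    = (\<integral>x. f x * \<theta> (F x) * hat \<mu> h x \<partial>\<mu>)"
proof -
  obtain n1 \<phi>1 D1 C1 and l1 :: "nat \<Rightarrow> 'a \<Rightarrow>\<^sub>L real" where d1: "cyl_data n1 \<phi>1 D1 C1"
    and f_eq: "f = (\<lambda>x. \<phi>1 (\<lambda>i. blinfun_apply (l1 i) x))"
    using FCb_cyl_data[OF f] .
  obtain n2 \<phi>2 D2 C2 and l2 :: "nat \<Rightarrow> 'a \<Rightarrow>\<^sub>L real" where d2: "cyl_data n2 \<phi>2 D2 C2"
    and F_eq: "F = (\<lambda>x. \<phi>2 (\<lambda>i. blinfun_apply (l2 i) x))"
    using FCb_cyl_data[OF F] .
  have "continuous_on UNIV \<theta>"
    using der by (auto intro!: continuous_at_imp_continuous_on DERIV_isCont)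
  then have [measurable]: "\<theta> \<in> borel_measurable borel" by (rule borel_measurable_continuous_onI)
  define L where "L i = (if even i then l1 (i div 2) else l2 (i div 2))" for i
  define ev od :: "(nat \<Rightarrow> real) \<Rightarrow> nat \<Rightarrow> real" where "ev z = (\<lambda>i. z (2 * i))" and "od z = (\<lambda>i. z (2 * i + 1))" for z
  have L: "ev (\<lambda>i. L i x) = (\<lambda>i. l1 i x)" "od (\<lambda>i. L i x) = (\<lambda>i. l2 i x)" for x
    by (auto simp: ev_def od_def L_def)
  have lin: "ev (\<lambda>i. z i + y * L i h) = (\<lambda>i. ev z i + y * l1 i h)" "od (\<lambda>i. z i + y * L i h) = (\<lambda>i. od z i + y * l2 i h)" for z y
    by (auto simp: ev_def od_def L_def)
  have em: "ev \<in> measurable (Pi\<^sub>M UNIV (\<lambda>_. borel)) (Pi\<^sub>M UNIV (\<lambda>_. borel))"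
    "od \<in> measurable (Pi\<^sub>M UNIV (\<lambda>_. borel)) (Pi\<^sub>M UNIV (\<lambda>_. borel))"
    unfolding ev_def od_def by (intro measurable_PiM_single'; auto)+
  note [measurable] = measurable_compose[OF em(1) cyl_dataD(1)[OF d1]] measurable_compose[OF em(2) cyl_dataD(1)[OF d2]]
    measurable_compose[OF em(1) cyl_dataD(2)[OF d1]] measurable_compose[OF em(2) cyl_dataD(2)[OF d2]]
  define P1 where "P1 z = (\<Sum>i<n1. D1 i (ev z) * l1 i h)" for z
  define P2 where "P2 z = (\<Sum>i<n2. D2 i (od z) * l2 i h)" for z
  have [measurable]: "P1 \<in> borel_measurable (Pi\<^sub>M UNIV (\<lambda>_. borel))" "P2 \<in> borel_measurable (Pi\<^sub>M UNIV (\<lambda>_. borel))"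
    unfolding P1_def P2_def by measurable
  define B1 where "B1 = (\<Sum>i<n1. C1 * \<bar>l1 i h\<bar>)"
  define B2 where "B2 = (\<Sum>i<n2. C2 * \<bar>l2 i h\<bar>)"
  have P1: "\<bar>P1 z\<bar> \<le> B1" for z
    unfolding P1_def B1_def by (rule order_trans[OF sum_abs])
      (auto simp: abs_mult intro!: sum_mono mult_right_mono cyl_dataD(4)[OF d1])
  have P2: "\<bar>P2 z\<bar> \<le> B2" for z
    unfolding P2_def B2_def by (rule order_trans[OF sum_abs])
      (auto simp: abs_mult intro!: sum_mono mult_right_mono cyl_dataD(4)[OF d2])
  define \<Psi> where "\<Psi> z = \<phi>1 (ev z) * \<theta> (\<phi>2 (od z))" for z
  define \<Psi>' where "\<Psi>' z = P1 z * \<theta> (\<phi>2 (od z)) + \<phi>1 (ev z) * (\<theta>' (\<phi>2 (od z)) * P2 z)" for z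
  have K: "0 \<le> K" using bd(1)[of 0] by linarith
  have B: "0 \<le> B1" "0 \<le> B2" using P1[of undefined] P2[of undefined] by linarith+
  have C1: "0 \<le> C1" by (rule cyl_dataD(5)[OF d1])
  have "(\<integral>x. \<Psi>' (\<lambda>i. L i x) \<partial>\<mu>) = (\<integral>x. \<Psi> (\<lambda>i. L i x) * hat \<mu> h x \<partial>\<mu>)"
  \<comment> \<open>One constant has to bound both \<open>\<Psi>\<close> and \<open>\<Psi>'\<close>,
    so the bounds of the two are added.\<close>
  proof (rule cylindrical_integration_by_parts[OF h, where C = "C1 * K + (B1 * K + C1 * (K * B2))"])
    show "\<Psi> \<in> borel_measurable (Pi\<^sub>M UNIV (\<lambda>_. borel))" unfolding \<Psi>_def by measurable
    show "\<Psi>' \<in> borel_measurable (Pi\<^sub>M UNIV (\<lambda>_. borel))" unfolding \<Psi>'_def by measurable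
    have b1: "\<bar>\<phi>1 z * \<theta> r\<bar> \<le> C1 * K" for z r
      unfolding abs_mult by (intro mult_mono cyl_dataD(3)[OF d1] bd C1) auto
    have b2: "\<bar>P1 z * \<theta> r\<bar> \<le> B1 * K" for z r
      unfolding abs_mult by (intro mult_mono P1 bd B) auto
    have b3: "\<bar>\<phi>1 z' * (\<theta>' r * P2 z)\<bar> \<le> C1 * (K * B2)" for z z' r
      unfolding abs_mult by (intro mult_mono cyl_dataD(3)[OF d1] bd P2 C1 K) auto
    show "\<bar>\<Psi> z\<bar> \<le> C1 * K + (B1 * K + C1 * (K * B2))" for z
      using b1[of "ev z" "\<phi>2 (od z)"] K B C1 unfolding \<Psi>_def by (simp add: add_increasing2)
    show "\<bar>\<Psi>' z\<bar> \<le> C1 * K + (B1 * K + C1 * (K * B2))" for z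
    proof -
      have "\<bar>\<Psi>' z\<bar> \<le> B1 * K + C1 * (K * B2)"
        unfolding \<Psi>'_def by (rule order_trans[OF abs_triangle_ineq add_mono[OF b2 b3]])
      moreover have "0 \<le> C1 * K" using K C1 by simp
      ultimately show ?thesis by linarith
    qed
    show "((\<lambda>t. \<Psi> (\<lambda>i. z i + t * L i h)) has_real_derivative \<Psi>' (\<lambda>i. z i + y * L i h)) (at y)" for z y
      unfolding \<Psi>_def \<Psi>'_def P1_def P2_def lin
      by (rule derivative_eq_intros cyl_data_line_derivative[OF d1] DERIV_chain2[OF der] cyl_data_line_derivative[OF d2] refl)+
         (simp add: algebra_simps)
  qed
  moreover have "\<Psi>' (\<lambda>i. L i x) = partial_H \<mu> h f x * \<theta> (F x) + f x * (\<theta>' (F x) * partial_H \<mu> h F x)" for x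
    unfolding f_eq F_eq partial_H_cyl[OF d1 h] partial_H_cyl[OF d2 h] by (simp add: \<Psi>'_def P1_def P2_def L)
  moreover have "\<Psi> (\<lambda>i. L i x) = f x * \<theta> (F x)" for x
    by (simp add: f_eq F_eq \<Psi>_def L)
  ultimately show ?thesis by simp
qed

end

section \<open>Weights with logarithm in a Sobolev space\<close>

lemma powr_add_le:
  fixes a b t :: real
  assumes "0 \<le> a" "0 \<le> b" "0 \<le> t"
  shows "(a + b) powr t \<le> 2 powr t * (a powr t + b powr t)"
proof -
  have "(a + b) powr t \<le> (2 * max a b) powr t"
    using assms by (intro powr_mono2) auto
  also have "\<dots> = 2 powr t * (max a b) powr t"
    using assms by (simp add: powr_mult)
  also have "\<dots> \<le> 2 powr t * (a powr t + b powr t)"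
    by (intro mult_left_mono) (auto simp: max_def)
  finally show ?thesis .
qed

text \<open>Young's inequality with second factor 1 gives integrability. Applied to
  \<open>X x / c\<close>, where \<open>c\<close> is the \<open>t\<close>-norm of \<open>X\<close>,
  it gives the constant 1 in the estimate, as the conjugate weights \<open>1 / t\<close> and
  \<open>1 / q\<close> add up to 1.\<close>

lemma (in prob_space) power_mean_integral:
  fixes X :: "'a \<Rightarrow> real"
  assumes [measurable]: "X \<in> borel_measurable M" and X: "\<And>x. 0 \<le> X x" and t: "1 < t"
    and int: "integrable M (\<lambda>x. X x powr t)"
  shows "integrable M X" "(\<integral>x. X x \<partial>M) \<le> (\<integral>x. X x powr t \<partial>M) powr (1 / t)"
proof -
  define q where "q = t / (t - 1)"
  have q: "q > 1" "1 / t + 1 / q = 1" using t by (auto simp: q_def field_simps)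
  have Y: "a \<le> a powr t / t + 1 / q" if "0 \<le> a" for a :: real
    using Youngs_inequality[OF t q that, of 1] by simp
  show iX: "integrable M X"
  proof (rule Bochner_Integration.integrable_bound)
    show "integrable M (\<lambda>x. X x powr t / t + 1 / q)" using int by simp
    show "AE x in M. norm (X x) \<le> norm (X x powr t / t + 1 / q)"
      using Y X by (auto intro: order_trans[OF _ abs_ge_self])
  qed measurable
  define N where "N = (\<integral>x. X x powr t \<partial>M)"
  have N: "N \<ge> 0" unfolding N_def by simp
  show "(\<integral>x. X x \<partial>M) \<le> (\<integral>x. X x powr t \<partial>M) powr (1 / t)"
  proof (cases "N = 0")
    case True
    then have "AE x in M. X x powr t = 0"
      using integral_nonneg_eq_0_iff_AE[OF int] by (simp add: N_def)
    then have "AE x in M. X x = 0" by simp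
    then have "(\<integral>x. X x \<partial>M) = (\<integral>x. 0 \<partial>M)" by (intro integral_cong_AE) auto
    then show ?thesis by simp
  next
    case False
    define c where "c = N powr (1 / t)"
    have c: "c > 0" "c powr t = N" using False N t by (auto simp: c_def powr_powr)
    have "(\<integral>x. X x / c \<partial>M) \<le> (\<integral>x. X x powr t / N / t + 1 / q \<partial>M)"
    proof (rule integral_mono)
      show "X x / c \<le> X x powr t / N / t + 1 / q" for x
        using Y[of "X x / c"] X[of x] c by (simp add: powr_divide)
    qed (use iX int in auto)
    also have "\<dots> = N / N / t + 1 / q" using int prob_space by (simp add: N_def)
    also have "\<dots> = 1" using False q by simp
    finally show ?thesis using c by (simp add: N_def[symmetric] c_def[symmetric])
  qed
qed

section \<open>Moments, approximation in the Sobolev space and the two limits\<close>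

context gaussian_measure
begin

text \<open>Unless it vanishes almost everywhere, \<open>e\<close> has a normal law. This is
  \<open>decorrelated_distribution\<close> with all functionals equal to 0, where only coordinate 0
  matters: it is \<open>e\<close> on one side and the normal variable on the other.\<close>

lemma dual_closure_moments:
  assumes e: "e \<in> dual_closure \<mu>"
  shows "integrable \<mu> (\<lambda>x. \<bar>e x\<bar> ^ k)"
proof (cases "(\<integral>x. (e x)\<^sup>2 \<partial>\<mu>) = 0")
  case True
  note eL = dual_closure_L2[OF e]
  note [measurable] = L2_measurable[OF eL]
  have "AE x in \<mu>. (e x)\<^sup>2 = 0"
    using eL True integral_nonneg_eq_0_iff_AE[of \<mu> "\<lambda>x. (e x)\<^sup>2"] by (simp add: L2_def)
  then have e0: "AE x in \<mu>. e x = 0" by simp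
  show ?thesis
  proof (rule integrable_const_bound[of _ 1])
    show "AE x in \<mu>. norm (\<bar>e x\<bar> ^ k) \<le> 1" using e0 by eventually_elim (simp add: power_le_one)
  qed measurable
next
  case False
  note eL = dual_closure_L2[OF e]
  have [measurable]: "e \<in> borel_measurable borel" using L2_measurable[OF eL] by simp
  define \<sigma> where "\<sigma> = sqrt (\<integral>x. (e x)\<^sup>2 \<partial>\<mu>)"
  have s: "\<sigma> > 0" "(\<integral>x. (e x)\<^sup>2 \<partial>\<mu>) = \<sigma>\<^sup>2" using False by (simp_all add: \<sigma>_def less_le)
  define \<gamma> where "\<gamma> = density lborel (\<lambda>x. ennreal (normal_density 0 \<sigma> x))"
  interpret G: prob_space \<gamma> unfolding \<gamma>_def using s(1) by (rule prob_space_normal_density)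
  interpret P: pair_prob_space \<mu> \<gamma> ..
  have [measurable_cong]: "sets \<gamma> = sets borel" by (simp add: \<gamma>_def)
  define X :: "nat \<Rightarrow> 'a \<times> real \<Rightarrow> real" where "X = (\<lambda>k p. case k of 0 \<Rightarrow> snd p | Suc i \<Rightarrow> blinfun_apply (0 :: 'a \<Rightarrow>\<^sub>L real) (fst p) - 0 * e (fst p))"
  have Xd: "distr \<mu> (Pi\<^sub>M UNIV (\<lambda>_. borel)) (\<lambda>x k. X k (x, e x)) = distr (\<mu> \<Otimes>\<^sub>M \<gamma>) (Pi\<^sub>M UNIV (\<lambda>_. borel)) (\<lambda>p k. X k p)"
    unfolding X_def \<gamma>_def by (rule decorrelated_distribution[OF e s, of "\<lambda>_. 0" "\<lambda>_. 0"]) simp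
  have Xk: "X k \<in> borel_measurable (borel \<Otimes>\<^sub>M borel)" for k
    unfolding X_def by (cases k) auto
  have Xm1: "(\<lambda>p k. X k p) \<in> measurable (\<mu> \<Otimes>\<^sub>M \<gamma>) (Pi\<^sub>M UNIV (\<lambda>_. borel))"
    using Xk by (intro measurable_PiM_single') (auto cong: measurable_cong_sets sets_pair_measure_cong simp: \<gamma>_def)
  have Xm2: "(\<lambda>x k. X k (x, e x)) \<in> measurable \<mu> (Pi\<^sub>M UNIV (\<lambda>_. borel))"
    using Xk by (intro measurable_PiM_single' measurable_compose[OF _ Xk]) auto
  have F: "(\<lambda>\<omega>. \<bar>\<omega> 0\<bar> ^ k) \<in> borel_measurable (Pi\<^sub>M UNIV (\<lambda>_. borel :: real measure))" for k :: nat
    by measurable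
  have g: "integrable \<gamma> (\<lambda>y. \<bar>y\<bar> ^ k)"
    unfolding \<gamma>_def using integrable_normal_moment_abs[OF s(1), of 0 k] by (subst integrable_density) auto
  have "integrable (\<mu> \<Otimes>\<^sub>M \<gamma>) (\<lambda>p. \<bar>snd p\<bar> ^ k)"
    by (rule P.Fubini_integrable) (use g in auto)
  then have "integrable (distr (\<mu> \<Otimes>\<^sub>M \<gamma>) (Pi\<^sub>M UNIV (\<lambda>_. borel)) (\<lambda>p k. X k p)) (\<lambda>\<omega>. \<bar>\<omega> 0\<bar> ^ k)"
    unfolding integrable_distr_eq[OF Xm1 F] by (simp add: X_def)
  then show ?thesis
    unfolding Xd[symmetric] integrable_distr_eq[OF Xm2 F] by (simp add: X_def)
qed

lemma dual_closure_powr_integrable: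
  assumes e: "e \<in> dual_closure \<mu>" and p: "0 \<le> p"
  shows "integrable \<mu> (\<lambda>x. \<bar>e x\<bar> powr p)"
proof -
  note [measurable] = L2_measurable[OF dual_closure_L2[OF e]]
  obtain k where k: "p \<le> real k" using real_arch_simple by blast
  have "\<bar>a\<bar> powr p \<le> 1 + \<bar>a\<bar> ^ k" for a :: real
  proof (cases "\<bar>a\<bar> \<le> 1")
    case True
    then have "\<bar>a\<bar> powr p \<le> 1" using p by (intro powr_le1) auto
    then show ?thesis by (simp add: add_increasing2)
  next
    case False
    then have "\<bar>a\<bar> powr p \<le> \<bar>a\<bar> powr real k" using k by (intro powr_mono) auto
    then show ?thesis using False by (simp add: powr_realpow)
  qed
  then have le: "AE x in \<mu>. norm (\<bar>e x\<bar> powr p) \<le> norm (1 + \<bar>e x\<bar> ^ k)"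
    by (auto intro: order_trans[OF _ abs_ge_self])
  have "integrable \<mu> (\<lambda>x. 1 + \<bar>e x\<bar> ^ k)" using dual_closure_moments[OF e] by simp
  then show ?thesis by (rule Bochner_Integration.integrable_bound[OF _ _ le]) measurable
qed

text \<open>\<open>Lp_H\<close> asks for measurability of the pairings only; the norm is recovered
  as a measurable function from the \<open>1 / t\<close>-th power of an integrable one.\<close>

lemma Lp_H_D:
  assumes G: "G \<in> Lp_H \<mu> t" and t: "t > 1"
  shows "G x \<in> cameron_martin \<mu>" "h \<in> cameron_martin \<mu> \<Longrightarrow> (\<lambda>x. inner_H \<mu> (G x) h) \<in> borel_measurable \<mu>"
    "integrable \<mu> (\<lambda>x. norm_H \<mu> (G x) powr t)" "(\<lambda>x. norm_H \<mu> (G x)) \<in> borel_measurable \<mu>"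
proof -
  show "G x \<in> cameron_martin \<mu>" "h \<in> cameron_martin \<mu> \<Longrightarrow> (\<lambda>x. inner_H \<mu> (G x) h) \<in> borel_measurable \<mu>"
    and int: "integrable \<mu> (\<lambda>x. norm_H \<mu> (G x) powr t)" using G unfolding Lp_H_def by auto
  have "(\<lambda>x. (norm_H \<mu> (G x) powr t) powr (1 / t)) \<in> borel_measurable \<mu>"
    using borel_measurable_integrable[OF int] by measurable
  also have "(\<lambda>x. (norm_H \<mu> (G x) powr t) powr (1 / t)) = (\<lambda>x. norm_H \<mu> (G x))"
    using t by (simp add: powr_powr)
  finally show "(\<lambda>x. norm_H \<mu> (G x)) \<in> borel_measurable \<mu>" .
qed

text \<open>Expanding the squared norm reduces measurability to pairings: the gradient of
  \<open>F\<close> combines the fixed vectors \<open>R_op \<mu> (l i)\<close> with measurable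
  coefficients, and these vectors can be paired with \<open>G\<close> by its weak measurability.
  Since the gradient of \<open>F\<close> is bounded, integrability is inherited from
  \<open>G\<close>.\<close>

lemma grad_H_diff_integrable:
  assumes F: "F \<in> FCb" and G: "G \<in> Lp_H \<mu> t" and t: "t > 1"
  shows "grad_H \<mu> F x \<in> cameron_martin \<mu>"
    and "(\<lambda>x. norm_H \<mu> (grad_H \<mu> F x - G x)) \<in> borel_measurable \<mu>"
    and "integrable \<mu> (\<lambda>x. norm_H \<mu> (grad_H \<mu> F x - G x) powr t)"
proof -
  obtain n \<phi> D C and l :: "nat \<Rightarrow> 'a \<Rightarrow>\<^sub>L real" where d: "cyl_data n \<phi> D C" and f: "F = (\<lambda>x. \<phi> (\<lambda>i. blinfun_apply (l i) x))"
    using FCb_cyl_data[OF F] .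
  define v where "v = grad_H \<mu> F"
  note GD = Lp_H_D[OF G t]
  have v: "v x \<in> cameron_martin \<mu>" for x
    unfolding v_def f by (rule grad_H_cyl_cameron_martin(1)[OF d])
  then show "grad_H \<mu> F x \<in> cameron_martin \<mu>" by (simp add: v_def)
  have vh: "inner_H \<mu> (v x) h = (\<Sum>i<n. D i (\<lambda>i. l i x) * inner_H \<mu> (R_op \<mu> (l i)) h)"
    if "h \<in> cameron_martin \<mu>" for x h
    unfolding v_def f by (rule grad_H_cyl_cameron_martin(2)[OF d that])
  note [measurable] = measurable_compose[OF dual_seq_measurable cyl_dataD(2)[OF d]] GD(4)
  have [measurable]: "(\<lambda>x. inner_H \<mu> (R_op \<mu> (l i)) (G x)) \<in> borel_measurable \<mu>" for i
    using GD(2)[OF R_op_dual_cameron_martin[of "l i"]] by (simp add: inner_H_commute[of "R_op \<mu> (l i)"])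
  have [measurable]: "(\<lambda>x. inner_H \<mu> (R_op \<mu> (l i)) (v x)) \<in> borel_measurable \<mu>" for i
    unfolding inner_H_commute[of "R_op \<mu> (l i)"] vh[OF R_op_dual_cameron_martin] by measurable
  have m1: "(\<lambda>x. inner_H \<mu> (v x) (v x)) \<in> borel_measurable \<mu>" unfolding vh[OF v] by measurable
  have m2: "(\<lambda>x. inner_H \<mu> (v x) (G x)) \<in> borel_measurable \<mu>" unfolding vh[OF GD(1)] by measurable
  have m3: "(\<lambda>x. inner_H \<mu> (G x) (G x)) \<in> borel_measurable \<mu>" unfolding norm_H_sq[symmetric] by measurable
  have sq: "inner_H \<mu> (v x - G x) (v x - G x) = inner_H \<mu> (v x) (v x) - 2 * inner_H \<mu> (v x) (G x) + inner_H \<mu> (G x) (G x)" for x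
  proof -
    note CM = cameron_martin_diff(1)[OF v[of x] GD(1)[of x]]
    show ?thesis
      unfolding cameron_martin_diff(2)[OF v[of x] GD(1)[of x] CM]
        inner_H_commute[of "v x" "v x - G x"] inner_H_commute[of "G x" "v x - G x"]
        cameron_martin_diff(2)[OF v[of x] GD(1)[of x] v[of x]] cameron_martin_diff(2)[OF v[of x] GD(1)[of x] GD(1)[of x]]
        inner_H_commute[of "G x" "v x"] by simp
  qed
  show m: "(\<lambda>x. norm_H \<mu> (grad_H \<mu> F x - G x)) \<in> borel_measurable \<mu>"
    unfolding norm_H_def v_def[symmetric] sq using m1 m2 m3 by measurable
  define B where "B = (\<Sum>i<n. C * norm_H \<mu> (R_op \<mu> (l i)))"
  \<comment> \<open>Pairing \<open>v x\<close> with itself bounds the square of its norm by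
    \<open>B\<close> times its norm.\<close>
  have B: "norm_H \<mu> (v x) \<le> B" for x
  proof -
    have "norm_H \<mu> (v x) * norm_H \<mu> (v x) = (\<Sum>i<n. D i (\<lambda>i. l i x) * inner_H \<mu> (R_op \<mu> (l i)) (v x))"
      unfolding vh[OF v, symmetric] norm_H_sq[symmetric] by (simp add: power2_eq_square)
    also have "\<dots> \<le> (\<Sum>i<n. C * (norm_H \<mu> (R_op \<mu> (l i)) * norm_H \<mu> (v x)))"
    proof (rule sum_mono)
      fix i
      have "\<bar>D i (\<lambda>i. l i x) * inner_H \<mu> (R_op \<mu> (l i)) (v x)\<bar> \<le> C * (norm_H \<mu> (R_op \<mu> (l i)) * norm_H \<mu> (v x))"
        unfolding abs_mult
        by (intro mult_mono cyl_dataD(4)[OF d] inner_H_Cauchy_Schwarz[OF R_op_dual_cameron_martin v] cyl_dataD(5)[OF d]) auto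
      then show "D i (\<lambda>i. l i x) * inner_H \<mu> (R_op \<mu> (l i)) (v x) \<le> C * (norm_H \<mu> (R_op \<mu> (l i)) * norm_H \<mu> (v x))"
        by linarith
    qed
    also have "\<dots> = B * norm_H \<mu> (v x)" by (simp add: B_def sum_distrib_right mult.assoc)
    finally have le: "norm_H \<mu> (v x) * norm_H \<mu> (v x) \<le> B * norm_H \<mu> (v x)" .
    have B0: "0 \<le> B" unfolding B_def using cyl_dataD(5)[OF d] by (simp add: sum_nonneg)
    show ?thesis
    proof (cases "norm_H \<mu> (v x) = 0")
      case True then show ?thesis using B0 by simp
    next
      case False
      then have "norm_H \<mu> (v x) > 0" using norm_H_nonneg[of "v x"] by linarith
      then show ?thesis using le by simp
    qed
  qed
  have B0: "0 \<le> B" using B[of undefined] norm_H_nonneg[of "v undefined"] by linarith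
  show "integrable \<mu> (\<lambda>x. norm_H \<mu> (grad_H \<mu> F x - G x) powr t)"
  proof (rule Bochner_Integration.integrable_bound)
    show "integrable \<mu> (\<lambda>x. 2 powr t * (B powr t + norm_H \<mu> (G x) powr t))"
      using GD(3) by simp
    show "AE x in \<mu>. norm (norm_H \<mu> (grad_H \<mu> F x - G x) powr t) \<le> norm (2 powr t * (B powr t + norm_H \<mu> (G x) powr t))"
    proof (rule AE_I2)
      fix x
      have "norm_H \<mu> (v x - G x) \<le> B + norm_H \<mu> (G x)"
        using norm_H_triangle[OF v[of x] GD(1)[of x]] B[of x] by linarith
      then have "norm_H \<mu> (v x - G x) powr t \<le> (B + norm_H \<mu> (G x)) powr t"
        using t by (intro powr_mono2) auto
      also have "\<dots> \<le> 2 powr t * (B powr t + norm_H \<mu> (G x) powr t)"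
        using t B0 by (intro powr_add_le) auto
      finally show "norm (norm_H \<mu> (grad_H \<mu> F x - G x) powr t) \<le> norm (2 powr t * (B powr t + norm_H \<mu> (G x) powr t))"
        by (simp add: v_def)
    qed
  qed (use m in measurable)
qed

lemma Lp_diff_integrable:
  assumes F: "F \<in> FCb" and u: "u \<in> Lp \<mu> t" and t: "t > 1"
  shows "integrable \<mu> (\<lambda>x. \<bar>F x - u x\<bar> powr t)"
proof -
  obtain C where C: "\<And>x. \<bar>F x\<bar> \<le> C" using FCb_bounded_measurable(2)[OF F] by blast
  have C0: "0 \<le> C" using C[of undefined] by linarith
  have [measurable]: "F \<in> borel_measurable \<mu>" "u \<in> borel_measurable \<mu>"
    using FCb_bounded_measurable(1)[OF F] u by (auto simp: Lp_def)
  show ?thesis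
  proof (rule Bochner_Integration.integrable_bound)
    show "integrable \<mu> (\<lambda>x. 2 powr t * (C powr t + \<bar>u x\<bar> powr t))"
      using u by (simp add: Lp_def)
    show "AE x in \<mu>. norm (\<bar>F x - u x\<bar> powr t) \<le> norm (2 powr t * (C powr t + \<bar>u x\<bar> powr t))"
    proof (rule AE_I2)
      fix x
      have "\<bar>F x - u x\<bar> \<le> C + \<bar>u x\<bar>" using C[of x] by linarith
      then have "\<bar>F x - u x\<bar> powr t \<le> (C + \<bar>u x\<bar>) powr t" using t by (intro powr_mono2) auto
      also have "\<dots> \<le> 2 powr t * (C powr t + \<bar>u x\<bar> powr t)" using t C0 by (intro powr_add_le) auto
      finally show "norm (\<bar>F x - u x\<bar> powr t) \<le> norm (2 powr t * (C powr t + \<bar>u x\<bar> powr t))" by simp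
    qed
  qed measurable
qed

text \<open>\<open>power_mean_integral\<close> weakens Sobolev convergence to convergence in mean,
  and a subsequence of the functions then converges almost everywhere. Pointwise convergence is what
  continuous nonlinearities can use; the gradients enter linearly, and for them convergence in mean
  is enough.\<close>

lemma sobolev_approximation:
  assumes grad: "has_sobolev_grad \<mu> t u G" and t: "t > 1"
  obtains F where "\<And>n. F n \<in> FCb" "AE x in \<mu>. (\<lambda>n. F n x) \<longlonglongrightarrow> u x"
    "(\<lambda>n. \<integral>x. norm_H \<mu> (grad_H \<mu> (F n) x - G x) \<partial>\<mu>) \<longlonglongrightarrow> 0"
proof -
  obtain F where u: "u \<in> Lp \<mu> t" and G: "G \<in> Lp_H \<mu> t" and F: "\<And>n. F n \<in> FCb"
    and lim: "(\<lambda>n. Lp_norm \<mu> t (\<lambda>x. F n x - u x) + Lp_H_norm \<mu> t (\<lambda>x. grad_H \<mu> (F n) x - G x)) \<longlonglongrightarrow> 0"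
    using grad unfolding has_sobolev_grad_def by blast
  have [measurable]: "F n \<in> borel_measurable \<mu>" "u \<in> borel_measurable \<mu>" for n
    using FCb_bounded_measurable(1)[OF F] u by (auto simp: Lp_def)
  note g = grad_H_diff_integrable[OF F G t]
  have X: "integrable \<mu> (\<lambda>x. \<bar>F n x - u x\<bar>)" "(\<integral>x. \<bar>F n x - u x\<bar> \<partial>\<mu>) \<le> Lp_norm \<mu> t (\<lambda>x. F n x - u x)" for n
    using power_mean_integral[of "\<lambda>x. \<bar>F n x - u x\<bar>" t] Lp_diff_integrable[OF F u t, of n] t
    by (auto simp: Lp_norm_def)
  have Y: "(\<integral>x. norm_H \<mu> (grad_H \<mu> (F n) x - G x) \<partial>\<mu>) \<le> Lp_H_norm \<mu> t (\<lambda>x. grad_H \<mu> (F n) x - G x)" for n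
    using power_mean_integral(2)[of "\<lambda>x. norm_H \<mu> (grad_H \<mu> (F n) x - G x)" t] g(2,3)[of n] t
    by (auto simp: Lp_H_norm_def)
  have nn: "0 \<le> Lp_norm \<mu> t (\<lambda>x. F n x - u x)" "0 \<le> Lp_H_norm \<mu> t (\<lambda>x. grad_H \<mu> (F n) x - G x)" for n
    by (simp_all add: Lp_norm_def Lp_H_norm_def)
  have L1: "(\<lambda>n. \<integral>x. norm (F n x - u x) \<partial>\<mu>) \<longlonglongrightarrow> 0"
    by (rule tendsto_zero_le[OF _ lim]) (use X(2) nn(2) in \<open>auto intro: add_increasing2\<close>)
  have L2': "(\<lambda>n. \<integral>x. norm_H \<mu> (grad_H \<mu> (F n) x - G x) \<partial>\<mu>) \<longlonglongrightarrow> 0"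
    by (rule tendsto_zero_le[OF _ lim]) (use Y nn(1) in \<open>auto intro: add_increasing\<close>)
  have "integrable \<mu> (\<lambda>x. F n x - u x)" for n
    using X(1)[of n] integrable_abs_cancel[of \<mu> "\<lambda>x. F n x - u x"] by simp
  from tendsto_L1_AE_subseq[OF this L1]
  obtain r :: "nat \<Rightarrow> nat" where r: "strict_mono r" "AE x in \<mu>. (\<lambda>n. F (r n) x - u x) \<longlonglongrightarrow> 0" by blast
  show thesis
  proof (rule that[of "\<lambda>n. F (r n)"])
    show "AE x in \<mu>. (\<lambda>n. F (r n) x) \<longlonglongrightarrow> u x"
      using r(2) by eventually_elim (simp add: LIM_zero_iff)
    show "(\<lambda>n. \<integral>x. norm_H \<mu> (grad_H \<mu> (F (r n)) x - G x) \<partial>\<mu>) \<longlonglongrightarrow> 0"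
      using LIMSEQ_subseq_LIMSEQ[OF L2' r(1)] by (simp add: comp_def)
  qed (rule F)
qed

text \<open>In \<open>\<theta>' (F n x) * partial_H \<mu> h (F n) x\<close> both factors vary with
  \<open>n\<close>. Replacing the second by its limit \<open>g\<close> leaves a term for dominated
  convergence, as \<open>\<theta>'\<close> is bounded and \<open>g\<close> integrable; the error is
  a constant times the mean distance of the gradients.\<close>

lemma sobolev_integration_by_parts:
  fixes \<theta> \<theta>' :: "real \<Rightarrow> real"
  assumes f: "f \<in> FCb" and h: "h \<in> cameron_martin \<mu>" and grad: "has_sobolev_grad \<mu> t u G" and t: "t > 1"
    and der: "\<And>r. (\<theta> has_real_derivative \<theta>' r) (at r)" and cont: "continuous_on UNIV \<theta>'"
    and bd: "\<And>r. \<bar>\<theta> r\<bar> \<le> K" "\<And>r. \<bar>\<theta>' r\<bar> \<le> K"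
  shows "(\<integral>x. partial_H \<mu> h f x * \<theta> (u x) + f x * (\<theta>' (u x) * inner_H \<mu> (G x) h) \<partial>\<mu>)
    = (\<integral>x. f x * \<theta> (u x) * hat \<mu> h x \<partial>\<mu>)"
proof -
  obtain F where F: "\<And>n. F n \<in> FCb" and lim: "AE x in \<mu>. (\<lambda>n. F n x) \<longlonglongrightarrow> u x"
    and glim: "(\<lambda>n. \<integral>x. norm_H \<mu> (grad_H \<mu> (F n) x - G x) \<partial>\<mu>) \<longlonglongrightarrow> 0"
    using sobolev_approximation[OF grad t] by blast
  have G: "G \<in> Lp_H \<mu> t" and u: "u \<in> Lp \<mu> t" using grad by (auto simp: has_sobolev_grad_def)
  note GD = Lp_H_D[OF G t] and gd = grad_H_diff_integrable[OF F G t]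
  have cont\<theta>: "continuous_on UNIV \<theta>"
    using der by (auto intro!: continuous_at_imp_continuous_on DERIV_isCont)
  have [measurable]: "\<theta> \<in> borel_measurable borel" "\<theta>' \<in> borel_measurable borel"
    using cont\<theta> cont by (auto intro: borel_measurable_continuous_onI)
  have [measurable]: "F n \<in> borel_measurable \<mu>" "u \<in> borel_measurable \<mu>" "f \<in> borel_measurable \<mu>"
    "partial_H \<mu> h f \<in> borel_measurable \<mu>" "partial_H \<mu> h (F n) \<in> borel_measurable \<mu>"
    "hat \<mu> h \<in> borel_measurable \<mu>" for n
    using FCb_bounded_measurable(1)[OF F] FCb_bounded_measurable(1)[OF f] u
      partial_H_bounded_measurable(1)[OF f h] partial_H_bounded_measurable(1)[OF F h] L2_measurable[OF hat_L2[OF h]]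
    by (auto simp: Lp_def)
  define g where "g x = inner_H \<mu> (G x) h" for x
  have [measurable]: "g \<in> borel_measurable \<mu>" unfolding g_def by (rule GD(2)[OF h])
  have iG: "integrable \<mu> (\<lambda>x. norm_H \<mu> (G x))"
    using power_mean_integral(1)[OF GD(4) _ t GD(3)] by simp
  have ig: "integrable \<mu> g"
  proof (rule Bochner_Integration.integrable_bound)
    show "integrable \<mu> (\<lambda>x. norm_H \<mu> (G x) * norm_H \<mu> h)" using iG by simp
    show "AE x in \<mu>. norm (g x) \<le> norm (norm_H \<mu> (G x) * norm_H \<mu> h)"
      using inner_H_Cauchy_Schwarz[OF GD(1) h] by (simp add: g_def)
  qed measurable
  obtain A where A: "\<And>x. \<bar>f x\<bar> \<le> A" using FCb_bounded_measurable(2)[OF f] by blast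
  obtain A' where A': "\<And>x. \<bar>partial_H \<mu> h f x\<bar> \<le> A'" using partial_H_bounded_measurable(2)[OF f h] by blast
  have nn: "0 \<le> A" "0 \<le> A'" "0 \<le> K" using A[of undefined] A'[of undefined] bd(1)[of 0] by linarith+
  have \<theta>lim: "AE x in \<mu>. (\<lambda>n. \<theta> (F n x)) \<longlonglongrightarrow> \<theta> (u x)" "AE x in \<mu>. (\<lambda>n. \<theta>' (F n x)) \<longlonglongrightarrow> \<theta>' (u x)"
  proof -
    show "AE x in \<mu>. (\<lambda>n. \<theta> (F n x)) \<longlonglongrightarrow> \<theta> (u x)"
      using lim by eventually_elim (rule continuous_on_tendsto_compose[OF cont\<theta>], auto)
    show "AE x in \<mu>. (\<lambda>n. \<theta>' (F n x)) \<longlonglongrightarrow> \<theta>' (u x)"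
      using lim by eventually_elim (rule continuous_on_tendsto_compose[OF cont], auto)
  qed
  define Y where "Y n x = norm_H \<mu> (grad_H \<mu> (F n) x - G x)" for n x
  have [measurable]: "Y n \<in> borel_measurable \<mu>" for n unfolding Y_def by (rule gd(2))
  have iY: "integrable \<mu> (Y n)" for n
    unfolding Y_def using power_mean_integral(1)[OF gd(2) _ t gd(3)] by simp
  have pY: "\<bar>partial_H \<mu> h (F n) x - g x\<bar> \<le> Y n x * norm_H \<mu> h" for n x
    unfolding partial_H_def g_def Y_def cameron_martin_diff(2)[OF gd(1) GD(1) h, symmetric]
    by (rule inner_H_Cauchy_Schwarz[OF cameron_martin_diff(1)[OF gd(1) GD(1)] h])
  have Klim: "(\<lambda>n. \<integral>x. partial_H \<mu> h f x * \<theta> (F n x) + f x * (\<theta>' (F n x) * g x) \<partial>\<mu>) \<longlonglongrightarrow>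
    (\<integral>x. partial_H \<mu> h f x * \<theta> (u x) + f x * (\<theta>' (u x) * g x) \<partial>\<mu>)"
  proof (rule integral_dominated_convergence[where w = "\<lambda>x. A' * K + A * (K * \<bar>g x\<bar>)"])
    show "AE x in \<mu>. (\<lambda>n. partial_H \<mu> h f x * \<theta> (F n x) + f x * (\<theta>' (F n x) * g x))
        \<longlonglongrightarrow> partial_H \<mu> h f x * \<theta> (u x) + f x * (\<theta>' (u x) * g x)"
      using \<theta>lim by eventually_elim (intro tendsto_intros)
    have "\<bar>partial_H \<mu> h f x * \<theta> r + f x * (\<theta>' r * g x)\<bar> \<le> A' * K + A * (K * \<bar>g x\<bar>)" for x r
      by (rule order_trans[OF abs_triangle_ineq], unfold abs_mult)
        (intro add_mono mult_mono A A' bd nn mult_nonneg_nonneg abs_ge_zero order_refl)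
    then show "AE x in \<mu>. norm (partial_H \<mu> h f x * \<theta> (F n x) + f x * (\<theta>' (F n x) * g x)) \<le> A' * K + A * (K * \<bar>g x\<bar>)" for n
      by simp
    show "integrable \<mu> (\<lambda>x. A' * K + A * (K * \<bar>g x\<bar>))" using ig by simp
  qed measurable
  have i1: "integrable \<mu> (\<lambda>x. partial_H \<mu> h f x * \<theta> (F n x) + f x * (\<theta>' (F n x) * g x))" for n
  proof (rule Bochner_Integration.integrable_bound)
    show "integrable \<mu> (\<lambda>x. A' * K + A * (K * \<bar>g x\<bar>))" using ig by simp
    have "\<bar>partial_H \<mu> h f x * \<theta> r + f x * (\<theta>' r * g x)\<bar> \<le> A' * K + A * (K * \<bar>g x\<bar>)" for x r
      by (rule order_trans[OF abs_triangle_ineq], unfold abs_mult)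
        (intro add_mono mult_mono A A' bd nn mult_nonneg_nonneg abs_ge_zero order_refl)
    then show "AE x in \<mu>. norm (partial_H \<mu> h f x * \<theta> (F n x) + f x * (\<theta>' (F n x) * g x)) \<le> norm (A' * K + A * (K * \<bar>g x\<bar>))"
      by (auto intro: order_trans[OF _ abs_ge_self])
  qed measurable
  have eb: "\<bar>f x * (\<theta>' (F n x) * (partial_H \<mu> h (F n) x - g x))\<bar> \<le> A * (K * (Y n x * norm_H \<mu> h))" for n x
    unfolding abs_mult by (intro mult_mono A bd pY nn mult_nonneg_nonneg abs_ge_zero)
  have i2: "integrable \<mu> (\<lambda>x. f x * (\<theta>' (F n x) * (partial_H \<mu> h (F n) x - g x)))" for n
  proof (rule Bochner_Integration.integrable_bound)
    show "integrable \<mu> (\<lambda>x. A * (K * (Y n x * norm_H \<mu> h)))" using iY[of n] by simp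
    show "AE x in \<mu>. norm (f x * (\<theta>' (F n x) * (partial_H \<mu> h (F n) x - g x))) \<le> norm (A * (K * (Y n x * norm_H \<mu> h)))"
      using eb by (auto intro: order_trans[OF _ abs_ge_self])
  qed measurable
  have err: "(\<lambda>n. \<integral>x. f x * (\<theta>' (F n x) * (partial_H \<mu> h (F n) x - g x)) \<partial>\<mu>) \<longlonglongrightarrow> 0"
  proof (rule tendsto_zero_le)
    show "\<bar>\<integral>x. f x * (\<theta>' (F n x) * (partial_H \<mu> h (F n) x - g x)) \<partial>\<mu>\<bar> \<le> A * K * norm_H \<mu> h * (\<integral>x. Y n x \<partial>\<mu>)" for n
    proof -
      have "\<bar>\<integral>x. f x * (\<theta>' (F n x) * (partial_H \<mu> h (F n) x - g x)) \<partial>\<mu>\<bar>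
        \<le> (\<integral>x. \<bar>f x * (\<theta>' (F n x) * (partial_H \<mu> h (F n) x - g x))\<bar> \<partial>\<mu>)"
        by (rule integral_abs_bound)
      also have "\<dots> \<le> (\<integral>x. A * K * norm_H \<mu> h * Y n x \<partial>\<mu>)"
      proof (rule integral_mono)
        show "integrable \<mu> (\<lambda>x. \<bar>f x * (\<theta>' (F n x) * (partial_H \<mu> h (F n) x - g x))\<bar>)"
          using i2[of n] by (rule integrable_abs)
        show "integrable \<mu> (\<lambda>x. A * K * norm_H \<mu> h * Y n x)" using iY[of n] by simp
        fix x
        have "A * (K * (Y n x * norm_H \<mu> h)) = A * K * norm_H \<mu> h * Y n x" by simp
        then show "\<bar>f x * (\<theta>' (F n x) * (partial_H \<mu> h (F n) x - g x))\<bar> \<le> A * K * norm_H \<mu> h * Y n x"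
          using eb by metis
      qed
      finally show ?thesis by simp
    qed
    show "(\<lambda>n. A * K * norm_H \<mu> h * (\<integral>x. Y n x \<partial>\<mu>)) \<longlonglongrightarrow> 0"
      using tendsto_mult[OF tendsto_const glim, of "A * K * norm_H \<mu> h"] by (simp add: Y_def)
  qed
  have ibp: "(\<integral>x. partial_H \<mu> h f x * \<theta> (F n x) + f x * (\<theta>' (F n x) * g x) \<partial>\<mu>)
      + (\<integral>x. f x * (\<theta>' (F n x) * (partial_H \<mu> h (F n) x - g x)) \<partial>\<mu>) = (\<integral>x. f x * \<theta> (F n x) * hat \<mu> h x \<partial>\<mu>)" for n
  proof -
    have "(\<integral>x. f x * \<theta> (F n x) * hat \<mu> h x \<partial>\<mu>) =
      (\<integral>x. partial_H \<mu> h f x * \<theta> (F n x) + f x * (\<theta>' (F n x) * partial_H \<mu> h (F n) x) \<partial>\<mu>)"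
      by (rule product_integration_by_parts[OF f F h der _ bd, symmetric]) measurable
    also have "\<dots> = (\<integral>x. (partial_H \<mu> h f x * \<theta> (F n x) + f x * (\<theta>' (F n x) * g x))
        + f x * (\<theta>' (F n x) * (partial_H \<mu> h (F n) x - g x)) \<partial>\<mu>)"
      by (simp add: algebra_simps)
    finally show ?thesis using i1[of n] i2[of n] by simp
  qed
  have "(\<lambda>n. \<integral>x. f x * \<theta> (F n x) * hat \<mu> h x \<partial>\<mu>) \<longlonglongrightarrow> (\<integral>x. f x * \<theta> (u x) * hat \<mu> h x \<partial>\<mu>)"
  proof (rule integral_dominated_convergence[where w = "\<lambda>x. A * K * \<bar>hat \<mu> h x\<bar>"])
    show "AE x in \<mu>. (\<lambda>n. f x * \<theta> (F n x) * hat \<mu> h x) \<longlonglongrightarrow> f x * \<theta> (u x) * hat \<mu> h x"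
      using \<theta>lim(1) by eventually_elim (intro tendsto_intros)
    show "AE x in \<mu>. norm (f x * \<theta> (F n x) * hat \<mu> h x) \<le> A * K * \<bar>hat \<mu> h x\<bar>" for n
      unfolding real_norm_def abs_mult
      by (intro AE_I2 mult_mono A bd nn mult_nonneg_nonneg abs_ge_zero order_refl)
    show "integrable \<mu> (\<lambda>x. A * K * \<bar>hat \<mu> h x\<bar>)" using L2_integrable[OF hat_L2[OF h]] by simp
  qed measurable
  moreover have "(\<lambda>n. \<integral>x. f x * \<theta> (F n x) * hat \<mu> h x \<partial>\<mu>) \<longlonglongrightarrow>
    (\<integral>x. partial_H \<mu> h f x * \<theta> (u x) + f x * (\<theta>' (u x) * g x) \<partial>\<mu>)"
    using tendsto_add[OF Klim err] unfolding ibp by simp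
  ultimately show ?thesis unfolding g_def using LIMSEQ_unique by blast
qed

theorem log_sobolev_integration_by_parts:
  assumes s: "s > 1" "s' = s / (s - 1)" "t > s'" and w: "AE x in \<mu>. w x > 0" "w \<in> Lp \<mu> s"
    and grad: "has_sobolev_grad \<mu> t (\<lambda>x. ln (w x)) G"
    and f: "f \<in> FCb" and h: "h \<in> cameron_martin \<mu>"
  shows "integrable \<mu> (\<lambda>x. w x * partial_H \<mu> h f x)"
    and "integrable \<mu> (\<lambda>x. w x * (f x * (hat \<mu> h x - inner_H \<mu> (G x) h)))"
    and "(\<integral>x. w x * partial_H \<mu> h f x \<partial>\<mu>) = (\<integral>x. w x * (f x * (hat \<mu> h x - inner_H \<mu> (G x) h)) \<partial>\<mu>)"
proof -
  have s': "s' > 1" "1 / s + 1 / s' = 1" using s(1) unfolding s(2) by (auto simp: field_simps)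
  have t: "t > 1" using s' s(3) by linarith
  have G: "G \<in> Lp_H \<mu> t" using grad by (auto simp: has_sobolev_grad_def)
  note GD = Lp_H_D[OF G t]
  have [measurable]: "w \<in> borel_measurable \<mu>" "f \<in> borel_measurable \<mu>"
    "partial_H \<mu> h f \<in> borel_measurable \<mu>" "hat \<mu> h \<in> borel_measurable \<mu>"
    "(\<lambda>x. norm_H \<mu> (G x)) \<in> borel_measurable \<mu>"
    using w FCb_bounded_measurable(1)[OF f] partial_H_bounded_measurable(1)[OF f h] L2_measurable[OF hat_L2[OF h]] GD(4)
    by (auto simp: Lp_def)
  define g where "g x = inner_H \<mu> (G x) h" for x
  have [measurable]: "g \<in> borel_measurable \<mu>" unfolding g_def by (rule GD(2)[OF h])
  have iw: "integrable \<mu> (\<lambda>x. \<bar>w x\<bar> powr s)" using w(2) by (simp add: Lp_def)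
  \<comment> \<open>The duality of the exponents \<open>s\<close> and \<open>s'\<close>. Only
    integrability is wanted, so the pointwise inequality of Young takes the place of
    Hoelder's.\<close>
  have prod: "integrable \<mu> (\<lambda>x. w x * k x)"
    if [measurable]: "k \<in> borel_measurable \<mu>" and k: "integrable \<mu> (\<lambda>x. \<bar>k x\<bar> powr s')" for k
  proof (rule Bochner_Integration.integrable_bound)
    show "integrable \<mu> (\<lambda>x. \<bar>w x\<bar> powr s / s + \<bar>k x\<bar> powr s' / s')" using iw k by simp
    show "AE x in \<mu>. norm (w x * k x) \<le> norm (\<bar>w x\<bar> powr s / s + \<bar>k x\<bar> powr s' / s')"
      unfolding real_norm_def abs_mult
      by (intro AE_I2 order_trans[OF Youngs_inequality[OF s(1) s'] abs_ge_self]) auto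
  qed measurable
  have iw1: "integrable \<mu> (\<lambda>x. w x * 1)" by (rule prod) auto
  have iwe: "integrable \<mu> (\<lambda>x. w x * hat \<mu> h x)"
    using dual_closure_powr_integrable[OF hat(1)[OF h], of s'] s' by (intro prod) auto
  have iwG: "integrable \<mu> (\<lambda>x. w x * norm_H \<mu> (G x))"
  proof (rule prod)
    show "integrable \<mu> (\<lambda>x. \<bar>norm_H \<mu> (G x)\<bar> powr s')"
    proof (rule Bochner_Integration.integrable_bound)
      show "integrable \<mu> (\<lambda>x. 1 + norm_H \<mu> (G x) powr t)" using GD(3) by simp
      \<comment> \<open>Here \<open>t > s'\<close> enters: the \<open>t\<close>-th moment of the
        norm of \<open>G\<close> controls the \<open>s'\<close>-th on a probability space.\<close>
      have "a powr s' \<le> 1 + a powr t" if "0 \<le> a" for a :: real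
      proof (cases "a \<le> 1")
        case True
        then have "a powr s' \<le> 1" using that s' by (intro powr_le1) auto
        then show ?thesis by (simp add: add_increasing2)
      next
        case False
        then have "a powr s' \<le> a powr t" using s(3) by (intro powr_mono) auto
        then show ?thesis by simp
      qed
      then show "AE x in \<mu>. norm (\<bar>norm_H \<mu> (G x)\<bar> powr s') \<le> norm (1 + norm_H \<mu> (G x) powr t)"
        by simp
    qed measurable
  qed measurable
  have iwg: "integrable \<mu> (\<lambda>x. w x * g x)"
  proof (rule Bochner_Integration.integrable_bound)
    show "integrable \<mu> (\<lambda>x. (w x * norm_H \<mu> (G x)) * norm_H \<mu> h)" using iwG by simp
    show "AE x in \<mu>. norm (w x * g x) \<le> norm ((w x * norm_H \<mu> (G x)) * norm_H \<mu> h)"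
      using inner_H_Cauchy_Schwarz[OF GD(1) h]
      by (auto simp: g_def abs_mult mult.assoc intro!: mult_left_mono)
  qed measurable
  obtain A where A: "\<And>x. \<bar>f x\<bar> \<le> A" using FCb_bounded_measurable(2)[OF f] by blast
  obtain A' where A': "\<And>x. \<bar>partial_H \<mu> h f x\<bar> \<le> A'" using partial_H_bounded_measurable(2)[OF f h] by blast
  have nn: "0 \<le> A" "0 \<le> A'" using A[of undefined] A'[of undefined] by linarith+
  have bp: "integrable \<mu> (\<lambda>x. b x * v x)"
    if v: "integrable \<mu> v" and [measurable]: "b \<in> borel_measurable \<mu>" and b: "\<And>x. \<bar>b x\<bar> \<le> B" for b v :: "'a \<Rightarrow> real" and B
  proof (rule Bochner_Integration.integrable_bound)
    show "integrable \<mu> (\<lambda>x. B * v x)" using v by simp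
    show "AE x in \<mu>. norm (b x * v x) \<le> norm (B * v x)"
      using b by (auto simp: abs_mult intro!: mult_right_mono order_trans[OF b abs_ge_self])
  qed (use v in measurable)
  have i1: "integrable \<mu> (\<lambda>x. partial_H \<mu> h f x * (w x * 1))" by (rule bp[OF iw1 _ A']) measurable
  then show "integrable \<mu> (\<lambda>x. w x * partial_H \<mu> h f x)" by (simp add: mult.commute)
  have i2: "integrable \<mu> (\<lambda>x. f x * (w x * hat \<mu> h x))" by (rule bp[OF iwe _ A]) measurable
  have i3: "integrable \<mu> (\<lambda>x. f x * (w x * g x))" by (rule bp[OF iwg _ A]) measurable
  have eq: "w x * (f x * (hat \<mu> h x - inner_H \<mu> (G x) h)) = f x * (w x * hat \<mu> h x) - f x * (w x * g x)" for x
    by (simp add: g_def algebra_simps)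
  show "integrable \<mu> (\<lambda>x. w x * (f x * (hat \<mu> h x - inner_H \<mu> (G x) h)))"
    unfolding eq using i2 i3 by simp
  define c where "c n = inverse (real (Suc n))" for n
  have c: "c n > 0" for n by (simp add: c_def)
  \<comment> \<open>A logistic function, solving
    \<open>\<theta>' = \<theta> * (1 - c * \<theta>)\<close>; hence
    \<open>0 \<le> \<theta>' \<le> \<theta>\<close>, and a bound on \<open>\<theta>\<close> serves
    for \<open>\<theta>'\<close> as well.\<close>
  define \<theta> where "\<theta> n r = exp r / (1 + c n * exp r)" for n r
  define \<theta>' where "\<theta>' n r = exp r / (1 + c n * exp r)\<^sup>2" for n r
  have pos: "1 + c n * exp r > 0" for n r using c[of n] by (simp add: add_pos_pos)
  have \<theta>_nonneg: "0 \<le> \<theta> n r" "0 \<le> \<theta>' n r" for n r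
    using pos[of n r] by (simp_all add: \<theta>_def \<theta>'_def)
  have \<theta>'_le: "\<theta>' n r \<le> \<theta> n r" for n r
    unfolding \<theta>_def \<theta>'_def using pos[of n r] c[of n]
    by (intro divide_left_mono) (auto simp: power2_eq_square)
  have \<theta>_le: "\<theta> n r \<le> exp r" "\<theta> n r \<le> 1 / c n" for n r
    using pos[of n r] c[of n] by (simp_all add: \<theta>_def field_simps)
  \<comment> \<open>The bounds by \<open>1 / c n\<close> admit \<open>\<theta> n\<close> to the
    Sobolev formula for fixed \<open>n\<close>; those by \<open>exp r\<close>, which is
    \<open>w x\<close> at \<open>r = u x\<close>, are uniform in \<open>n\<close> and provide the
    dominating functions.\<close>
  have \<theta>_bd: "\<bar>\<theta> n r\<bar> \<le> 1 / c n" "\<bar>\<theta>' n r\<bar> \<le> 1 / c n" "\<bar>\<theta> n r\<bar> \<le> exp r" "\<bar>\<theta>' n r\<bar> \<le> exp r" for n r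
    using \<theta>_nonneg[of n r] \<theta>_le[of n r] \<theta>'_le[of n r] by auto
  have der: "(\<theta> n has_real_derivative \<theta>' n r) (at r)" for n r
    unfolding \<theta>_def[abs_def] \<theta>'_def using pos[of n r]
    by (auto intro!: derivative_eq_intros simp: field_simps power2_eq_square)
  have cont: "continuous_on UNIV (\<theta>' n)" "continuous_on UNIV (\<theta> n)" for n
    unfolding \<theta>'_def[abs_def] \<theta>_def[abs_def] using pos[of n]
    by (auto intro!: continuous_intros simp: less_imp_neq[THEN not_sym])
  have [measurable]: "\<theta> n \<in> borel_measurable borel" "\<theta>' n \<in> borel_measurable borel" for n
    using cont by (auto intro: borel_measurable_continuous_onI)
  have clim: "(\<lambda>n. 1 + c n * exp r) \<longlonglongrightarrow> 1" for r
    using tendsto_add[OF tendsto_const tendsto_mult[OF LIMSEQ_inverse_real_of_nat tendsto_const], of 1 "exp r"]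
    by (simp add: c_def)
  have \<theta>_lim: "(\<lambda>n. \<theta> n r) \<longlonglongrightarrow> exp r" "(\<lambda>n. \<theta>' n r) \<longlonglongrightarrow> exp r" for r
    using tendsto_divide[OF tendsto_const clim[of r], of "exp r"]
      tendsto_divide[OF tendsto_const tendsto_power[OF clim[of r], of 2], of "exp r"]
    by (simp_all add: \<theta>_def \<theta>'_def)
  define u where "u x = ln (w x)" for x
  have [measurable]: "u \<in> borel_measurable \<mu>" unfolding u_def by measurable
  \<comment> \<open>Positivity of \<open>w\<close> enters here: it makes \<open>exp\<close> undo
    \<open>ln\<close> almost everywhere.\<close>
  have eu: "AE x in \<mu>. exp (u x) = w x" using w(1) by eventually_elim (simp add: u_def)
  have ibp: "(\<integral>x. partial_H \<mu> h f x * \<theta> n (u x) + f x * (\<theta>' n (u x) * g x) \<partial>\<mu>)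
    = (\<integral>x. f x * \<theta> n (u x) * hat \<mu> h x \<partial>\<mu>)" for n
    unfolding g_def u_def by (rule sobolev_integration_by_parts[OF f h grad t der cont(1) \<theta>_bd(1,2)])
  have "(\<lambda>n. \<integral>x. partial_H \<mu> h f x * \<theta> n (u x) + f x * (\<theta>' n (u x) * g x) \<partial>\<mu>) \<longlonglongrightarrow>
    (\<integral>x. partial_H \<mu> h f x * w x + f x * (w x * g x) \<partial>\<mu>)"
  proof (rule integral_dominated_convergence[where w = "\<lambda>x. A' * \<bar>w x * 1\<bar> + A * \<bar>w x * g x\<bar>"])
    show "AE x in \<mu>. (\<lambda>n. partial_H \<mu> h f x * \<theta> n (u x) + f x * (\<theta>' n (u x) * g x))
        \<longlonglongrightarrow> partial_H \<mu> h f x * w x + f x * (w x * g x)"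
      using eu
    proof eventually_elim
      case (elim x)
      show ?case
        unfolding elim[symmetric] by (intro tendsto_intros \<theta>_lim)
    qed
    show "AE x in \<mu>. norm (partial_H \<mu> h f x * \<theta> n (u x) + f x * (\<theta>' n (u x) * g x))
        \<le> A' * \<bar>w x * 1\<bar> + A * \<bar>w x * g x\<bar>" for n
      using eu
    proof eventually_elim
      case (elim x)
      have "\<bar>\<theta> n (u x)\<bar> \<le> \<bar>w x\<bar>" "\<bar>\<theta>' n (u x)\<bar> \<le> \<bar>w x\<bar>"
        using \<theta>_bd(3,4)[of n "u x"] elim by auto
      then show ?case
        unfolding real_norm_def mult_1_right
        by (intro order_trans[OF abs_triangle_ineq] add_mono; unfold abs_mult)
          (intro mult_mono A A' nn mult_nonneg_nonneg abs_ge_zero order_refl; assumption)+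
    qed
    show "integrable \<mu> (\<lambda>x. A' * \<bar>w x * 1\<bar> + A * \<bar>w x * g x\<bar>)" using iw1 iwg by simp
  qed measurable
  moreover have "(\<lambda>n. \<integral>x. f x * \<theta> n (u x) * hat \<mu> h x \<partial>\<mu>) \<longlonglongrightarrow> (\<integral>x. f x * w x * hat \<mu> h x \<partial>\<mu>)"
  proof (rule integral_dominated_convergence[where w = "\<lambda>x. A * \<bar>w x * hat \<mu> h x\<bar>"])
    show "AE x in \<mu>. (\<lambda>n. f x * \<theta> n (u x) * hat \<mu> h x) \<longlonglongrightarrow> f x * w x * hat \<mu> h x"
      using eu
    proof eventually_elim
      case (elim x)
      show ?case
        unfolding elim[symmetric] by (intro tendsto_intros \<theta>_lim)
    qed
    show "AE x in \<mu>. norm (f x * \<theta> n (u x) * hat \<mu> h x) \<le> A * \<bar>w x * hat \<mu> h x\<bar>" for n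
      using eu
    proof eventually_elim
      case (elim x)
      have "\<bar>\<theta> n (u x)\<bar> \<le> \<bar>w x\<bar>"
        using \<theta>_bd(3)[of n "u x"] elim by auto
      then show ?case
        unfolding real_norm_def abs_mult mult.assoc
        by (intro mult_mono A nn mult_nonneg_nonneg abs_ge_zero order_refl; assumption)
    qed
    show "integrable \<mu> (\<lambda>x. A * \<bar>w x * hat \<mu> h x\<bar>)" using iwe by simp
  qed measurable
  ultimately have "(\<integral>x. partial_H \<mu> h f x * w x + f x * (w x * g x) \<partial>\<mu>) = (\<integral>x. f x * w x * hat \<mu> h x \<partial>\<mu>)"
    unfolding ibp using LIMSEQ_unique by blast
  then have "(\<integral>x. w x * partial_H \<mu> h f x \<partial>\<mu>) + (\<integral>x. f x * (w x * g x) \<partial>\<mu>) = (\<integral>x. f x * (w x * hat \<mu> h x) \<partial>\<mu>)"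
    using i1 i3 by (simp add: mult_ac)
  then show "(\<integral>x. w x * partial_H \<mu> h f x \<partial>\<mu>) = (\<integral>x. w x * (f x * (hat \<mu> h x - inner_H \<mu> (G x) h)) \<partial>\<mu>)"
    unfolding eq using i2 i3 by simp
qed

end

text \<open>Integrability is part of the conclusion because the Bochner integral of a function that
  is not integrable is 0 by convention, so the equation alone would say less. The derivative of
  \<open>log w\<close> is expressed by a version \<open>G\<close> of its Sobolev gradient, since
  \<open>partial_H\<close> refers to pointwise differentiability along \<open>H\<close>, which
  \<open>log w\<close> need not have.\<close>

theorem lemma3p1:
  fixes \<mu> \<nu> :: "'a::{banach, second_countable_topology} measure"
    and s s' t :: real
    and w f :: "'a \<Rightarrow> real"
    and G :: "'a \<Rightarrow> 'a"
    and h :: 'a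
  assumes "centered_gaussian \<mu>"
    and "nondegenerate \<mu>"
    and "s > 1"
    and "s' = s / (s - 1)"
    and "t > s'"
    and "AE x in \<mu>. w x > 0"
    and "w \<in> sobolev \<mu> s"
    and "precise \<mu> 1 s w"
    and "has_sobolev_grad \<mu> t (\<lambda>x. ln (w x)) G"
    and "\<nu> = density \<mu> (\<lambda>x. ennreal (w x))"
    and "f \<in> FCb"
    and "h \<in> cameron_martin \<mu>"
  shows "integrable \<nu> (partial_H \<mu> h f)
    \<and> integrable \<nu> (\<lambda>x. f x * (hat \<mu> h x - inner_H \<mu> (G x) h))
    \<and> (\<integral>x. partial_H \<mu> h f x \<partial>\<nu>)
        = (\<integral>x. f x * (hat \<mu> h x - inner_H \<mu> (G x) h) \<partial>\<nu>)"
proof -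
  interpret gaussian_measure \<mu> by unfold_locales (rule assms(1))
  have w: "w \<in> Lp \<mu> s" using assms(7) by (auto simp: sobolev_def has_sobolev_grad_def)
  have w0: "AE x in \<mu>. 0 \<le> w x" using assms(6) by eventually_elim simp
  have s': "s' > 1" using assms(3) unfolding assms(4) by (simp add: field_simps)
  with assms(5) have t: "t > 1" by linarith
  have G: "G \<in> Lp_H \<mu> t" using assms(9) by (simp add: has_sobolev_grad_def)
  have [measurable]: "w \<in> borel_measurable \<mu>" "f \<in> borel_measurable \<mu>" "hat \<mu> h \<in> borel_measurable \<mu>"
    "partial_H \<mu> h f \<in> borel_measurable \<mu>" "(\<lambda>x. inner_H \<mu> (G x) h) \<in> borel_measurable \<mu>"
    using w FCb_bounded_measurable(1)[OF assms(11)] L2_measurable[OF hat_L2[OF assms(12)]]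
      partial_H_bounded_measurable(1)[OF assms(11,12)] Lp_H_D(2)[OF G t assms(12)]
    by (auto simp: Lp_def)
  have m: "(\<lambda>x. f x * (hat \<mu> h x - inner_H \<mu> (G x) h)) \<in> borel_measurable \<mu>" by measurable
  note main = log_sobolev_integration_by_parts[OF assms(3-6) w assms(9,11,12)]
  show ?thesis
    \<comment> \<open>Integration against the density multiplies the integrands by \<open>w\<close>;
      its nonnegativity almost everywhere removes \<open>ennreal\<close>.\<close>
    unfolding assms(10)
    using main w0 m by (simp add: integrable_density integral_density)
qed

end
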